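(* Let $\{Z_t\}_{t\ge 0}$ be a theta-positive branching process in varying environment with parameters $(\theta,\{\lambda_t\},\{a_t\})$, where $\theta\in(0,1]$. The process is loosely subcritical if and only if $V_\theta=\infty$ and $\mu_t^{\theta}V_{t,\theta}$ does not have a limit in $[0,\infty]$ as $t\to\infty$. In this case, there are several (at least two) sequences $t'=\{t_n\}$ with $t_n\to\infty$ leading to different partial limits $M_\theta\in[0,\infty]$ in $$\mu_{t'}^{\theta}V_{t',\theta}\to M_\theta,\qquad t'\to\infty. \quad ( * )$$ Moreover, for any sequence $t'=\{t_n\}$, $t_n\to\infty$, the following hold. (a) If $( * )$ holds with $M_\theta=\infty$, then, as $t'\to\infty$, $$\mathrm{P}(Z_{t'}>0)\sim V_{t',\theta}^{-1/\theta},\qquad m_{t'}\sim\mu_{t'}V_{t',\theta}^{1/\theta},$$ and $$\lim_{t'\to\infty}\mathrm{E}\big(e^{-wZ_{t'}/m_{t'}}\mid Z_{t'}>0\big)=1-(1+w^{-\theta})^{-1/\theta},\qquad w\ge0$$ (the right-hand side being read as $1$ for $w=0$). (b) If $( * )$ holds with $0\le M_\theta<\infty$, then, as $t'\to\infty$, $\mu_{t'}\to0$, $$\mathrm{P}(Z_{t'}>0)\sim m^{-1}\mu_{t'},\qquad m_{t'}\to m,\qquad\text{where } m=\big(M_\theta+\theta(1+\theta)^{-1}\big)^{1/\theta},$$ and $$\mathrm{E}(s^{Z_{t'}}\mid Z_{t'}>0)\to1-m\big(M_\theta-(1+\theta)^{-1}+(1-s)^{-\theta}\big)^{-1/\theta},\qquad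 0\le s\le1$$ (the right-hand side being read as $1$ for $s=1$).
   Context: Theta-positive branching process in varying environment with parameters $(\theta,\{\lambda_t\},\{a_t\})$: fix $\theta\in(0,1]$ and measurable functions $t\mapsto\lambda_t\ge0$ and $t\mapsto a_t$ on $[0,\infty)$ such that $\Lambda_t=\int_0^t\lambda_u\,du<\infty$ for all $t\ge0$ and $0\le a_t\le 1+1/\theta$ for all $t\ge 0$. The process $\{Z_t\}_{t\ge0}$ is the time-inhomogeneous continuous-time Markov branching process on $\{0,1,2,\dots\}$ with $Z_0=1$ (right-continuous sample paths) in which individuals live and reproduce independently; an individual alive at time $t$ dies during $(t,t+\delta)$ with probability $\lambda_t\delta+o(\delta)$ as $\delta\to0$, and an individual dying at time $t$ is instantaneously replaced by $k$ offspring with probability $p_t(k)$, where $k=0$ or $k\ge2$. (So from state $n$ the process jumps to $n-1+k$ at rate $n\lambda_tp_t(k)$ at time $t$.) The offspring probability generating function is $h_t(s)=p_t(0)+\sum_{k\ge2}p_t(k)s^k=1-a_t(1-s)+a_t(1+\theta)^{-1}(1-s)^{1+\theta}$, $0\le s\le 1$; in particular $a_t=\sum_{k\ge 2} kp_t(k)$ is the mean offspring number. Notation: $\mu_t=\mathrm{E}(Z_t)=\exp\{\int_0^t(a_u-1)\,d\Lambda_u\}$, where $d\Lambda_u=\lambda_u\,du$; $m_t=\mathrm{E}(Z_t\mid Z_t>0)$; $q=\lim_{t\to\infty}\mathrm{P}(Z_t=0)$ is the extinction probability; $V_{t,\theta}=\theta(1+\theta)^{-1}\int_0^t\mu_u^{-\theta}\,d\Lambda_u$;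 $V_\theta=\lim_{t\to\infty}V_{t,\theta}\in[0,\infty]$. For a sequence $t'=\{t_n\}$ with $t_n\to\infty$, limits and relations "as $t'\to\infty$" are taken along $t=t_n$, $n\to\infty$; $f\sim g$ means $f/g\to1$ along the sequence. The process is called loosely subcritical if $q=1$ and $\lim_{t\to\infty}m_t$ does not exist (neither as a finite limit nor as $\infty$). *)

theory Defs
  imports "HOL-Probability.Probability" "HOL-Library.Landau_Symbols"
begin

definition cumulative_rate :: "(real \<Rightarrow> real) \<Rightarrow> real \<Rightarrow> real" where
  "cumulative_rate lam t = (LBINT u:{0..t}. lam u)"

(* The rate at time t of a jump from state n to a state m different from n.  Each of the n
   individuals dies at rate lam t independently of the others and is replaced by k offspring
   with probability p t k, so the rate is n * lam t * p t k for m = n - 1 + k (written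
   m + 1 = n + k to avoid truncated subtraction), and 0 if m < n - 1. *)
definition jump_rate :: "(real \<Rightarrow> real) \<Rightarrow> (real \<Rightarrow> nat pmf) \<Rightarrow> real \<Rightarrow> nat \<Rightarrow> nat \<Rightarrow> real" where
  "jump_rate lam p t n m =
     (if n \<le> m + 1 then real n * lam t * pmf (p t) (m + 1 - n) else 0)"

definition events_generated_by ::
    "'a measure \<Rightarrow> (real \<Rightarrow> 'a \<Rightarrow> nat) \<Rightarrow> real set \<Rightarrow> 'a set set" where
  "events_generated_by M Z I =
     sigma_sets (space M) {Z u -` B \<inter> space M | u B. u \<in> I}"

definition stay_event ::
    "'a measure \<Rightarrow> (real \<Rightarrow> 'a \<Rightarrow> nat) \<Rightarrow> real \<Rightarrow> real \<Rightarrow> nat \<Rightarrow> 'a set" where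
  "stay_event M Z s t n = {\<omega> \<in> space M. \<forall>u\<in>{s..t}. Z u \<omega> = n}"

(* Z s = n, and the first jump after s takes place in (s, t] and leads to m. *)
definition first_jump_event ::
    "'a measure \<Rightarrow> (real \<Rightarrow> 'a \<Rightarrow> nat) \<Rightarrow> real \<Rightarrow> real \<Rightarrow> nat \<Rightarrow> nat \<Rightarrow> 'a set" where
  "first_jump_event M Z s t n m =
     {\<omega> \<in> space M. Z s \<omega> = n \<and>
        (\<exists>u\<in>{s<..t}. (\<forall>r\<in>{s..<u}. Z r \<omega> = n) \<and> Z u \<omega> = m)}"

(* Continuous-time Markov branching process in varying environment, started from one individual.
   Since lam is merely measurable, rates are meant in the integrated sense: given Z s = n, the
   waiting time for the next jump has hazard n * lam u at time u, and a jump at time u leads to m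
   with rate jump_rate lam p u n m.  (At continuity points this is the usual o(delta) description;
   demanded literally at every time, the latter would exclude discontinuous rates.)
   No assumption is made that paths make finitely many jumps in bounded time.
   The sets of events are those determined by the process before, respectively after, time s;
   the Markov property is stated multiplied out, to cover states of probability zero. *)
locale markov_branching_process = prob_space M
  for M :: "'a measure" +
  fixes lam :: "real \<Rightarrow> real"
    and p :: "real \<Rightarrow> nat pmf"
    and Z :: "real \<Rightarrow> 'a \<Rightarrow> nat"
  assumes rate_measurable: "set_borel_measurable borel {0..} lam"
    and rate_nonneg: "t \<ge> 0 \<Longrightarrow> lam t \<ge> 0"
    and rate_integrable: "t \<ge> 0 \<Longrightarrow> set_integrable lborel {0..t} lam"
    and no_single_offspring: "t \<ge> 0 \<Longrightarrow> pmf (p t) 1 = 0"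
    and Z_measurable: "t \<ge> 0 \<Longrightarrow> Z t \<in> measurable M (count_space UNIV)"
    and Z_start: "\<omega> \<in> space M \<Longrightarrow> Z 0 \<omega> = 1"
    and Z_right_continuous:
      "\<omega> \<in> space M \<Longrightarrow> t \<ge> 0 \<Longrightarrow> continuous (at_right t) (\<lambda>u. Z u \<omega>)"
    and Z_Markov:
      "s \<ge> 0 \<Longrightarrow> A \<in> events_generated_by M Z {0..s} \<Longrightarrow> B \<in> events_generated_by M Z {s..} \<Longrightarrow>
         \<P>(\<omega> in M. \<omega> \<in> A \<and> \<omega> \<in> B \<and> Z s \<omega> = n) * \<P>(\<omega> in M. Z s \<omega> = n)
         = \<P>(\<omega> in M. \<omega> \<in> A \<and> Z s \<omega> = n) * \<P>(\<omega> in M. \<omega> \<in> B \<and> Z s \<omega> = n)"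
    and Z_stay:
      "0 \<le> s \<Longrightarrow> s \<le> t \<Longrightarrow>
         measure M (stay_event M Z s t n)
         = \<P>(\<omega> in M. Z s \<omega> = n)
           * exp (- real n * (cumulative_rate lam t - cumulative_rate lam s))"
    and Z_jump:
      "0 \<le> s \<Longrightarrow> s \<le> t \<Longrightarrow> n \<noteq> m \<Longrightarrow>
         measure M (first_jump_event M Z s t n m)
         = \<P>(\<omega> in M. Z s \<omega> = n)
           * (LBINT u:{s..t}. jump_rate lam p u n m
                * exp (- real n * (cumulative_rate lam u - cumulative_rate lam s)))"

locale theta_positive_branching_process = markov_branching_process M lam p Z
  for M :: "'a measure"
    and \<theta> :: real
    and lam :: "real \<Rightarrow> real"
    and a :: "real \<Rightarrow> real"
    and p :: "real \<Rightarrow> nat pmf"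
    and Z :: "real \<Rightarrow> 'a \<Rightarrow> nat" +
  assumes theta_range: "0 < \<theta>" "\<theta> \<le> 1"
    and mean_offspring_measurable: "set_borel_measurable borel {0..} a"
    and mean_offspring_range: "t \<ge> 0 \<Longrightarrow> 0 \<le> a t \<and> a t \<le> 1 + 1 / \<theta>"
    and offspring_pgf:
      "t \<ge> 0 \<Longrightarrow> 0 \<le> s \<Longrightarrow> s \<le> 1 \<Longrightarrow>
         (\<lambda>k. pmf (p t) k * s ^ k) sums
           (1 - a t * (1 - s) + a t / (1 + \<theta>) * (1 - s) powr (1 + \<theta>))"

definition mean_size :: "'a measure \<Rightarrow> (real \<Rightarrow> 'a \<Rightarrow> nat) \<Rightarrow> real \<Rightarrow> real" where
  "mean_size M Z t = (\<integral>\<omega>. real (Z t \<omega>) \<partial>M)"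

definition survival_prob :: "'a measure \<Rightarrow> (real \<Rightarrow> 'a \<Rightarrow> nat) \<Rightarrow> real \<Rightarrow> real" where
  "survival_prob M Z t = \<P>(\<omega> in M. Z t \<omega> > 0)"

definition expectation_given_survival ::
    "'a measure \<Rightarrow> (real \<Rightarrow> 'a \<Rightarrow> nat) \<Rightarrow> real \<Rightarrow> (nat \<Rightarrow> real) \<Rightarrow> real" where
  "expectation_given_survival M Z t f =
     (LINT \<omega>:{\<omega> \<in> space M. Z t \<omega> > 0}|M. f (Z t \<omega>)) / survival_prob M Z t"

definition conditional_mean_size :: "'a measure \<Rightarrow> (real \<Rightarrow> 'a \<Rightarrow> nat) \<Rightarrow> real \<Rightarrow> real" where
  "conditional_mean_size M Z t = expectation_given_survival M Z t real"

definition extinction_prob :: "'a measure \<Rightarrow> (real \<Rightarrow> 'a \<Rightarrow> nat) \<Rightarrow> real" where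
  "extinction_prob M Z = Lim at_top (\<lambda>t. \<P>(\<omega> in M. Z t \<omega> = 0))"

definition V_fun ::
    "'a measure \<Rightarrow> (real \<Rightarrow> 'a \<Rightarrow> nat) \<Rightarrow> (real \<Rightarrow> real) \<Rightarrow> real \<Rightarrow> real \<Rightarrow> real" where
  "V_fun M Z lam \<theta> t =
     \<theta> / (1 + \<theta>) * (LBINT u:{0..t}. mean_size M Z u powr (- \<theta>) * lam u)"

definition V_limit ::
    "'a measure \<Rightarrow> (real \<Rightarrow> 'a \<Rightarrow> nat) \<Rightarrow> (real \<Rightarrow> real) \<Rightarrow> real \<Rightarrow> ereal" where
  "V_limit M Z lam \<theta> = Lim at_top (\<lambda>t. ereal (V_fun M Z lam \<theta> t))"

definition loosely_subcritical :: "'a measure \<Rightarrow> (real \<Rightarrow> 'a \<Rightarrow> nat) \<Rightarrow> bool" where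
  "loosely_subcritical M Z \<longleftrightarrow>
     extinction_prob M Z = 1 \<and>
     \<not> (\<exists>L::ereal. ((\<lambda>t. ereal (conditional_mean_size M Z t)) \<longlongrightarrow> L) at_top)"

definition time_sequence :: "(nat \<Rightarrow> real) \<Rightarrow> bool" where
  "time_sequence \<tau> \<longleftrightarrow> (\<forall>n. 0 \<le> \<tau> n) \<and> filterlim \<tau> at_top sequentially"

definition has_partial_limit ::
    "'a measure \<Rightarrow> (real \<Rightarrow> 'a \<Rightarrow> nat) \<Rightarrow> (real \<Rightarrow> real) \<Rightarrow> real \<Rightarrow> (nat \<Rightarrow> real) \<Rightarrow> ereal \<Rightarrow> bool" where
  "has_partial_limit M Z lam \<theta> \<tau> L \<longleftrightarrow>
     (\<lambda>n. ereal (mean_size M Z (\<tau> n) powr \<theta> * V_fun M Z lam \<theta> (\<tau> n))) \<longlonglongrightarrow> L"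

end

theory Submission
  imports Defs "HOL-Complex_Analysis.Cauchy_Integral_Formula" "HOL-Real_Asymp.Real_Asymp"
begin

text \<open>
Everything follows from one explicit formula. With \<open>\<mu>\<close> the mean and \<open>E = \<mu> powr (- \<theta>)\<close>, the
generating function of \<open>Z t\<close> is
\<open>1 - (V t + 1 / (1 + \<theta>) + E t * ((1 - s) powr (- \<theta>) - 1 / (1 + \<theta>))) powr (- 1 / \<theta>)\<close>
(lemma \<open>pgf_eq\<close>): for this offspring law \<open>(1 - F) powr (- \<theta>)\<close> turns the backward equation into
a linear one. Reading off survival probability, mean (\<open>mean_eq\<close>) and conditional law gives two
facts. The conditional mean satisfies
\<open>m powr \<theta> = \<mu> powr \<theta> * V * (1 + 1 / ((1 + \<theta>) * V)) + \<theta> / (1 + \<theta>)\<close>, so that, once \<open>V\<close> tends to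
infinity, \<open>m\<close> and \<open>\<mu> powr \<theta> * V\<close> have limits together (\<open>conditional_mean_limit\<close>); and the
conditional generating function depends on \<open>t\<close> only through \<open>m\<close> (\<open>conditional_pgf\<close>), which gives
the two limit laws. Extinction is certain exactly if \<open>V\<close> tends to infinity, because
\<open>E \<le> 1 + (1 + \<theta>) * V\<close> controls the remaining term (\<open>extinction_prob_eq_1_iff\<close>). Compactness
of the extended reals yields two different partial limits (\<open>two_partial_limits\<close>).

The work lies in deriving the formula from the description of the paths by staying times and first
jumps, where neither non-explosion nor continuous rates are given. The strategy is to use only lower
bounds for transition probabilities. Over an interval on which the cumulative rate grows by
\<open>D\<close>, a jump followed by no further jump before the end of the interval has at least the
expected probability up to a relative error of order \<open>D\<close> (\<open>prob_transition_ge\<close>). Hence, if \<open>x\<close> and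
\<open>y\<close> solve the backward equation, \<open>0 \<le> y \<le> x \<le> R < 1\<close> and \<open>0 \<le> b \<le> 1\<close>, the expectations of
\<open>x r ^ Z r - b * y r ^ Z r\<close>, a nonnegative function of the state that decays geometrically, drop by at
most \<open>O(D^2)\<close> over each interval, with a constant uniform in the state; subdividing the interval shows
that they are nondecreasing (\<open>backward_solution_submartingale\<close>). Taking \<open>b = 0\<close> gives one inequality
for the generating function. Taking \<open>b = 1\<close> and letting the end value of \<open>x\<close> tend to 1 gives the
other one; non-explosion is contained in the fact that the explicit solution then tends to 1 as well.

Since the rates are merely measurable, differential equations are replaced throughout by increments
that are known up to the square of the increment of the cumulative rate.
\<close>

section \<open>Functions that are smooth with respect to a clock\<close>

lemma first_order_taylor_error:
  fixes f f1 f2 :: "real \<Rightarrow> real"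
  assumes f: "\<And>x. x \<in> closed_segment a b \<Longrightarrow> (f has_real_derivative f1 x) (at x)"
    and f1: "\<And>x. x \<in> closed_segment a b \<Longrightarrow> (f1 has_real_derivative f2 x) (at x)"
    and bound: "\<And>x. x \<in> closed_segment a b \<Longrightarrow> \<bar>f2 x\<bar> \<le> B"
  shows "\<bar>f b - f a - f1 a * (b - a)\<bar> \<le> B * (b - a)^2"
proof -
  have B: "0 \<le> B" using bound[of a] by force
  have slope: "\<bar>f1 x - f1 a\<bar> \<le> B * \<bar>b - a\<bar>" if x: "x \<in> closed_segment a b" for x
  proof -
    have "norm (f1 x - f1 a) \<le> B * norm (x - a)"
      by (rule field_differentiable_bound[where S = "closed_segment a b" and f' = f2])
         (use f1 bound x in \<open>auto intro: has_field_derivative_at_within\<close>)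
    also have "\<dots> \<le> B * \<bar>b - a\<bar>"
      using x B by (intro mult_left_mono) (auto simp: closed_segment_eq_real_ivl split: if_splits)
    finally show ?thesis by simp
  qed
  have "norm ((f b - f1 a * b) - (f a - f1 a * a)) \<le> (B * \<bar>b - a\<bar>) * norm (b - a)"
  proof (rule field_differentiable_bound[where S = "closed_segment a b"
        and f' = "\<lambda>x. f1 x - f1 a" and f = "\<lambda>x. f x - f1 a * x"])
    fix x assume x: "x \<in> closed_segment a b"
    have "((\<lambda>x. f x - f1 a * x) has_real_derivative f1 x - f1 a) (at x)"
      using f[OF x] by (auto intro!: derivative_eq_intros)
    then show "((\<lambda>x. f x - f1 a * x) has_real_derivative f1 x - f1 a) (at x within closed_segment a b)"
      by (rule has_field_derivative_at_within)
  qed (use slope in auto)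
  moreover have "(B * \<bar>b - a\<bar>) * norm (b - a) = B * (b - a)^2"
    by (simp add: power2_eq_square mult.assoc flip: abs_mult)
  ultimately show ?thesis by (simp add: algebra_simps)
qed

text \<open>
The chain rule over a single interval. It is stated apart from the calculus below because it is also
needed for the powers \<open>z ^ n\<close> with a constant that does not depend on \<open>n\<close>.
\<close>
lemma second_order_composition:
  fixes u v \<delta> D :: real
  assumes lipschitz: "\<bar>v - u\<bar> \<le> H * D" and error: "\<bar>v - u - \<delta>\<bar> \<le> K * D^2"
    and d1: "\<And>x. x \<in> closed_segment v u \<Longrightarrow> (\<phi> has_real_derivative \<phi>1 x) (at x)"
    and d2: "\<And>x. x \<in> closed_segment v u \<Longrightarrow> (\<phi>1 has_real_derivative \<phi>2 x) (at x)"
    and b2: "\<And>x. x \<in> closed_segment v u \<Longrightarrow> \<bar>\<phi>2 x\<bar> \<le> B" and b1: "\<bar>\<phi>1 v\<bar> \<le> B"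
  shows "\<bar>\<phi> v - \<phi> u - \<phi>1 v * \<delta>\<bar> \<le> B * (H^2 + K) * D^2"
proof -
  have B: "0 \<le> B" using b1 by linarith
  have "\<bar>\<phi> u - \<phi> v - \<phi>1 v * (u - v)\<bar> \<le> B * (u - v)^2"
    by (rule first_order_taylor_error[OF d1 d2 b2])
  moreover have "(u - v)^2 \<le> H^2 * D^2"
    using power_mono[OF lipschitz, of 2] by (simp add: power_mult_distrib power2_commute)
  ultimately have "\<bar>\<phi> u - \<phi> v - \<phi>1 v * (u - v)\<bar> \<le> B * (H^2 * D^2)"
    using B by (meson mult_left_mono order.trans)
  moreover have "\<bar>\<phi>1 v * (v - u - \<delta>)\<bar> \<le> B * (K * D^2)"
    using mult_mono[OF b1 error B] by (simp add: abs_mult)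
  ultimately have "\<bar>\<phi>1 v * (v - u - \<delta>) - (\<phi> u - \<phi> v - \<phi>1 v * (u - v))\<bar>
      \<le> B * (H^2 * D^2) + B * (K * D^2)"
    by linarith
  then show ?thesis by (simp add: algebra_simps)
qed

text \<open>
A clock is a continuous nondecreasing time change, here always the cumulative rate. Measuring all
increments by it avoids absolute continuity and differentiation almost everywhere: a function whose
increments agree with a linear term up to the square of the clock increment behaves like a
differentiable function of the clock.
\<close>
locale clock =
  fixes L :: "real \<Rightarrow> real" and T :: real
  assumes clock_continuous: "continuous_on {0..T} L"
    and clock_mono: "0 \<le> r \<Longrightarrow> r \<le> r' \<Longrightarrow> r' \<le> T \<Longrightarrow> L r \<le> L r'"
begin

text \<open>
Halving an interval with respect to the clock halves the sum of the squares of the clock increments,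
so the permitted loss \<open>C * D^2\<close> improves to \<open>C / 2 ^ k * D^2\<close> for every \<open>k\<close>. A clock that stands
still causes no trouble, since the midpoint is taken in clock time.
\<close>
lemma mono_if_second_order_decrease:
  fixes f :: "real \<Rightarrow> real"
  assumes step: "\<And>r r'. 0 \<le> r \<Longrightarrow> r \<le> r' \<Longrightarrow> r' \<le> T \<Longrightarrow> f r - C * (L r' - L r)^2 \<le> f r'"
    and r: "0 \<le> r" "r \<le> r'" "r' \<le> T"
  shows "f r \<le> f r'"
proof -
  have bisected: "f r - C / 2^k * (L r' - L r)^2 \<le> f r'"
    if "0 \<le> r" "r \<le> r'" "r' \<le> T" for k r r'
    using that
  proof (induction k arbitrary: r r')
    case 0
    then show ?case using step by simp
  next
    case (Suc k)
    define h where "h = (L r' - L r) / 2"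
    have "0 \<le> h" using clock_mono[OF Suc.prems] by (simp add: h_def)
    moreover have "continuous_on {r..r'} L"
      by (rule continuous_on_subset[OF clock_continuous]) (use Suc.prems in auto)
    ultimately obtain q where q: "r \<le> q" "q \<le> r'" and Lq: "L q = L r + h"
      using IVT'[of L r "L r + h" r'] Suc.prems by (auto simp: h_def field_simps)
    have "f r - C / 2^k * h^2 \<le> f q"
      using Suc.IH[of r q] Suc.prems q by (simp add: Lq)
    moreover have "f q - C / 2^k * h^2 \<le> f r'"
    proof -
      have "L r' - L q = h" by (simp add: Lq h_def field_simps)
      then show ?thesis using Suc.IH[of q r'] Suc.prems q by simp
    qed
    moreover have "C / 2^Suc k * (L r' - L r)^2 = C / 2^k * h^2 + C / 2^k * h^2"
      by (simp add: h_def power2_eq_square)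
    ultimately show ?case by linarith
  qed
  have "(\<lambda>k. f r - (1/2)^k * (C * (L r' - L r)^2)) \<longlonglongrightarrow> f r - 0 * (C * (L r' - L r)^2)"
    by (intro tendsto_intros LIMSEQ_power_zero) simp
  then show ?thesis
    using bisected[OF r] by (intro LIMSEQ_le_const2) (auto simp: power_divide)
qed

text \<open>
The term \<open>d r r'\<close> plays the role of the differential of \<open>f\<close> with respect to the clock, with coefficients
evaluated at the right end point \<open>r'\<close>: the state at the later time is what enters a backward equation.
\<close>
definition has_increments :: "(real \<Rightarrow> real) \<Rightarrow> (real \<Rightarrow> real \<Rightarrow> real) \<Rightarrow> bool" where
  "has_increments f d \<longleftrightarrow>
     (\<exists>K\<ge>0. \<forall>r r'. 0 \<le> r \<and> r \<le> r' \<and> r' \<le> T \<longrightarrow>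
        \<bar>d r r'\<bar> \<le> K * (L r' - L r) \<and> \<bar>f r' - f r - d r r'\<bar> \<le> K * (L r' - L r)^2)"

lemma has_incrementsI:
  assumes "\<And>r r'. 0 \<le> r \<Longrightarrow> r \<le> r' \<Longrightarrow> r' \<le> T \<Longrightarrow> \<bar>d r r'\<bar> \<le> K * (L r' - L r)"
    and "\<And>r r'. 0 \<le> r \<Longrightarrow> r \<le> r' \<Longrightarrow> r' \<le> T \<Longrightarrow> \<bar>f r' - f r - d r r'\<bar> \<le> C * (L r' - L r)^2"
  shows "has_increments f d"
proof -
  have "\<bar>d r r'\<bar> \<le> (\<bar>K\<bar> + \<bar>C\<bar>) * (L r' - L r) \<and>
      \<bar>f r' - f r - d r r'\<bar> \<le> (\<bar>K\<bar> + \<bar>C\<bar>) * (L r' - L r)^2"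
    if r: "0 \<le> r" "r \<le> r'" "r' \<le> T" for r r'
  proof -
    have "K * (L r' - L r) \<le> (\<bar>K\<bar> + \<bar>C\<bar>) * (L r' - L r)"
      using clock_mono[OF r] by (intro mult_right_mono) auto
    moreover have "C * (L r' - L r)^2 \<le> (\<bar>K\<bar> + \<bar>C\<bar>) * (L r' - L r)^2"
      by (intro mult_right_mono) auto
    ultimately show ?thesis
      using assms(1)[OF r] assms(2)[OF r] by linarith
  qed
  then show ?thesis unfolding has_increments_def
    by (intro exI[of _ "\<bar>K\<bar> + \<bar>C\<bar>"]) auto
qed

lemma has_incrementsE:
  assumes "has_increments f d"
  obtains K where "K \<ge> 0"
    "\<And>r r'. 0 \<le> r \<Longrightarrow> r \<le> r' \<Longrightarrow> r' \<le> T \<Longrightarrow> \<bar>d r r'\<bar> \<le> K * (L r' - L r)"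
    "\<And>r r'. 0 \<le> r \<Longrightarrow> r \<le> r' \<Longrightarrow> r' \<le> T \<Longrightarrow> \<bar>f r' - f r - d r r'\<bar> \<le> K * (L r' - L r)^2"
  using assms unfolding has_increments_def by blast

lemma has_increments_cong:
  assumes "has_increments f d"
    and "\<And>r. 0 \<le> r \<Longrightarrow> r \<le> T \<Longrightarrow> f r = g r"
    and "\<And>r r'. 0 \<le> r \<Longrightarrow> r \<le> r' \<Longrightarrow> r' \<le> T \<Longrightarrow> d r r' = e r r'"
  shows "has_increments g e"
proof -
  obtain K where K: "K \<ge> 0"
      "\<And>r r'. 0 \<le> r \<Longrightarrow> r \<le> r' \<Longrightarrow> r' \<le> T \<Longrightarrow> \<bar>d r r'\<bar> \<le> K * (L r' - L r)"
      "\<And>r r'. 0 \<le> r \<Longrightarrow> r \<le> r' \<Longrightarrow> r' \<le> T \<Longrightarrow> \<bar>f r' - f r - d r r'\<bar> \<le> K * (L r' - L r)^2"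
    by (rule has_incrementsE[OF assms(1)]) (rule that)
  show ?thesis
    by (rule has_incrementsI[where K = K and C = K])
       (use K(2,3) assms(2)[symmetric] assms(3)[symmetric] in simp_all)
qed

lemma has_increments_const: "has_increments (\<lambda>_. c) (\<lambda>_ _. 0)"
  by (rule has_incrementsI[where K = 0 and C = 0]) auto

lemma has_increments_add:
  assumes "has_increments f d" "has_increments g e"
  shows "has_increments (\<lambda>r. f r + g r) (\<lambda>r r'. d r r' + e r r')"
proof -
  obtain K where K: "K \<ge> 0"
      "\<And>r r'. 0 \<le> r \<Longrightarrow> r \<le> r' \<Longrightarrow> r' \<le> T \<Longrightarrow> \<bar>d r r'\<bar> \<le> K * (L r' - L r)"
      "\<And>r r'. 0 \<le> r \<Longrightarrow> r \<le> r' \<Longrightarrow> r' \<le> T \<Longrightarrow> \<bar>f r' - f r - d r r'\<bar> \<le> K * (L r' - L r)^2"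
    by (rule has_incrementsE[OF assms(1)]) (rule that)
  obtain K' where K': "K' \<ge> 0"
      "\<And>r r'. 0 \<le> r \<Longrightarrow> r \<le> r' \<Longrightarrow> r' \<le> T \<Longrightarrow> \<bar>e r r'\<bar> \<le> K' * (L r' - L r)"
      "\<And>r r'. 0 \<le> r \<Longrightarrow> r \<le> r' \<Longrightarrow> r' \<le> T \<Longrightarrow> \<bar>g r' - g r - e r r'\<bar> \<le> K' * (L r' - L r)^2"
    by (rule has_incrementsE[OF assms(2)]) (rule that)
  show ?thesis
  proof (rule has_incrementsI[where K = "K + K'" and C = "K + K'"])
    fix r r' :: real assume r: "0 \<le> r" "r \<le> r'" "r' \<le> T"
    show "\<bar>d r r' + e r r'\<bar> \<le> (K + K') * (L r' - L r)"
      using K(2)[OF r] K'(2)[OF r] unfolding distrib_right by linarith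
    show "\<bar>f r' + g r' - (f r + g r) - (d r r' + e r r')\<bar> \<le> (K + K') * (L r' - L r)^2"
      using K(3)[OF r] K'(3)[OF r] unfolding distrib_right by linarith
  qed
qed

lemma has_increments_cmult:
  assumes "has_increments f d"
  shows "has_increments (\<lambda>r. c * f r) (\<lambda>r r'. c * d r r')"
proof -
  obtain K where K: "K \<ge> 0"
      "\<And>r r'. 0 \<le> r \<Longrightarrow> r \<le> r' \<Longrightarrow> r' \<le> T \<Longrightarrow> \<bar>d r r'\<bar> \<le> K * (L r' - L r)"
      "\<And>r r'. 0 \<le> r \<Longrightarrow> r \<le> r' \<Longrightarrow> r' \<le> T \<Longrightarrow> \<bar>f r' - f r - d r r'\<bar> \<le> K * (L r' - L r)^2"
    by (rule has_incrementsE[OF assms]) (rule that)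
  show ?thesis
  proof (rule has_incrementsI[where K = "\<bar>c\<bar> * K" and C = "\<bar>c\<bar> * K"])
    fix r r' :: real assume r: "0 \<le> r" "r \<le> r'" "r' \<le> T"
    show "\<bar>c * d r r'\<bar> \<le> \<bar>c\<bar> * K * (L r' - L r)"
      using K(2)[OF r] by (simp add: abs_mult mult.assoc mult_left_mono)
    have "\<bar>c * (f r' - f r - d r r')\<bar> \<le> \<bar>c\<bar> * K * (L r' - L r)^2"
      using K(3)[OF r] by (simp add: abs_mult mult.assoc mult_left_mono)
    then show "\<bar>c * f r' - c * f r - c * d r r'\<bar> \<le> \<bar>c\<bar> * K * (L r' - L r)^2"
      by (simp add: algebra_simps)
  qed
qed

lemma has_increments_lipschitz:
  assumes "has_increments f d"
  obtains K where "K \<ge> 0"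
    "\<And>r r'. 0 \<le> r \<Longrightarrow> r \<le> r' \<Longrightarrow> r' \<le> T \<Longrightarrow> \<bar>f r' - f r\<bar> \<le> K * (L r' - L r)"
proof -
  obtain K where K: "K \<ge> 0"
      "\<And>r r'. 0 \<le> r \<Longrightarrow> r \<le> r' \<Longrightarrow> r' \<le> T \<Longrightarrow> \<bar>d r r'\<bar> \<le> K * (L r' - L r)"
      "\<And>r r'. 0 \<le> r \<Longrightarrow> r \<le> r' \<Longrightarrow> r' \<le> T \<Longrightarrow> \<bar>f r' - f r - d r r'\<bar> \<le> K * (L r' - L r)^2"
    by (rule has_incrementsE[OF assms]) (rule that)
  show thesis
  proof (rule that)
    show "K + K * \<bar>L T - L 0\<bar> \<ge> 0" using K(1) by simp
    fix r r' :: real assume r: "0 \<le> r" "r \<le> r'" "r' \<le> T"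
    have D: "0 \<le> L r' - L r" "L r' - L r \<le> \<bar>L T - L 0\<bar>"
      using clock_mono[of r r'] clock_mono[of 0 r] clock_mono[of r' T] r by auto
    have "K * (L r' - L r)^2 \<le> K * \<bar>L T - L 0\<bar> * (L r' - L r)"
      using D K(1) by (simp add: power2_eq_square mult_left_mono mult_right_mono mult.assoc)
    then show "\<bar>f r' - f r\<bar> \<le> (K + K * \<bar>L T - L 0\<bar>) * (L r' - L r)"
      using K(2,3)[OF r] unfolding distrib_right by linarith
  qed
qed

lemma has_increments_bounded:
  assumes "has_increments f d"
  obtains B where "\<And>r. 0 \<le> r \<Longrightarrow> r \<le> T \<Longrightarrow> \<bar>f r\<bar> \<le> B"
proof -
  obtain K where K: "K \<ge> 0"
    "\<And>r r'. 0 \<le> r \<Longrightarrow> r \<le> r' \<Longrightarrow> r' \<le> T \<Longrightarrow> \<bar>f r' - f r\<bar> \<le> K * (L r' - L r)"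
    by (rule has_increments_lipschitz[OF assms]) (rule that)
  show thesis
  proof (rule that)
    fix r :: real assume r: "0 \<le> r" "r \<le> T"
    have "K * (L r - L 0) \<le> K * (L T - L 0)"
      using K(1) clock_mono[of r T] r by (intro mult_left_mono) auto
    then show "\<bar>f r\<bar> \<le> \<bar>f 0\<bar> + K * (L T - L 0)"
      using K(2)[of 0 r] r by linarith
  qed
qed

lemma has_increments_chain:
  assumes f: "has_increments f d"
    and range: "\<And>r. 0 \<le> r \<Longrightarrow> r \<le> T \<Longrightarrow> f r \<in> {l..h}"
    and d1: "\<And>x. x \<in> {l..h} \<Longrightarrow> (\<phi> has_real_derivative \<phi>1 x) (at x)"
    and d2: "\<And>x. x \<in> {l..h} \<Longrightarrow> (\<phi>1 has_real_derivative \<phi>2 x) (at x)"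
    and b2: "\<And>x. x \<in> {l..h} \<Longrightarrow> \<bar>\<phi>2 x\<bar> \<le> B2"
  shows "has_increments (\<lambda>r. \<phi> (f r)) (\<lambda>r r'. \<phi>1 (f r') * d r r')"
proof -
  have "continuous_on {l..h} \<phi>1"
    using d2 by (meson continuous_at_imp_continuous_on DERIV_isCont)
  then have "bounded (\<phi>1 ` {l..h})"
    by (intro compact_imp_bounded compact_continuous_image) auto
  then obtain B1 where B1: "\<And>x. x \<in> {l..h} \<Longrightarrow> \<bar>\<phi>1 x\<bar> \<le> B1"
    unfolding bounded_iff real_norm_def by blast
  define B where "B = max B1 B2"
  obtain K where K: "K \<ge> 0"
      "\<And>r r'. 0 \<le> r \<Longrightarrow> r \<le> r' \<Longrightarrow> r' \<le> T \<Longrightarrow> \<bar>d r r'\<bar> \<le> K * (L r' - L r)"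
      "\<And>r r'. 0 \<le> r \<Longrightarrow> r \<le> r' \<Longrightarrow> r' \<le> T \<Longrightarrow> \<bar>f r' - f r - d r r'\<bar> \<le> K * (L r' - L r)^2"
    by (rule has_incrementsE[OF f]) (rule that)
  obtain H where H: "H \<ge> 0"
    "\<And>r r'. 0 \<le> r \<Longrightarrow> r \<le> r' \<Longrightarrow> r' \<le> T \<Longrightarrow> \<bar>f r' - f r\<bar> \<le> H * (L r' - L r)"
    by (rule has_increments_lipschitz[OF f]) (rule that)
  show ?thesis
  proof (rule has_incrementsI)
    fix r r' :: real assume r: "0 \<le> r" "r \<le> r'" "r' \<le> T"
    have fr: "f r \<in> {l..h}" "f r' \<in> {l..h}" using range r by auto
    then have seg: "closed_segment (f r') (f r) \<subseteq> {l..h}"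
      by (auto simp: closed_segment_eq_real_ivl split: if_splits)
    have B: "\<bar>\<phi>1 (f r')\<bar> \<le> B" "\<And>x. x \<in> {l..h} \<Longrightarrow> \<bar>\<phi>2 x\<bar> \<le> B"
      using B1[OF fr(2)] b2 by (fastforce simp: B_def)+
    show "\<bar>\<phi>1 (f r') * d r r'\<bar> \<le> (B * K) * (L r' - L r)"
      using mult_mono[OF B(1) K(2)[OF r]] B(1) by (simp add: abs_mult mult.assoc)
    show "\<bar>\<phi> (f r') - \<phi> (f r) - \<phi>1 (f r') * d r r'\<bar> \<le> B * (H^2 + K) * (L r' - L r)^2"
      by (rule second_order_composition[where ?\<phi>2.0 = \<phi>2, OF H(2)[OF r] K(3)[OF r]])
        (use seg d1 d2 B in auto)
  qed
qed

lemma has_increments_exp: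
  assumes "has_increments f d"
  shows "has_increments (\<lambda>r. exp (f r)) (\<lambda>r r'. exp (f r') * d r r')"
proof -
  obtain B where B: "\<And>r. 0 \<le> r \<Longrightarrow> r \<le> T \<Longrightarrow> \<bar>f r\<bar> \<le> B"
    by (rule has_increments_bounded[OF assms]) (rule that)
  show ?thesis
  proof (rule has_increments_chain[OF assms, where l = "-B" and h = B and ?\<phi>2.0 = exp and ?B2.0 = "exp B"])
    show "f r \<in> {-B..B}" if "0 \<le> r" "r \<le> T" for r
      using B[OF that] by auto
  qed auto
qed

lemma has_increments_ln:
  assumes f: "has_increments f d" and l: "0 < l" "\<And>r. 0 \<le> r \<Longrightarrow> r \<le> T \<Longrightarrow> l \<le> f r"
  shows "has_increments (\<lambda>r. ln (f r)) (\<lambda>r r'. d r r' / f r')"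
proof -
  obtain B where B: "\<And>r. 0 \<le> r \<Longrightarrow> r \<le> T \<Longrightarrow> \<bar>f r\<bar> \<le> B"
    by (rule has_increments_bounded[OF f]) (rule that)
  have "has_increments (\<lambda>r. ln (f r)) (\<lambda>r r'. inverse (f r') * d r r')"
  proof (rule has_increments_chain[OF f, where l = l and h = B and ?\<phi>2.0 = "\<lambda>x. - (inverse x ^ 2)"
        and ?B2.0 = "inverse l ^ 2"])
    fix x assume x: "x \<in> {l..B}"
    show "(ln has_real_derivative inverse x) (at x)"
      using x l by (auto intro!: derivative_eq_intros simp: field_simps)
    show "(inverse has_real_derivative - (inverse x ^ 2)) (at x)"
      using x l by (auto intro!: derivative_eq_intros simp: field_simps power2_eq_square)
    have "inverse x ^ 2 \<le> inverse l ^ 2"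
      using x l by (intro power_mono le_imp_inverse_le) auto
    then show "\<bar>- (inverse x ^ 2)\<bar> \<le> inverse l ^ 2" by simp
  next
    show "f r \<in> {l..B}" if "0 \<le> r" "r \<le> T" for r
      using B[OF that] l(2)[OF that] by auto
  qed
  then show ?thesis by (simp add: divide_inverse mult.commute)
qed

end

text \<open>
A generating function is known only on \<open>[0, 1)\<close>; its coefficients are still determined, because
zeros of a nonzero power series are isolated.
\<close>
lemma power_series_unique:
  fixes c :: "nat \<Rightarrow> real"
  assumes zero: "\<And>x. 0 \<le> x \<Longrightarrow> x < 1 \<Longrightarrow> (\<lambda>k. c k * x^k) sums 0"
  shows "c m = 0"
proof (rule ccontr)
  assume cm: "c m \<noteq> 0"
  have "c 0 = 0" using sums_unique2[OF zero[of 0], of "c 0"] powser_sums_zero[of c] by simp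
  with cm have "m > 0" by (cases m) auto
  define f where "f x = (\<Sum>k. c k * x^k)" for x
  have summ: "(\<lambda>k. c k * x^k) sums f x" if x: "norm x < 1" for x
  proof -
    obtain y where y: "norm x < y" "y < 1" using dense[OF x] by blast
    then have "0 \<le> y" using norm_ge_zero[of x] by linarith
    then have "summable (\<lambda>k. c k * y^k)" using zero[of y] y(2) by (simp add: sums_iff)
    then have "summable (\<lambda>k. c k * x^k)"
      by (rule powser_inside) (use y \<open>0 \<le> y\<close> in simp)
    then show ?thesis by (simp add: f_def summable_sums)
  qed
  have f0: "f x = 0" if "0 \<le> x" "x < 1" for x
    using zero[OF that] by (simp add: f_def sums_iff)
  obtain s where s: "0 < s" "\<And>z. z \<in> cball 0 s - {0} \<Longrightarrow> f z \<noteq> 0"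
    by (rule powser_0_nonzero[of 1 0 c f m]) (use summ f0 cm \<open>m > 0\<close> in auto)
  have "f (min s (1/2)) \<noteq> 0" using s by (intro s(2)) auto
  moreover have "f (min s (1/2)) = 0" using s(1) by (intro f0) auto
  ultimately show False by simp
qed

section \<open>Transition probabilities from below\<close>

lemma set_integral_Icc_diff:
  fixes f :: "real \<Rightarrow> real"
  assumes "set_integrable lborel {0..t} f" "0 \<le> r" "r \<le> t"
  shows "(LBINT u:{0..t}. f u) - (LBINT u:{0..r}. f u) = (LBINT u:{r..t}. f u)"
proof -
  have "set_integrable lborel {0..r} f" "set_integrable lborel {r..t} f"
    using assms by (auto intro: set_integrable_subset)
  then show ?thesis
    using assms Henstock_Kurzweil_Integration.integral_combine[of 0 r t f]
    by (simp add: set_borel_integral_eq_integral)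
qed

lemma continuous_on_indefinite_set_integral:
  fixes f :: "real \<Rightarrow> real"
  assumes "set_integrable lborel {0..T} f"
  shows "continuous_on {0..T} (\<lambda>t. LBINT u:{0..t}. f u)"
proof -
  have "continuous_on {0..T} (\<lambda>t. integral {0..t} f)"
    using assms by (intro indefinite_integral_continuous_1) (simp add: set_borel_integral_eq_integral)
  moreover have "integral {0..t} f = (LBINT u:{0..t}. f u)" if "t \<in> {0..T}" for t
  proof -
    have "set_integrable lborel {0..t} f"
      using assms that by (auto intro: set_integrable_subset)
    then show ?thesis by (simp add: set_borel_integral_eq_integral)
  qed
  ultimately show ?thesis by (rule continuous_on_eq)
qed

lemma set_integrable_mult_continuous:
  fixes f g :: "real \<Rightarrow> real"
  assumes f: "set_integrable lborel {a..b} f" and g: "continuous_on {a..b} g"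
  shows "set_integrable lborel {a..b} (\<lambda>u. g u * f u)"
proof -
  have "bounded (g ` {a..b})"
    by (intro compact_imp_bounded compact_continuous_image g compact_Icc)
  then obtain B where B: "\<And>u. u \<in> {a..b} \<Longrightarrow> \<bar>g u\<bar> \<le> B"
    unfolding bounded_iff real_norm_def by blast
  have eq: "(\<lambda>u. indicator {a..b} u *\<^sub>R (g u * f u))
      = (\<lambda>u. (indicator {a..b} u *\<^sub>R g u) * (indicator {a..b} u *\<^sub>R f u))"
    by (auto simp: indicator_def)
  have "(\<lambda>u. indicator {a..b} u *\<^sub>R g u) \<in> borel_measurable lborel"
    using borel_measurable_continuous_on_indicator[OF _ g] by simp
  then have meas: "(\<lambda>u. indicator {a..b} u *\<^sub>R (g u * f u)) \<in> borel_measurable lborel"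
    unfolding eq using f by (auto simp: set_integrable_def)
  have "integrable lborel (\<lambda>u. B * (indicator {a..b} u *\<^sub>R f u))"
    using f by (simp add: set_integrable_def)
  then show ?thesis
    unfolding set_integrable_def
  proof (rule Bochner_Integration.integrable_bound[OF _ meas], intro AE_I2)
    fix u
    show "norm (indicator {a..b} u *\<^sub>R (g u * f u)) \<le> norm (B * (indicator {a..b} u *\<^sub>R f u))"
    proof (cases "u \<in> {a..b}")
      case True
      have "\<bar>g u\<bar> * \<bar>f u\<bar> \<le> \<bar>B\<bar> * \<bar>f u\<bar>" using B[OF True] by (intro mult_right_mono) auto
      then show ?thesis using True by (simp add: abs_mult)
    qed simp
  qed
qed

context markov_branching_process
begin

lemma cumulative_rate_diff:
  assumes "0 \<le> r" "r \<le> t"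
  shows "cumulative_rate lam t - cumulative_rate lam r = (LBINT u:{r..t}. lam u)"
  unfolding cumulative_rate_def using assms rate_integrable
  by (intro set_integral_Icc_diff) auto

lemma clock_cumulative_rate: "clock (cumulative_rate lam) T"
proof
  show "continuous_on {0..T} (cumulative_rate lam)"
  proof (cases "0 \<le> T")
    case True
    then show ?thesis unfolding cumulative_rate_def
      by (intro continuous_on_indefinite_set_integral rate_integrable)
  qed simp
  show "cumulative_rate lam r \<le> cumulative_rate lam r'" if "0 \<le> r" "r \<le> r'" for r r'
  proof -
    have "0 \<le> (LBINT u:{r..r'}. lam u)"
      unfolding set_lebesgue_integral_def using that rate_nonneg
      by (intro integral_nonneg_AE AE_I2) (auto simp: indicator_def)
    then show ?thesis using cumulative_rate_diff[OF that] by simp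
  qed
qed

lemma cumulative_rate_mono:
  assumes "0 \<le> r" "r \<le> t"
  shows "cumulative_rate lam r \<le> cumulative_rate lam t"
  using clock.clock_mono[OF clock_cumulative_rate assms order_refl] .

lemma sigma_algebra_events_generated_by:
  "sigma_algebra (space M) (events_generated_by M Z I)"
  unfolding events_generated_by_def by (rule sigma_algebra_sigma_sets) auto

lemma state_event_in_events_generated_by:
  assumes "u \<in> I"
  shows "{\<omega> \<in> space M. Z u \<omega> = n} \<in> events_generated_by M Z I"
proof -
  have "{\<omega> \<in> space M. Z u \<omega> = n} = Z u -` {n} \<inter> space M" by auto
  then show ?thesis unfolding events_generated_by_def using assms
    by (intro sigma_sets.Basic) blast
qed

lemma state_event_sets [measurable]:
  assumes "0 \<le> u"
  shows "{\<omega> \<in> space M. Z u \<omega> = n} \<in> sets M"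
proof -
  have "{\<omega> \<in> space M. Z u \<omega> = n} = Z u -` {n} \<inter> space M" by auto
  then show ?thesis using measurable_sets[OF Z_measurable[OF assms], of "{n}"] by simp
qed

lemma joint_state_sets:
  assumes "0 \<le> r" "0 \<le> t"
  shows "{\<omega> \<in> space M. Z r \<omega> = n \<and> Z t \<omega> = m} \<in> sets M"
proof -
  have "{\<omega> \<in> space M. Z r \<omega> = n \<and> Z t \<omega> = m} =
      {\<omega> \<in> space M. Z r \<omega> = n} \<inter> {\<omega> \<in> space M. Z t \<omega> = m}" by auto
  then show ?thesis using assms by auto
qed

lemma events_generated_by_subset_sets:
  assumes "I \<subseteq> {0..}"
  shows "events_generated_by M Z I \<subseteq> sets M"
  unfolding events_generated_by_def
  by (intro sets.sigma_sets_subset) (use assms Z_measurable in \<open>auto intro: measurable_sets\<close>)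

lemma prob_stay_le:
  assumes "0 \<le> s" "s \<le> t"
  shows "\<P>(\<omega> in M. Z s \<omega> = n) * exp (- real n * (cumulative_rate lam t - cumulative_rate lam s))
    \<le> \<P>(\<omega> in M. Z s \<omega> = n \<and> Z t \<omega> = n)"
proof -
  have "{\<omega> \<in> space M. Z s \<omega> = n \<and> Z t \<omega> = n} \<in> sets M"
    using assms by (intro joint_state_sets) auto
  then have "measure M (stay_event M Z s t n) \<le> \<P>(\<omega> in M. Z s \<omega> = n \<and> Z t \<omega> = n)"
    using assms by (intro finite_measure_mono) (auto simp: stay_event_def)
  then show ?thesis by (simp only: Z_stay[OF assms])
qed

text \<open>The Markov property at \<open>v\<close> combined with the law of the staying time.\<close>
lemma prob_persist_after:
  assumes v: "0 \<le> v" "v \<le> t" and A: "A \<in> events_generated_by M Z {0..v}"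
    and m: "A \<subseteq> {\<omega> \<in> space M. Z v \<omega> = m}"
  shows "exp (- real m * (cumulative_rate lam t - cumulative_rate lam v)) * prob A
    \<le> prob (A \<inter> {\<omega> \<in> space M. Z t \<omega> = m})"
proof (cases "\<P>(\<omega> in M. Z v \<omega> = m) = 0")
  case True
  then have "prob A \<le> 0" using finite_measure_mono[OF m] v by simp
  then show ?thesis by (simp add: measure_le_0_iff)
next
  case False
  define B where "B = {\<omega> \<in> space M. Z t \<omega> = m}"
  have B: "B \<in> events_generated_by M Z {v..}"
    unfolding B_def by (rule state_event_in_events_generated_by) (use v in simp)
  have "\<P>(\<omega> in M. \<omega> \<in> A \<and> \<omega> \<in> B \<and> Z v \<omega> = m) * \<P>(\<omega> in M. Z v \<omega> = m)
      = \<P>(\<omega> in M. \<omega> \<in> A \<and> Z v \<omega> = m) * \<P>(\<omega> in M. \<omega> \<in> B \<and> Z v \<omega> = m)"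
    by (rule Z_Markov[OF v(1) A B])
  moreover have "{\<omega> \<in> space M. \<omega> \<in> A \<and> \<omega> \<in> B \<and> Z v \<omega> = m} = A \<inter> B"
    "{\<omega> \<in> space M. \<omega> \<in> A \<and> Z v \<omega> = m} = A"
    "{\<omega> \<in> space M. \<omega> \<in> B \<and> Z v \<omega> = m} = {\<omega> \<in> space M. Z v \<omega> = m \<and> Z t \<omega> = m}"
    using m by (auto simp: B_def)
  ultimately have "prob (A \<inter> B) * \<P>(\<omega> in M. Z v \<omega> = m)
      = prob A * \<P>(\<omega> in M. Z v \<omega> = m \<and> Z t \<omega> = m)" by simp
  moreover have "prob A * (\<P>(\<omega> in M. Z v \<omega> = m)
        * exp (- real m * (cumulative_rate lam t - cumulative_rate lam v)))
      \<le> prob A * \<P>(\<omega> in M. Z v \<omega> = m \<and> Z t \<omega> = m)"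
    by (intro mult_left_mono prob_stay_le v) simp
  ultimately have "(exp (- real m * (cumulative_rate lam t - cumulative_rate lam v)) * prob A)
      * \<P>(\<omega> in M. Z v \<omega> = m) \<le> prob (A \<inter> B) * \<P>(\<omega> in M. Z v \<omega> = m)"
    by (simp only: mult_ac)
  then show ?thesis
    using False by (simp add: B_def zero_less_measure_iff)
qed

text \<open>
The first jump as seen on a grid of \<open>N + 1\<close> equidistant times from \<open>r\<close> to \<open>t\<close>. The event is
determined by finitely many deterministic times, so the Markov property applies at the grid point where
the jump is noticed; at the time of the first jump itself it is not available.
\<close>
definition grid_exit_event :: "real \<Rightarrow> real \<Rightarrow> nat \<Rightarrow> nat \<Rightarrow> nat \<Rightarrow> nat \<Rightarrow> 'a set" where
  "grid_exit_event r t n m N i =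
     {\<omega> \<in> space M. (\<forall>j\<le>i. Z (r + (t - r) * j / N) \<omega> = n) \<and> Z (r + (t - r) * Suc i / N) \<omega> = m}"

lemma grid_point_le:
  fixes r t :: real
  assumes "r \<le> t" "j \<le> N"
  shows "r + (t - r) * real j / real N \<le> t"
proof -
  have "real j / real N \<le> 1" using assms(2) by (simp add: divide_le_eq)
  then have "(t - r) * (real j / real N) \<le> (t - r) * 1" using assms(1) by (intro mult_left_mono) auto
  then show ?thesis by simp
qed

lemma grid_point_mono:
  fixes r t :: real
  assumes "r \<le> t" "i \<le> j"
  shows "r + (t - r) * real i / real N \<le> r + (t - r) * real j / real N"
  using assms by (simp add: divide_right_mono mult_left_mono)

lemma grid_exit_event_in_events_generated_by:
  assumes "0 \<le> r" "r \<le> t"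
  shows "grid_exit_event r t n m N i \<in> events_generated_by M Z {0..r + (t - r) * Suc i / N}"
proof -
  interpret E: sigma_algebra "space M" "events_generated_by M Z {0..r + (t - r) * Suc i / N}"
    by (rule sigma_algebra_events_generated_by)
  have "grid_exit_event r t n m N i = (\<Inter>j\<in>{..i}. {\<omega> \<in> space M. Z (r + (t - r) * j / N) \<omega> = n})
      \<inter> {\<omega> \<in> space M. Z (r + (t - r) * Suc i / N) \<omega> = m}"
    by (auto simp: grid_exit_event_def)
  moreover have "{\<omega> \<in> space M. Z (r + (t - r) * j / N) \<omega> = k}
      \<in> events_generated_by M Z {0..r + (t - r) * Suc i / N}" if "j \<le> Suc i" for j k
    by (rule state_event_in_events_generated_by)
       (use assms grid_point_mono[OF assms(2) that, of N] in auto)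
  then have "(\<Inter>j\<in>{..i}. {\<omega> \<in> space M. Z (r + (t - r) * j / N) \<omega> = n})
      \<inter> {\<omega> \<in> space M. Z (r + (t - r) * Suc i / N) \<omega> = m}
      \<in> events_generated_by M Z {0..r + (t - r) * Suc i / N}"
    by (intro E.Int E.finite_INT) (simp_all del: of_nat_Suc)
  ultimately show ?thesis by (simp only:)
qed

lemma grid_exit_event_sets:
  assumes "0 \<le> r" "r \<le> t"
  shows "grid_exit_event r t n m N i \<in> sets M"
  using grid_exit_event_in_events_generated_by[OF assms] events_generated_by_subset_sets[of "{0..r + (t - r) * Suc i / N}"]
  by auto

text \<open>
After its first jump a right-continuous path keeps the new value for a short while, so every
sufficiently fine grid has a point in that stretch, and the first such point sees the new value.
\<close>
lemma first_jump_event_subset_liminf_grid_exit: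
  assumes rt: "0 \<le> r" "r \<le> t"
  shows "first_jump_event M Z r t n m
    \<subseteq> (\<Union>K. \<Inter>N\<in>{K..}. \<Union>i<Suc N. grid_exit_event r t n m (Suc N) i)"
proof
  fix \<omega> assume "\<omega> \<in> first_jump_event M Z r t n m"
  then have \<omega>: "\<omega> \<in> space M"
    and "\<exists>u\<in>{r<..t}. (\<forall>v\<in>{r..<u}. Z v \<omega> = n) \<and> Z u \<omega> = m"
    by (simp_all add: first_jump_event_def)
  then obtain u where u: "r < u" "u \<le> t"
    and stay: "\<forall>v\<in>{r..<u}. Z v \<omega> = n" and at: "Z u \<omega> = m"
    by (elim bexE conjE) (rule that; simp)
  have before: "Z v \<omega> = n" if "r \<le> v" "v < u" for v
    using stay that by simp
  have "((\<lambda>v. Z v \<omega>) \<longlongrightarrow> m) (at_right u)"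
    using Z_right_continuous[OF \<omega>, of u] u rt at by (simp add: continuous_within)
  then have "eventually (\<lambda>v. Z v \<omega> = m) (at_right u)" by (simp add: tendsto_discrete)
  then obtain b where b: "u < b" "\<And>v. u < v \<Longrightarrow> v < b \<Longrightarrow> Z v \<omega> = m"
    by (auto simp: eventually_at_right_field)
  obtain K :: nat where K: "(t - r) / (b - u) < real K" using reals_Archimedean2 by blast
  have "\<omega> \<in> (\<Union>i<Suc N. grid_exit_event r t n m (Suc N) i)" if N: "K \<le> N" for N
  proof -
    define g where "g j = r + (t - r) * real j / real (Suc N)" for j
    define j where "j = (LEAST j. u \<le> g j)"
    have last: "u \<le> g (Suc N)" using u by (simp add: g_def)
    have uj: "u \<le> g j" unfolding j_def by (rule LeastI[where P = "\<lambda>j. u \<le> g j", OF last])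
    have less: "g i < u" if "i < j" for i using not_less_Least[where P = "\<lambda>j. u \<le> g j" and k = i] that by (simp add: j_def)
    have "j \<le> Suc N" unfolding j_def by (rule Least_le[where P = "\<lambda>j. u \<le> g j", OF last])
    have "g 0 = r" by (simp add: g_def)
    then have "j \<noteq> 0" using uj u by (intro notI) simp
    then obtain i where i: "j = Suc i" by (cases j) auto
    have "(t - r) / (b - u) < real (Suc N)" using K N by (simp)
    then have "(t - r) / real (Suc N) < b - u" using b by (simp add: field_simps)
    moreover have "g (Suc i) = g i + (t - r) / real (Suc N)" by (simp add: g_def add_divide_distrib distrib_left)
    ultimately have "g j < b" using less[of i] i by simp
    then have "Z (g j) \<omega> = m" using b(2)[of "g j"] uj at by (cases "g j = u") auto
    moreover have "Z (g k) \<omega> = n" if "k \<le> i" for k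
    proof (rule before)
      show "r \<le> g k" using rt by (simp add: g_def)
      show "g k < u" using less that i by simp
    qed
    ultimately have "\<omega> \<in> grid_exit_event r t n m (Suc N) i"
      using \<omega> i by (simp add: grid_exit_event_def g_def)
    then show ?thesis using i \<open>j \<le> Suc N\<close> by auto
  qed
  then show "\<omega> \<in> (\<Union>K. \<Inter>N\<in>{K..}. \<Union>i<Suc N. grid_exit_event r t n m (Suc N) i)"
    by blast
qed

text \<open>
The events for different \<open>i\<close> are disjoint, so the estimates obtained from the Markov property at the
individual grid points can be added.
\<close>
lemma prob_grid_exit_le:
  assumes rt: "0 \<le> r" "r \<le> t" and "n \<noteq> m" and "0 < N"
  shows "exp (- real m * (cumulative_rate lam t - cumulative_rate lam r))
      * prob (\<Union>i<N. grid_exit_event r t n m N i)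
    \<le> \<P>(\<omega> in M. Z r \<omega> = n \<and> Z t \<omega> = m)"
proof -
  let ?D = "grid_exit_event r t n m N" and ?T = "{\<omega> \<in> space M. Z t \<omega> = m}"
  let ?e = "exp (- real m * (cumulative_rate lam t - cumulative_rate lam r))"
  have exit: "Z (r + (t - r) * Suc i / N) \<omega> = m" and before: "k \<le> i \<Longrightarrow> Z (r + (t - r) * k / N) \<omega> = n"
    if "\<omega> \<in> ?D i" for \<omega> i k
    using that unfolding grid_exit_event_def by blast+
  have disj: "disjoint_family_on ?D {..<N}"
    unfolding disjoint_family_on_def
  proof (intro ballI impI)
    fix i j :: nat assume "i \<noteq> j"
    then consider "Suc i \<le> j" | "Suc j \<le> i" by linarith
    then show "?D i \<inter> ?D j = {}"
    proof cases
      case 1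
      then show ?thesis using exit[of _ i] before[of _ j "Suc i"] \<open>n \<noteq> m\<close> by fastforce
    next
      case 2
      then show ?thesis using exit[of _ j] before[of _ i "Suc j"] \<open>n \<noteq> m\<close> by fastforce
    qed
  qed
  have each: "?e * prob (?D i) \<le> prob (?D i \<inter> ?T)" if "i < N" for i
  proof -
    let ?v = "r + (t - r) * Suc i / N"
    have v: "0 \<le> ?v" "r \<le> ?v" "?v \<le> t"
      using rt grid_point_le[OF rt(2), of "Suc i" N] that by auto
    have "?e \<le> exp (- real m * (cumulative_rate lam t - cumulative_rate lam ?v))"
      using cumulative_rate_mono[OF rt(1) v(2)] by (simp add: mult_left_mono)
    then have "?e * prob (?D i) \<le> exp (- real m * (cumulative_rate lam t - cumulative_rate lam ?v)) * prob (?D i)"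
      by (intro mult_right_mono) auto
    also have "\<dots> \<le> prob (?D i \<inter> ?T)"
      by (rule prob_persist_after[OF v(1,3) grid_exit_event_in_events_generated_by[OF rt]])
         (use exit grid_exit_event_sets[OF rt] sets.sets_into_space in blast)
    finally show ?thesis .
  qed
  have sets: "?D i \<in> sets M" "?D i \<inter> ?T \<in> sets M" for i
    using grid_exit_event_sets[OF rt] rt by auto
  have "?e * prob (\<Union>i<N. ?D i) = (\<Sum>i<N. ?e * prob (?D i))"
    using disj sets by (subst finite_measure_finite_Union) (auto simp: sum_distrib_left)
  also have "\<dots> \<le> (\<Sum>i<N. prob (?D i \<inter> ?T))"
    using each by (intro sum_mono) auto
  also have "\<dots> = prob (\<Union>i<N. ?D i \<inter> ?T)"
    using disj sets by (intro finite_measure_finite_Union[symmetric]) (auto simp: disjoint_family_on_def)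
  also have "\<dots> \<le> \<P>(\<omega> in M. Z r \<omega> = n \<and> Z t \<omega> = m)"
  proof (rule finite_measure_mono)
    show "(\<Union>i<N. ?D i \<inter> ?T) \<subseteq> {\<omega> \<in> space M. Z r \<omega> = n \<and> Z t \<omega> = m}"
      using before[of _ _ 0] by auto
    show "{\<omega> \<in> space M. Z r \<omega> = n \<and> Z t \<omega> = m} \<in> sets M"
      using rt by (intro joint_state_sets) auto
  qed
  finally show ?thesis .
qed

text \<open>
A substitute for the strong Markov property at the first jump. The inclusion above compares the first
jump event with a limit inferior of measurable events, whose probability is controlled from the
grid estimate by continuity from below.
\<close>
lemma prob_first_jump_le:
  assumes rt: "0 \<le> r" "r \<le> t" and "n \<noteq> m"
  shows "exp (- real m * (cumulative_rate lam t - cumulative_rate lam r))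
      * measure M (first_jump_event M Z r t n m)
    \<le> \<P>(\<omega> in M. Z r \<omega> = n \<and> Z t \<omega> = m)"
proof -
  let ?e = "exp (- real m * (cumulative_rate lam t - cumulative_rate lam r))"
  define D where "D N = (\<Union>i<Suc N. grid_exit_event r t n m (Suc N) i)" for N
  define I where "I K = (\<Inter>N\<in>{K..}. D N)" for K
  have D: "D N \<in> sets M" for N
    unfolding D_def using grid_exit_event_sets[OF rt] by auto
  then have I: "I K \<in> sets M" for K
    unfolding I_def by (intro sets.countable_INT) auto
  have lim: "(\<lambda>K. ?e * prob (I K)) \<longlonglongrightarrow> ?e * prob (\<Union>K. I K)"
    by (intro tendsto_mult_left finite_Lim_measure_incseq)
       (use I in \<open>auto simp: I_def incseq_def\<close>)
  have bound: "?e * prob (I K) \<le> \<P>(\<omega> in M. Z r \<omega> = n \<and> Z t \<omega> = m)" for K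
  proof -
    have "prob (I K) \<le> prob (D K)" using D by (intro finite_measure_mono) (auto simp: I_def)
    then have "?e * prob (I K) \<le> ?e * prob (D K)" by simp
    also have "\<dots> \<le> \<P>(\<omega> in M. Z r \<omega> = n \<and> Z t \<omega> = m)"
      unfolding D_def by (rule prob_grid_exit_le[OF assms]) simp
    finally show ?thesis .
  qed
  have limit: "?e * prob (\<Union>K. I K) \<le> \<P>(\<omega> in M. Z r \<omega> = n \<and> Z t \<omega> = m)"
    using bound by (intro LIMSEQ_le_const2[OF lim]) blast
  have "measure M (first_jump_event M Z r t n m) \<le> prob (\<Union>K. I K)"
  proof (rule finite_measure_mono)
    show "first_jump_event M Z r t n m \<subseteq> (\<Union>K. I K)"
      unfolding I_def D_def by (rule first_jump_event_subset_liminf_grid_exit[OF rt])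
  qed (use I in blast)
  then have "?e * measure M (first_jump_event M Z r t n m) \<le> ?e * prob (\<Union>K. I K)"
    by (intro mult_left_mono) simp_all
  then show ?thesis using limit by linarith
qed

lemma jump_rate_nonneg: "0 \<le> t \<Longrightarrow> 0 \<le> jump_rate lam p t n m"
  using rate_nonneg by (simp add: jump_rate_def)

lemma prob_transition_ge:
  assumes rt: "0 \<le> r" "r \<le> t" and "n \<noteq> m"
    and integrable: "set_integrable lborel {r..t} (\<lambda>u. jump_rate lam p u n m)"
  shows "\<P>(\<omega> in M. Z r \<omega> = n)
      * (exp (- (real n + real m) * (cumulative_rate lam t - cumulative_rate lam r))
         * (LBINT u:{r..t}. jump_rate lam p u n m))
    \<le> \<P>(\<omega> in M. Z r \<omega> = n \<and> Z t \<omega> = m)"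
proof -
  let ?L = "cumulative_rate lam"
  define en where "en = exp (- real n * (?L t - ?L r))"
  define em where "em = exp (- real m * (?L t - ?L r))"
  have cont: "continuous_on {r..t} ?L"
    by (rule continuous_on_subset[OF clock.clock_continuous[OF clock_cumulative_rate[of t]]])
       (use rt in auto)
  have int1: "set_integrable lborel {r..t} (\<lambda>u. jump_rate lam p u n m * exp (- real n * (?L u - ?L r)))"
  proof -
    have "continuous_on {r..t} (\<lambda>u. exp (- real n * (?L u - ?L r)))"
      by (intro continuous_intros cont)
    from set_integrable_mult_continuous[OF integrable this] show ?thesis
      by (simp only: mult.commute)
  qed
  have "en * (LBINT u:{r..t}. jump_rate lam p u n m) = (LBINT u:{r..t}. en * jump_rate lam p u n m)"
    by simp
  also have "\<dots> \<le> (LBINT u:{r..t}. jump_rate lam p u n m * exp (- real n * (?L u - ?L r)))"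
  proof (rule set_integral_mono)
    show "set_integrable lborel {r..t} (\<lambda>u. en * jump_rate lam p u n m)" using integrable by simp
    fix u assume u: "u \<in> {r..t}"
    have "en \<le> exp (- real n * (?L u - ?L r))"
      unfolding en_def using cumulative_rate_mono[of u t] u rt by (auto intro!: mult_left_mono)
    then show "en * jump_rate lam p u n m \<le> jump_rate lam p u n m * exp (- real n * (?L u - ?L r))"
      using jump_rate_nonneg[of u n m] u rt
      by (subst mult.commute[of en]) (intro mult_left_mono, auto)
  qed (rule int1)
  finally have le: "en * (LBINT u:{r..t}. jump_rate lam p u n m)
      \<le> (LBINT u:{r..t}. jump_rate lam p u n m * exp (- real n * (?L u - ?L r)))" .
  have "em * (\<P>(\<omega> in M. Z r \<omega> = n) * (en * (LBINT u:{r..t}. jump_rate lam p u n m)))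
      \<le> em * measure M (first_jump_event M Z r t n m)"
    unfolding Z_jump[OF rt \<open>n \<noteq> m\<close>] using le
    by (intro mult_left_mono) (auto simp: em_def)
  also have "\<dots> \<le> \<P>(\<omega> in M. Z r \<omega> = n \<and> Z t \<omega> = m)"
    unfolding em_def by (rule prob_first_jump_le[OF rt \<open>n \<noteq> m\<close>])
  finally have "em * (\<P>(\<omega> in M. Z r \<omega> = n) * (en * (LBINT u:{r..t}. jump_rate lam p u n m)))
      \<le> \<P>(\<omega> in M. Z r \<omega> = n \<and> Z t \<omega> = m)" .
  moreover have "exp (- (real n + real m) * (?L t - ?L r)) = en * em"
    by (simp add: en_def em_def algebra_simps flip: exp_add)
  ultimately show ?thesis by (simp add: mult_ac)
qed

end

section \<open>One step of the generating functional\<close>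

text \<open>
The source of all constants that are uniform in the population size: errors grow at most quadratically
with the number of individuals, whereas the test functions decay geometrically.
\<close>
lemma quadratic_times_power_bounded:
  fixes R :: real
  assumes "0 \<le> R" "R < 1"
  obtains C where "0 \<le> C" "\<And>m. real (m + 1) * real (2 * m + 1) * R^m \<le> C"
proof -
  have R: "sqrt R < 1" "0 \<le> sqrt R" using assms by (auto simp: real_sqrt_lt_1_iff)
  have "(\<lambda>m. of_nat m * sqrt R^m) \<longlonglongrightarrow> 0" using R by (intro powser_times_n_limit_0) simp
  then have "Bseq (\<lambda>m. real m * sqrt R^m)" by (intro convergent_imp_Bseq) (auto simp: convergent_def)
  then obtain K where K: "\<And>m. \<bar>real m * sqrt R^m\<bar> \<le> K"
    unfolding Bseq_def real_norm_def by blast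
  show thesis
  proof (rule that)
    fix m
    have "(real m * sqrt R^m)^2 \<le> K^2"
      using power_mono[OF K[of m], of 2] by simp
    moreover have "(sqrt R^m)^2 = R^m"
      using assms by (metis power_mult power_mult_distrib mult.commute real_sqrt_pow2)
    ultimately have "real m^2 * R^m \<le> K^2" by (simp add: power_mult_distrib)
    moreover have "R^m \<le> 1" using assms by (intro power_le_one) auto
    moreover have "real (m + 1) * real (2 * m + 1) \<le> 6 * real m^2 + 1"
    proof (cases m)
      case (Suc k)
      then show ?thesis by (simp add: power2_eq_square algebra_simps)
    qed simp
    then have "real (m + 1) * real (2 * m + 1) * R^m \<le> (6 * real m^2 + 1) * R^m"
      using assms by (intro mult_right_mono) auto
    ultimately show "real (m + 1) * real (2 * m + 1) * R^m \<le> 6 * K^2 + 1"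
      by (simp add: distrib_right)
  qed simp
qed

lemma (in prob_space) expectation_sums_by_value:
  fixes X :: "'a \<Rightarrow> nat" and f :: "'a \<Rightarrow> real"
  assumes X: "X \<in> measurable M (count_space UNIV)" and f: "integrable M f"
  shows "(\<lambda>n. \<integral>\<omega>. indicator {\<omega> \<in> space M. X \<omega> = n} \<omega> * f \<omega> \<partial>M) sums (\<integral>\<omega>. f \<omega> \<partial>M)"
proof -
  have sets: "{\<omega> \<in> space M. X \<omega> = n} \<in> sets M" for n
  proof -
    have "{\<omega> \<in> space M. X \<omega> = n} = X -` {n} \<inter> space M" by auto
    then show ?thesis using measurable_sets[OF X, of "{n}"] by simp
  qed
  have int: "integrable M (\<lambda>\<omega>. indicator {\<omega> \<in> space M. X \<omega> = n} \<omega> * f \<omega>)" for n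
    using integrable_real_mult_indicator[OF sets f] by (simp only: mult.commute)
  have partial: "(\<Sum>n<N. indicator {\<omega> \<in> space M. X \<omega> = n} \<omega> * f \<omega>) = (if X \<omega> < N then f \<omega> else 0)"
    if "\<omega> \<in> space M" for N \<omega>
    using that by (induction N) (auto simp: indicator_def less_Suc_eq)
  have "(\<lambda>N. \<integral>\<omega>. (\<Sum>n<N. indicator {\<omega> \<in> space M. X \<omega> = n} \<omega> * f \<omega>) \<partial>M) \<longlonglongrightarrow> (\<integral>\<omega>. f \<omega> \<partial>M)"
  proof (rule integral_dominated_convergence[where w = "\<lambda>\<omega>. \<bar>f \<omega>\<bar>"])
    show "AE \<omega> in M. (\<lambda>N. \<Sum>n<N. indicator {\<omega> \<in> space M. X \<omega> = n} \<omega> * f \<omega>) \<longlonglongrightarrow> f \<omega>"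
    proof (rule AE_I2)
      fix \<omega> assume \<omega>: "\<omega> \<in> space M"
      have "eventually (\<lambda>N. (\<Sum>n<N. indicator {\<omega> \<in> space M. X \<omega> = n} \<omega> * f \<omega>) = f \<omega>) sequentially"
        using eventually_gt_at_top[of "X \<omega>"] by eventually_elim (simp only: partial[OF \<omega>] if_True)
      then show "(\<lambda>N. \<Sum>n<N. indicator {\<omega> \<in> space M. X \<omega> = n} \<omega> * f \<omega>) \<longlonglongrightarrow> f \<omega>"
        by (rule tendsto_eventually)
    qed
    show "AE \<omega> in M. norm (\<Sum>n<N. indicator {\<omega> \<in> space M. X \<omega> = n} \<omega> * f \<omega>) \<le> \<bar>f \<omega>\<bar>" for N
      by (rule AE_I2) (simp only: partial, simp)
    show "f \<in> borel_measurable M" "integrable M (\<lambda>\<omega>. \<bar>f \<omega>\<bar>)" using f by simp_all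
    show "(\<lambda>\<omega>. \<Sum>n<N. indicator {\<omega> \<in> space M. X \<omega> = n} \<omega> * f \<omega>) \<in> borel_measurable M" for N
      by (rule borel_measurable_integrable[OF Bochner_Integration.integrable_sum[OF int]])
  qed
  moreover have "(\<integral>\<omega>. (\<Sum>n<N. indicator {\<omega> \<in> space M. X \<omega> = n} \<omega> * f \<omega>) \<partial>M)
      = (\<Sum>n<N. \<integral>\<omega>. indicator {\<omega> \<in> space M. X \<omega> = n} \<omega> * f \<omega> \<partial>M)" for N
    using int by (intro Bochner_Integration.integral_sum) auto
  ultimately show ?thesis by (simp only: sums_def)
qed

context theta_positive_branching_process
begin

text \<open>
The power series coefficients of \<open>- (1 - x) + (1 - x) powr (1 + \<theta>) / (1 + \<theta>)\<close>, by the binomial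
series.
\<close>
definition offspring_coeff :: "nat \<Rightarrow> real" where
  "offspring_coeff k =
     (if k = 0 then -1 else if k = 1 then 1 else 0) + ((1 + \<theta>) gchoose k) * (-1)^k / (1 + \<theta>)"

lemma offspring_coeff_sums:
  assumes "0 \<le> x" "x < 1"
  shows "(\<lambda>k. offspring_coeff k * x^k) sums (- (1 - x) + (1 - x) powr (1 + \<theta>) / (1 + \<theta>))"
proof -
  have "(\<lambda>k. (if k = 0 then -1 else if k = 1 then 1 else 0) * x^k)
      sums (\<Sum>k\<in>{0, 1}. (if k = 0 then -1 else if k = 1 then 1 else 0) * x^k)"
    by (rule sums_finite) auto
  then have "(\<lambda>k. (if k = 0 then -1 else if k = 1 then 1 else 0) * x^k) sums (- (1 - x))"
    by simp
  moreover have "(\<lambda>k. ((1 + \<theta>) gchoose k) * (-x)^k / (1 + \<theta>)) sums ((1 + - x) powr (1 + \<theta>) / (1 + \<theta>))"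
    using assms by (intro sums_divide gen_binomial_real) auto
  ultimately have "(\<lambda>k. (if k = 0 then -1 else if k = 1 then 1 else 0) * x^k
      + ((1 + \<theta>) gchoose k) * (-x)^k / (1 + \<theta>)) sums (- (1 - x) + (1 + - x) powr (1 + \<theta>) / (1 + \<theta>))"
    by (rule sums_add)
  moreover have "(if k = 0 then -1 else if k = 1 then 1 else 0) * x^k
      + ((1 + \<theta>) gchoose k) * (-x)^k / (1 + \<theta>) = offspring_coeff k * x^k" for k
  proof -
    have "(-x)^k = (-1)^k * x^k" by (metis power_minus)
    then show ?thesis unfolding offspring_coeff_def by (simp only: distrib_right mult.assoc times_divide_eq_left)
  qed
  ultimately show ?thesis by simp
qed

text \<open>
The offspring law depends on time only through \<open>a t\<close>, and affinely. This makes the offspring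
probabilities measurable functions of time and allows sums over the offspring number and
integrals over time to be interchanged trivially.
\<close>
lemma pmf_offspring:
  assumes "0 \<le> t"
  shows "pmf (p t) k = (if k = 0 then 1 else 0) + a t * offspring_coeff k"
proof -
  have "pmf (p t) k - ((if k = 0 then 1 else 0) + a t * offspring_coeff k) = 0"
  proof (rule power_series_unique[of "\<lambda>k. pmf (p t) k - ((if k = 0 then 1 else 0) + a t * offspring_coeff k)"])
    fix x :: real assume x: "0 \<le> x" "x < 1"
    have one: "(\<lambda>k. (if k = 0 then 1 else 0) * x^k) sums 1"
      using sums_If_finite_set[of "{0}" "\<lambda>k. x^k"] by (simp add: if_distrib[of "\<lambda>c. c * _"] cong: if_cong)
    have "(\<lambda>k. pmf (p t) k * x^k - ((if k = 0 then 1 else 0) * x^k + a t * (offspring_coeff k * x^k))) sums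
      ((1 - a t * (1 - x) + a t / (1 + \<theta>) * (1 - x) powr (1 + \<theta>))
        - (1 + a t * (- (1 - x) + (1 - x) powr (1 + \<theta>) / (1 + \<theta>))))"
      by (intro sums_diff sums_add sums_mult offspring_pgf one offspring_coeff_sums) (use assms x in auto)
    then show "(\<lambda>k. (pmf (p t) k - ((if k = 0 then 1 else 0) + a t * offspring_coeff k)) * x^k) sums 0"
      by (simp add: algebra_simps)
  qed
  then show ?thesis by simp
qed

definition offspring_rate :: "real \<Rightarrow> real" where
  "offspring_rate t = (LBINT u:{0..t}. a u * lam u)"

lemma offspring_rate_integrable:
  assumes "0 \<le> t"
  shows "set_integrable lborel {0..t} (\<lambda>u. a u * lam u)"
proof (rule set_integrable_bound)
  show "set_integrable lborel {0..t} (\<lambda>u. (1 + 1 / \<theta>) * lam u)"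
    using rate_integrable[OF assms] by simp
  have "(\<lambda>u. (indicator {0..t} u * (indicator {0..} u *\<^sub>R a u)) * (indicator {0..} u *\<^sub>R lam u)) \<in> borel_measurable borel"
    using mean_offspring_measurable rate_measurable unfolding set_borel_measurable_def by simp
  moreover have "(\<lambda>u. (indicator {0..t} u * (indicator {0..} u *\<^sub>R a u)) * (indicator {0..} u *\<^sub>R lam u))
      = (\<lambda>u. indicator {0..t} u *\<^sub>R (a u * lam u))"
    by (auto simp: indicator_def)
  ultimately show "set_borel_measurable lborel {0..t} (\<lambda>u. a u * lam u)"
    unfolding set_borel_measurable_def by simp
  show "AE u in lborel. u \<in> {0..t} \<longrightarrow> norm (a u * lam u) \<le> norm ((1 + 1 / \<theta>) * lam u)"
  proof (intro AE_I2 impI)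
    fix u assume u: "u \<in> {0..t}"
    have "a u * lam u \<le> (1 + 1 / \<theta>) * lam u" "0 \<le> a u * lam u" "0 \<le> (1 + 1 / \<theta>) * lam u"
      using u mean_offspring_range[of u] rate_nonneg[of u] theta_range
      by (auto intro!: mult_right_mono mult_nonneg_nonneg add_nonneg_nonneg)
    then show "norm (a u * lam u) \<le> norm ((1 + 1 / \<theta>) * lam u)" by simp
  qed
qed

lemma rate_integrable_Icc:
  assumes "0 \<le> r"
  shows "set_integrable lborel {r..t} lam" "set_integrable lborel {r..t} (\<lambda>u. a u * lam u)"
proof -
  have sub: "{r..t} \<subseteq> {0..max r t}" "0 \<le> max r t" using assms by auto
  show "set_integrable lborel {r..t} lam"
    by (rule set_integrable_subset[OF rate_integrable[OF sub(2)] _ sub(1)]) simp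
  show "set_integrable lborel {r..t} (\<lambda>u. a u * lam u)"
    by (rule set_integrable_subset[OF offspring_rate_integrable[OF sub(2)] _ sub(1)]) simp
qed

lemma offspring_rate_diff:
  assumes "0 \<le> r" "r \<le> t"
  shows "offspring_rate t - offspring_rate r = (LBINT u:{r..t}. a u * lam u)"
  unfolding offspring_rate_def using assms
  by (intro set_integral_Icc_diff offspring_rate_integrable) auto

lemma offspring_rate_diff_bounds:
  assumes "0 \<le> r" "r \<le> t"
  shows "0 \<le> offspring_rate t - offspring_rate r"
    and "offspring_rate t - offspring_rate r \<le> (1 + 1 / \<theta>) * (cumulative_rate lam t - cumulative_rate lam r)"
proof -
  have "(LBINT u:{r..t}. 0 * lam u) \<le> (LBINT u:{r..t}. a u * lam u)"
    by (intro set_integral_mono rate_integrable_Icc mult_right_mono set_integrable_mult_right)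
       (use assms mean_offspring_range rate_nonneg in auto)
  then show "0 \<le> offspring_rate t - offspring_rate r"
    using offspring_rate_diff[OF assms] by simp
  have "(LBINT u:{r..t}. a u * lam u) \<le> (LBINT u:{r..t}. (1 + 1 / \<theta>) * lam u)"
    by (intro set_integral_mono rate_integrable_Icc mult_right_mono set_integrable_mult_right)
       (use assms mean_offspring_range rate_nonneg in auto)
  also have "\<dots> = (1 + 1 / \<theta>) * (LBINT u:{r..t}. lam u)" by (rule set_integral_mult_right)
  finally show "offspring_rate t - offspring_rate r
      \<le> (1 + 1 / \<theta>) * (cumulative_rate lam t - cumulative_rate lam r)"
    using offspring_rate_diff[OF assms] cumulative_rate_diff[OF assms] by simp
qed

text \<open>
The integral of \<open>lam u * pmf (p u) k\<close> over \<open>u\<close> from \<open>r\<close> to \<open>t\<close>, written out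
by means of \<open>pmf_offspring\<close>; \<open>replacement_pgf\<close> is its generating function.
\<close>
definition replacement_mass :: "real \<Rightarrow> real \<Rightarrow> nat \<Rightarrow> real" where
  "replacement_mass r t k =
     (if k = 0 then cumulative_rate lam t - cumulative_rate lam r else 0)
     + (offspring_rate t - offspring_rate r) * offspring_coeff k"

lemma replacement_mass_integral:
  assumes "0 \<le> r" "r \<le> t"
  shows "set_integrable lborel {r..t} (\<lambda>u. lam u * pmf (p u) k)"
    and "(LBINT u:{r..t}. lam u * pmf (p u) k) = replacement_mass r t k"
proof -
  have eq: "lam u * pmf (p u) k = (if k = 0 then 1 else 0) * lam u + offspring_coeff k * (a u * lam u)"
    if "u \<in> {r..t}" for u
    using that assms by (simp add: pmf_offspring algebra_simps)
  have int: "set_integrable lborel {r..t} (\<lambda>u. (if k = 0 then 1 else 0) * lam u)"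
      "set_integrable lborel {r..t} (\<lambda>u. offspring_coeff k * (a u * lam u))"
    using rate_integrable_Icc[OF assms(1), of t] by auto
  then have "set_integrable lborel {r..t} (\<lambda>u. (if k = 0 then 1 else 0) * lam u + offspring_coeff k * (a u * lam u))"
    by (rule set_integral_add)
  then show "set_integrable lborel {r..t} (\<lambda>u. lam u * pmf (p u) k)"
    by (subst set_integrable_cong[OF refl refl eq])
  have "(LBINT u:{r..t}. lam u * pmf (p u) k)
      = (LBINT u:{r..t}. (if k = 0 then 1 else 0) * lam u + offspring_coeff k * (a u * lam u))"
    using eq by (intro set_lebesgue_integral_cong) auto
  also have "\<dots> = (LBINT u:{r..t}. (if k = 0 then 1 else 0) * lam u) + (LBINT u:{r..t}. offspring_coeff k * (a u * lam u))"
    using int by (rule set_integral_add(2))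
  also have "\<dots> = (if k = 0 then 1 else 0) * (LBINT u:{r..t}. lam u) + offspring_coeff k * (LBINT u:{r..t}. a u * lam u)"
    by (simp only: set_integral_mult_right)
  also have "\<dots> = replacement_mass r t k"
    unfolding replacement_mass_def cumulative_rate_diff[OF assms, symmetric] offspring_rate_diff[OF assms, symmetric]
    by simp
  finally show "(LBINT u:{r..t}. lam u * pmf (p u) k) = replacement_mass r t k" .
qed

lemma replacement_mass_nonneg:
  assumes "0 \<le> r" "r \<le> t"
  shows "0 \<le> replacement_mass r t k"
proof -
  have "(LBINT u:{r..t}. 0 * lam u) \<le> (LBINT u:{r..t}. lam u * pmf (p u) k)"
    by (intro set_integral_mono rate_integrable_Icc replacement_mass_integral set_integrable_mult_right)
       (use assms rate_nonneg in auto)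
  then show ?thesis using replacement_mass_integral[OF assms] by simp
qed

lemma replacement_mass_1:
  assumes "0 \<le> r" "r \<le> t"
  shows "replacement_mass r t 1 = 0"
proof -
  have "(LBINT u:{r..t}. lam u * pmf (p u) 1) = (LBINT u:{r..t}. 0)"
    using no_single_offspring assms by (intro set_lebesgue_integral_cong) auto
  then show ?thesis using replacement_mass_integral[OF assms, of 1] by simp
qed

definition replacement_pgf :: "real \<Rightarrow> real \<Rightarrow> real \<Rightarrow> real" where
  "replacement_pgf r t x = (cumulative_rate lam t - cumulative_rate lam r)
     + (offspring_rate t - offspring_rate r) * (- (1 - x) + (1 - x) powr (1 + \<theta>) / (1 + \<theta>))"

lemma replacement_mass_sums:
  assumes "0 \<le> x" "x < 1"
  shows "(\<lambda>k. replacement_mass r t k * x^k) sums replacement_pgf r t x"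
proof -
  let ?D = "cumulative_rate lam t - cumulative_rate lam r"
  have "(\<lambda>k. if k \<in> {0} then ?D * x^k else 0) sums (\<Sum>k\<in>{0}. ?D * x^k)"
    by (rule sums_If_finite_set) simp
  moreover have "(\<lambda>k. (offspring_rate t - offspring_rate r) * (offspring_coeff k * x^k))
      sums ((offspring_rate t - offspring_rate r) * (- (1 - x) + (1 - x) powr (1 + \<theta>) / (1 + \<theta>)))"
    by (intro sums_mult offspring_coeff_sums assms)
  ultimately have "(\<lambda>k. (if k \<in> {0} then ?D * x^k else 0)
      + (offspring_rate t - offspring_rate r) * (offspring_coeff k * x^k)) sums
      ((\<Sum>k\<in>{0}. ?D * x^k)
        + (offspring_rate t - offspring_rate r) * (- (1 - x) + (1 - x) powr (1 + \<theta>) / (1 + \<theta>)))"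
    by (rule sums_add)
  moreover have "(if k \<in> {0} then ?D * x^k else 0) + (offspring_rate t - offspring_rate r) * (offspring_coeff k * x^k)
      = replacement_mass r t k * x^k" for k
    by (simp add: replacement_mass_def distrib_right)
  ultimately show ?thesis by (simp add: replacement_pgf_def)
qed

lemma replacement_pgf_le:
  assumes "0 \<le> r" "r \<le> t" "0 \<le> x" "x < 1"
  shows "replacement_pgf r t x \<le> cumulative_rate lam t - cumulative_rate lam r"
proof -
  have "(1 - x) powr (1 + \<theta>) \<le> (1 - x) powr 1"
    using assms theta_range by (intro powr_mono') auto
  also have "\<dots> = 1 - x" using assms by simp
  finally have "(1 - x) powr (1 + \<theta>) \<le> 1 - x" .
  then have "(1 - x) powr (1 + \<theta>) / (1 + \<theta>) \<le> (1 - x) / 1"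
    using theta_range assms by (intro frac_le) auto
  then have "(offspring_rate t - offspring_rate r) * (- (1 - x) + (1 - x) powr (1 + \<theta>) / (1 + \<theta>)) \<le> 0"
    using offspring_rate_diff_bounds(1)[OF assms(1,2)] by (intro mult_nonneg_nonpos) auto
  then show ?thesis by (simp add: replacement_pgf_def)
qed

lemma prob_transition_ge_linear:
  assumes rt: "0 \<le> r" "r \<le> t"
  defines "D \<equiv> cumulative_rate lam t - cumulative_rate lam r"
  shows "\<P>(\<omega> in M. Z r \<omega> = n)
      * ((if m = n then 1 - real n * D else 0)
         + (if n \<le> m + 1 then (1 - (real n + real m) * D) * (real n * replacement_mass r t (m + 1 - n)) else 0))
    \<le> \<P>(\<omega> in M. Z r \<omega> = n \<and> Z t \<omega> = m)"
proof (cases "m = n")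
  case True
  have "1 - real n * D \<le> exp (- real n * D)" using exp_ge_add_one_self[of "- real n * D"] by simp
  then have "\<P>(\<omega> in M. Z r \<omega> = n) * (1 - real n * D) \<le> \<P>(\<omega> in M. Z r \<omega> = n) * exp (- real n * D)"
    by (intro mult_left_mono) auto
  also have "\<dots> \<le> \<P>(\<omega> in M. Z r \<omega> = n \<and> Z t \<omega> = n)"
    unfolding D_def by (rule prob_stay_le[OF rt])
  finally show ?thesis
    using True replacement_mass_1[OF rt] by simp
next
  case False
  show ?thesis
  proof (cases "n \<le> m + 1")
    case le: True
    have rate: "jump_rate lam p u n m = real n * (lam u * pmf (p u) (m + 1 - n))" for u
      using le by (simp add: jump_rate_def mult.assoc)
    have int: "set_integrable lborel {r..t} (\<lambda>u. jump_rate lam p u n m)"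
      unfolding rate using replacement_mass_integral(1)[OF rt] by (intro set_integrable_mult_right)
    have val: "(LBINT u:{r..t}. jump_rate lam p u n m) = real n * replacement_mass r t (m + 1 - n)"
      unfolding rate set_integral_mult_right replacement_mass_integral(2)[OF rt] ..
    have "1 - (real n + real m) * D \<le> exp (- (real n + real m) * D)"
      using exp_ge_add_one_self[of "- (real n + real m) * D"] by (simp only: mult_minus_left)
    then have "\<P>(\<omega> in M. Z r \<omega> = n) * ((1 - (real n + real m) * D) * (real n * replacement_mass r t (m + 1 - n)))
        \<le> \<P>(\<omega> in M. Z r \<omega> = n) * (exp (- (real n + real m) * D) * (real n * replacement_mass r t (m + 1 - n)))"
      using replacement_mass_nonneg[OF rt] by (intro mult_left_mono mult_right_mono) auto
    also have "\<dots> \<le> \<P>(\<omega> in M. Z r \<omega> = n \<and> Z t \<omega> = m)"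
      using prob_transition_ge[OF rt _ int] False unfolding val D_def by auto
    finally show ?thesis using False le by simp
  qed (use False in simp)
qed

lemma integrable_function_of_state:
  fixes G :: "nat \<Rightarrow> real"
  assumes "0 \<le> t" "\<And>m. \<bar>G m\<bar> \<le> B"
  shows "integrable M (\<lambda>\<omega>. G (Z t \<omega>))"
proof (rule integrable_const_bound[where B = B])
  show "(\<lambda>\<omega>. G (Z t \<omega>)) \<in> borel_measurable M"
    by (rule measurable_compose[OF Z_measurable[OF assms(1)]]) simp
qed (use assms(2) in auto)

lemma expectation_on_state_sums:
  fixes G :: "nat \<Rightarrow> real"
  assumes rt: "0 \<le> r" "0 \<le> t" and G: "\<And>m. \<bar>G m\<bar> \<le> B"
  shows "(\<lambda>m. G m * \<P>(\<omega> in M. Z r \<omega> = n \<and> Z t \<omega> = m)) sums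
    (\<integral>\<omega>. indicator {\<omega> \<in> space M. Z r \<omega> = n} \<omega> * G (Z t \<omega>) \<partial>M)"
proof -
  have "integrable M (\<lambda>\<omega>. indicator {\<omega> \<in> space M. Z r \<omega> = n} \<omega> * G (Z t \<omega>))"
    using integrable_real_mult_indicator[OF state_event_sets[OF rt(1)] integrable_function_of_state[OF rt(2) G]]
    by (simp only: mult.commute)
  from expectation_sums_by_value[OF Z_measurable[OF rt(2)] this]
  have "(\<lambda>m. \<integral>\<omega>. indicator {\<omega> \<in> space M. Z t \<omega> = m} \<omega>
        * (indicator {\<omega> \<in> space M. Z r \<omega> = n} \<omega> * G (Z t \<omega>)) \<partial>M)
      sums (\<integral>\<omega>. indicator {\<omega> \<in> space M. Z r \<omega> = n} \<omega> * G (Z t \<omega>) \<partial>M)" .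
  moreover have "(\<integral>\<omega>. indicator {\<omega> \<in> space M. Z t \<omega> = m} \<omega>
        * (indicator {\<omega> \<in> space M. Z r \<omega> = n} \<omega> * G (Z t \<omega>)) \<partial>M)
      = G m * \<P>(\<omega> in M. Z r \<omega> = n \<and> Z t \<omega> = m)" for m
  proof -
    have "(\<integral>\<omega>. indicator {\<omega> \<in> space M. Z t \<omega> = m} \<omega>
          * (indicator {\<omega> \<in> space M. Z r \<omega> = n} \<omega> * G (Z t \<omega>)) \<partial>M)
        = (\<integral>\<omega>. G m * indicator {\<omega> \<in> space M. Z r \<omega> = n \<and> Z t \<omega> = m} \<omega> \<partial>M)"
      by (rule Bochner_Integration.integral_cong) (auto simp: indicator_def)
    also have "\<dots> = G m * \<P>(\<omega> in M. Z r \<omega> = n \<and> Z t \<omega> = m)"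
      using joint_state_sets[OF rt] by simp
    finally show ?thesis .
  qed
  ultimately show ?thesis by simp
qed

text \<open>
The first-order prediction for the expectation of \<open>x ^ Z t\<close> given \<open>Z r = n\<close>: at most one of the
\<open>n\<close> individuals is replaced, and only once.
\<close>
definition one_step_power :: "real \<Rightarrow> real \<Rightarrow> nat \<Rightarrow> real \<Rightarrow> real" where
  "one_step_power r t n x = x^n + real n * x^(n - 1)
     * (replacement_pgf r t x - x * (cumulative_rate lam t - cumulative_rate lam r))"

text \<open>
Inserting the lower bounds for the transition probabilities requires a nonnegative function
of the state; \<open>y \<le> x\<close> and \<open>b \<le> 1\<close> ensure this. The loss in the transition from \<open>n\<close> to \<open>m\<close>
carries the factor \<open>(n + m) * n\<close>, which the geometric decay of \<open>x ^ m\<close> absorbs.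
\<close>
lemma expectation_one_step_ge:
  assumes R: "0 \<le> R" "R < 1"
  obtains C where "0 \<le> C"
    "\<And>r t n x y b. 0 \<le> r \<Longrightarrow> r \<le> t \<Longrightarrow> 0 \<le> y \<Longrightarrow> y \<le> x \<Longrightarrow> x \<le> R \<Longrightarrow> 0 \<le> b \<Longrightarrow> b \<le> 1 \<Longrightarrow>
       \<P>(\<omega> in M. Z r \<omega> = n) * (one_step_power r t n x - b * one_step_power r t n y
           - C * (cumulative_rate lam t - cumulative_rate lam r)^2)
       \<le> (\<integral>\<omega>. indicator {\<omega> \<in> space M. Z r \<omega> = n} \<omega> * (x ^ Z t \<omega> - b * y ^ Z t \<omega>) \<partial>M)"
proof -
  \<comment> \<open>A base strictly between \<open>R\<close> and 1 leaves room for the quadratic factor, and the replacement masses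
    remain summable against its powers.\<close>
  define S where "S = (1 + R) / 2"
  have S: "0 < S" "R < S" "S < 1" using R by (auto simp: S_def)
  have "0 \<le> R / S" "R / S < 1" using S R by auto
  then obtain C where C: "0 \<le> C" "\<And>m. real (m + 1) * real (2 * m + 1) * (R / S)^m \<le> C"
    by (rule quadratic_times_power_bounded) (rule that)
  show thesis
  proof (rule that[OF C(1)])
    fix r t x y b :: real and n :: nat
    assume rt: "0 \<le> r" "r \<le> t" and xy: "0 \<le> y" "y \<le> x" "x \<le> R" and b: "0 \<le> b" "b \<le> 1"
    define D where "D = cumulative_rate lam t - cumulative_rate lam r"
    have D: "0 \<le> D" using cumulative_rate_mono[OF rt] by (simp add: D_def)
    define G where "G m = x^m - b * y^m" for m
    define J where "J = replacement_mass r t"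
    define P where "P = \<P>(\<omega> in M. Z r \<omega> = n)"
    have J: "0 \<le> J k" for k unfolding J_def by (rule replacement_mass_nonneg[OF rt])
    have G: "0 \<le> G m" "G m \<le> R^m" "\<bar>G m\<bar> \<le> 1" for m
    proof -
      have "b * y^m \<le> 1 * y^m" using b xy by (intro mult_right_mono) auto
      also have "\<dots> \<le> x^m" using xy by (simp add: power_mono)
      finally show 0: "0 \<le> G m" by (simp add: G_def)
      have "0 \<le> b * y^m" using b xy by simp
      moreover have "x^m \<le> R^m" using xy by (intro power_mono) auto
      ultimately show 1: "G m \<le> R^m" by (simp add: G_def)
      moreover have "R^m \<le> 1" using R by (intro power_le_one) auto
      ultimately show "\<bar>G m\<bar> \<le> 1" using 0 by simp
    qed
    have sums: "(\<lambda>m. G m * \<P>(\<omega> in M. Z r \<omega> = n \<and> Z t \<omega> = m)) sums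
      (\<integral>\<omega>. indicator {\<omega> \<in> space M. Z r \<omega> = n} \<omega> * G (Z t \<omega>) \<partial>M)" (is "_ sums ?E")
      by (rule expectation_on_state_sums[OF _ _ G(3)]) (use rt in auto)
    have "P * (one_step_power r t n x - b * one_step_power r t n y - C * D^2) \<le> ?E"
    proof (cases n)
      case 0
      have "P * (one_step_power r t n x - b * one_step_power r t n y - C * D^2) = P * (1 - b) - P * (C * D^2)"
        by (simp add: 0 one_step_power_def algebra_simps)
      also have "\<dots> \<le> G 0 * P" using C(1) by (simp add: P_def G_def mult.commute)
      also have "\<dots> \<le> G 0 * \<P>(\<omega> in M. Z r \<omega> = n \<and> Z t \<omega> = 0)"
        using prob_stay_le[OF rt, of 0] G(1)[of 0] by (intro mult_left_mono) (auto simp: P_def 0)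
      also have "\<dots> = (\<Sum>m\<in>{0}. G m * \<P>(\<omega> in M. Z r \<omega> = n \<and> Z t \<omega> = m))" by simp
      also have "\<dots> \<le> (\<Sum>m. G m * \<P>(\<omega> in M. Z r \<omega> = n \<and> Z t \<omega> = m))"
        by (rule sum_le_suminf) (use sums G(1) in \<open>auto simp: sums_iff\<close>)
      also have "\<dots> = ?E" using sums by (simp add: sums_iff)
      finally show ?thesis .
    next
      case (Suc l)
      \<comment> \<open>\<open>A\<close> collects the paths that stay at \<open>n\<close>, \<open>B\<close> those with one jump, where \<open>l = n - 1\<close> individuals remain
        and \<open>m - l\<close> are born.\<close>
      define A where "A m = (if m = n then (1 - real n * D) * G m else 0)" for m
      define B where "B m = (if m < l then 0
        else real n * J (m - l) * G m - D * C * (J (m - l) * S^(m - l)))" for m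
      have "A sums (\<Sum>m\<in>{n}. (1 - real n * D) * G m)"
        using sums_If_finite_set[of "{n}" "\<lambda>m. (1 - real n * D) * G m"] unfolding A_def by simp
      then have A: "A sums ((1 - real n * D) * G n)" by simp
      have "(\<lambda>k. real n * (x^l * (J k * x^k)) - real n * b * (y^l * (J k * y^k)) - D * C * (J k * S^k))
        sums (real n * (x^l * replacement_pgf r t x) - real n * b * (y^l * replacement_pgf r t y)
            - D * C * replacement_pgf r t S)"
        unfolding J_def
        by (intro sums_diff sums_mult replacement_mass_sums) (use xy R S in auto)
      moreover have "real n * (x^l * (J k * x^k)) - real n * b * (y^l * (J k * y^k)) - D * C * (J k * S^k)
          = B (k + l)" for k
        by (simp add: B_def G_def power_add algebra_simps)
      ultimately have "(\<lambda>k. B (k + l)) sums (real n * (x^l * replacement_pgf r t x)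
            - real n * b * (y^l * replacement_pgf r t y) - D * C * replacement_pgf r t S)"
        by simp
      then have B: "B sums (real n * (x^l * replacement_pgf r t x)
            - real n * b * (y^l * replacement_pgf r t y) - D * C * replacement_pgf r t S)"
        by (subst (asm) sums_zero_iff_shift) (auto simp: B_def)
      have AB: "P * (A m + B m) \<le> G m * \<P>(\<omega> in M. Z r \<omega> = n \<and> Z t \<omega> = m)" for m
      proof -
        have "B m \<le> G m * (if n \<le> m + 1 then (1 - (real n + real m) * D) * (real n * J (m + 1 - n)) else 0)"
        proof (cases "m < l")
          case True
          then show ?thesis using Suc by (simp add: B_def)
        next
          case False
          then have k: "m + 1 - n = m - l" "n \<le> m + 1" using Suc by auto
          have "(real n + real m) * real n * G m \<le> (real (2 * m + 1) * real (m + 1)) * R^m"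
            using k G by (intro mult_mono) auto
          also have "\<dots> = (real (m + 1) * real (2 * m + 1) * (R / S)^m) * S^m"
            using S by (simp add: power_divide)
          also have "\<dots> \<le> C * S^m" using C S by (intro mult_right_mono) auto
          also have "\<dots> \<le> C * S^(m - l)" using C S by (intro mult_left_mono power_decreasing) auto
          finally have "(J (m - l) * D) * ((real n + real m) * real n * G m) \<le> (J (m - l) * D) * (C * S^(m - l))"
            using J D by (intro mult_left_mono) auto
          then show ?thesis using False k by (simp add: B_def algebra_simps)
        qed
        moreover have "A m = G m * (if m = n then 1 - real n * D else 0)" by (simp add: A_def)
        ultimately have "P * (A m + B m) \<le> P * (G m * ((if m = n then 1 - real n * D else 0)
          + (if n \<le> m + 1 then (1 - (real n + real m) * D) * (real n * J (m + 1 - n)) else 0)))"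
          by (intro mult_left_mono) (auto simp: P_def distrib_left)
        also have "\<dots> = G m * (P * ((if m = n then 1 - real n * D else 0)
          + (if n \<le> m + 1 then (1 - (real n + real m) * D) * (real n * J (m + 1 - n)) else 0)))"
          by (simp only: mult.left_commute)
        also have "\<dots> \<le> G m * \<P>(\<omega> in M. Z r \<omega> = n \<and> Z t \<omega> = m)"
          using prob_transition_ge_linear[OF rt, of n m] G(1) unfolding P_def J_def D_def
          by (intro mult_left_mono) auto
        finally show ?thesis .
      qed
      have "P * (((1 - real n * D) * G n) + (real n * (x^l * replacement_pgf r t x)
            - real n * b * (y^l * replacement_pgf r t y) - D * C * replacement_pgf r t S)) \<le> ?E"
        using sums_le[OF AB sums_mult[OF sums_add[OF A B]] sums] .
      moreover have "D * C * replacement_pgf r t S \<le> C * D^2"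
      proof -
        have "D * C * replacement_pgf r t S \<le> D * C * D"
          using replacement_pgf_le[OF rt, of S] S D C(1) by (intro mult_left_mono) (auto simp: D_def)
        then show ?thesis by (simp add: power2_eq_square mult_ac)
      qed
      moreover have "one_step_power r t n x - b * one_step_power r t n y
          = (1 - real n * D) * G n + (real n * (x^l * replacement_pgf r t x) - real n * b * (y^l * replacement_pgf r t y))"
        by (simp add: one_step_power_def G_def Suc D_def algebra_simps)
      ultimately have "P * (one_step_power r t n x - b * one_step_power r t n y - C * D^2)
          \<le> P * (((1 - real n * D) * G n) + (real n * (x^l * replacement_pgf r t x)
            - real n * b * (y^l * replacement_pgf r t y) - D * C * replacement_pgf r t S))"
        by (intro mult_left_mono) (auto simp: P_def)
      then show ?thesis using \<open>P * (((1 - real n * D) * G n) + _) \<le> ?E\<close> by linarith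
    qed
    then show "\<P>(\<omega> in M. Z r \<omega> = n) * (one_step_power r t n x - b * one_step_power r t n y
           - C * (cumulative_rate lam t - cumulative_rate lam r)^2)
       \<le> (\<integral>\<omega>. indicator {\<omega> \<in> space M. Z r \<omega> = n} \<omega> * (x ^ Z t \<omega> - b * y ^ Z t \<omega>) \<partial>M)"
      by (simp only: P_def D_def G_def)
  qed
qed

end

section \<open>The probability generating function and the mean\<close>

context theta_positive_branching_process
begin

text \<open>
The integrated form, up to second order, of \<open>x' = - lam * (h x - x)\<close>, where \<open>h\<close> is the offspring
generating function.
\<close>
definition backward_solution :: "real \<Rightarrow> (real \<Rightarrow> real) \<Rightarrow> bool" where
  "backward_solution T x \<longleftrightarrow> clock.has_increments (cumulative_rate lam) T x
     (\<lambda>r t. x t * (cumulative_rate lam t - cumulative_rate lam r) - replacement_pgf r t (x t))"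

text \<open>
Along a solution of the backward equation the first-order prediction returns the value at the earlier
time, with an error that is uniform in the population size \<open>n\<close>.
\<close>
lemma one_step_power_backward_solution:
  assumes x: "backward_solution T x"
    and range: "\<And>r. 0 \<le> r \<Longrightarrow> r \<le> T \<Longrightarrow> 0 \<le> x r \<and> x r \<le> R" and R: "0 \<le> R" "R < 1"
  obtains K where "0 \<le> K"
    "\<And>r t n. 0 \<le> r \<Longrightarrow> r \<le> t \<Longrightarrow> t \<le> T \<Longrightarrow>
       \<bar>one_step_power r t n (x t) - x r ^ n\<bar> \<le> K * (cumulative_rate lam t - cumulative_rate lam r)^2"
proof -
  interpret C: clock "cumulative_rate lam" T by (rule clock_cumulative_rate)
  let ?L = "cumulative_rate lam"
  have inc: "C.has_increments x (\<lambda>r t. x t * (?L t - ?L r) - replacement_pgf r t (x t))"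
    using x by (simp add: backward_solution_def)
  obtain K where K: "0 \<le> K"
    "\<And>r t. 0 \<le> r \<Longrightarrow> r \<le> t \<Longrightarrow> t \<le> T \<Longrightarrow>
      \<bar>x t * (?L t - ?L r) - replacement_pgf r t (x t)\<bar> \<le> K * (?L t - ?L r)"
    "\<And>r t. 0 \<le> r \<Longrightarrow> r \<le> t \<Longrightarrow> t \<le> T \<Longrightarrow>
      \<bar>x t - x r - (x t * (?L t - ?L r) - replacement_pgf r t (x t))\<bar> \<le> K * (?L t - ?L r)^2"
    by (rule C.has_incrementsE[OF inc]) (rule that)
  obtain H where H: "0 \<le> H"
    "\<And>r t. 0 \<le> r \<Longrightarrow> r \<le> t \<Longrightarrow> t \<le> T \<Longrightarrow> \<bar>x t - x r\<bar> \<le> H * (?L t - ?L r)"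
    by (rule C.has_increments_lipschitz[OF inc]) (rule that)
  obtain B where B: "0 \<le> B" "\<And>m. real (m + 1) * real (2 * m + 1) * R^m \<le> B"
    by (rule quadratic_times_power_bounded[OF R]) (rule that)
  have slope: "\<bar>real n * z^(n - 1)\<bar> \<le> 2 * B" if z: "0 \<le> z" "z \<le> R" for n z
  proof (cases n)
    case (Suc m)
    have "z^m \<le> R^m" using z by (simp add: power_mono)
    moreover have "real (m + 1) * 1 \<le> real (m + 1) * real (2 * m + 1)" by (intro mult_left_mono) auto
    ultimately have "real n * z^(n - 1) \<le> (real (m + 1) * real (2 * m + 1)) * R^m"
      using z unfolding Suc by (intro mult_mono) auto
    also have "\<dots> \<le> B" by (rule B)
    finally show ?thesis using z B(1) by simp
  qed (use B in simp)
  have curvature: "\<bar>real n * (real (n - 1) * z^(n - 1 - 1))\<bar> \<le> 2 * B" if z: "0 \<le> z" "z \<le> R" for n z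
  proof (cases "n \<le> 1")
    case True
    then have "n = 0 \<or> n = 1" by auto
    then show ?thesis using B(1) by auto
  next
    case False
    then obtain m where m: "n = m + 2" using le_Suc_ex[of 2 n] by auto
    have c1: "real n * real (n - 1) \<le> 2 * (real (m + 1) * real (2 * m + 1))"
      unfolding m by (simp add: algebra_simps)
    have c2: "z^m \<le> R^m" using z by (simp add: power_mono)
    have "real n * real (n - 1) * z^m \<le> 2 * (real (m + 1) * real (2 * m + 1)) * R^m"
      by (rule mult_mono[OF c1 c2]) (use z in auto)
    also have "\<dots> \<le> 2 * B" using B(2)[of m] by simp
    finally show ?thesis using z m by (simp add: mult.assoc)
  qed
  show thesis
  proof (rule that)
    show "0 \<le> 2 * B * (H^2 + K)" using B K by simp
    fix r t n assume rt: "0 \<le> r" "r \<le> t" "t \<le> T"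
    have seg: "0 \<le> z \<and> z \<le> R" if "z \<in> closed_segment (x t) (x r)" for z
      using that range[of r] range[of t] rt by (auto simp: closed_segment_eq_real_ivl split: if_splits)
    have "\<bar>x t ^ n - x r ^ n - real n * x t^(n - 1) * (x t * (?L t - ?L r) - replacement_pgf r t (x t))\<bar>
      \<le> 2 * B * (H^2 + K) * (?L t - ?L r)^2"
    proof (rule second_order_composition[OF H(2)[OF rt] K(3)[OF rt], where \<phi> = "\<lambda>z. z^n"
          and ?\<phi>1.0 = "\<lambda>z. real n * z^(n - 1)" and ?\<phi>2.0 = "\<lambda>z. real n * (real (n - 1) * z^(n - 1 - 1))"])
      fix z assume "z \<in> closed_segment (x t) (x r)"
      show "((\<lambda>z. z^n) has_real_derivative real n * z^(n - 1)) (at z)"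
        by (auto intro!: derivative_eq_intros)
      show "((\<lambda>z. real n * z^(n - 1)) has_real_derivative real n * (real (n - 1) * z^(n - 1 - 1))) (at z)"
        by (auto intro!: derivative_eq_intros)
    qed (use seg slope[of "x t" n] curvature range[of t] rt in auto)
    then show "\<bar>one_step_power r t n (x t) - x r ^ n\<bar> \<le> 2 * B * (H^2 + K) * (?L t - ?L r)^2"
      by (simp add: one_step_power_def algebra_simps)
  qed
qed

lemma power_state_integrable:
  fixes x :: real
  assumes "0 \<le> t" "0 \<le> x" "x \<le> 1"
  shows "integrable M (\<lambda>\<omega>. x ^ Z t \<omega>)"
  using assms by (intro integrable_function_of_state[where G = "\<lambda>m. x^m" and B = 1]) (auto simp: power_le_one)

text \<open>
Only one-sided estimates are available, hence a submartingale; applied to \<open>b = 0\<close> and to \<open>b = 1\<close> it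
will nevertheless determine the generating function.
\<close>
lemma backward_solution_submartingale:
  assumes T: "0 \<le> T" and x: "backward_solution T x" and y: "backward_solution T y"
    and range: "\<And>r. 0 \<le> r \<Longrightarrow> r \<le> T \<Longrightarrow> 0 \<le> y r \<and> y r \<le> x r \<and> x r \<le> R" and R: "R < 1"
    and b: "0 \<le> b" "b \<le> 1"
  shows "x 0 - b * y 0 \<le> (\<integral>\<omega>. x T ^ Z T \<omega> - b * y T ^ Z T \<omega> \<partial>M)"
proof -
  interpret C: clock "cumulative_rate lam" T by (rule clock_cumulative_rate)
  let ?L = "cumulative_rate lam"
  have R0: "0 \<le> R" using range[of 0] T by linarith
  obtain Kx where Kx: "0 \<le> Kx" "\<And>r t n. 0 \<le> r \<Longrightarrow> r \<le> t \<Longrightarrow> t \<le> T \<Longrightarrow>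
       \<bar>one_step_power r t n (x t) - x r ^ n\<bar> \<le> Kx * (?L t - ?L r)^2"
    by (rule one_step_power_backward_solution[OF x _ R0 R]) (use range in force, rule that)
  obtain Ky where Ky: "0 \<le> Ky" "\<And>r t n. 0 \<le> r \<Longrightarrow> r \<le> t \<Longrightarrow> t \<le> T \<Longrightarrow>
       \<bar>one_step_power r t n (y t) - y r ^ n\<bar> \<le> Ky * (?L t - ?L r)^2"
    by (rule one_step_power_backward_solution[OF y _ R0 R]) (use range in force, rule that)
  obtain K where K: "0 \<le> K"
    "\<And>r t n x y b. 0 \<le> r \<Longrightarrow> r \<le> t \<Longrightarrow> 0 \<le> y \<Longrightarrow> y \<le> x \<Longrightarrow> x \<le> R \<Longrightarrow> 0 \<le> b \<Longrightarrow> b \<le> 1 \<Longrightarrow>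
       \<P>(\<omega> in M. Z r \<omega> = n) * (one_step_power r t n x - b * one_step_power r t n y - K * (?L t - ?L r)^2)
       \<le> (\<integral>\<omega>. indicator {\<omega> \<in> space M. Z r \<omega> = n} \<omega> * (x ^ Z t \<omega> - b * y ^ Z t \<omega>) \<partial>M)"
    by (rule expectation_one_step_ge[OF R0 R]) (rule that)
  define \<psi> where "\<psi> r = (\<integral>\<omega>. x r ^ Z r \<omega> - b * y r ^ Z r \<omega> \<partial>M)" for r
  have int: "integrable M (\<lambda>\<omega>. x r ^ Z r \<omega> - b * y r ^ Z r \<omega>)" if "0 \<le> r" "r \<le> T" for r
    using range[OF that] R that
    by (intro Bochner_Integration.integrable_diff integrable_mult_right power_state_integrable) auto
  have "\<psi> 0 \<le> \<psi> T"
  proof (rule C.mono_if_second_order_decrease[where f = \<psi> and C = "Kx + Ky + K"])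
    fix r t assume rt: "0 \<le> r" "r \<le> t" "t \<le> T"
    have r: "0 \<le> r" "r \<le> T" and t: "0 \<le> t" using rt by auto
    let ?P = "\<lambda>n. \<P>(\<omega> in M. Z r \<omega> = n)"
    let ?err = "(Kx + Ky + K) * (?L t - ?L r)^2"
    have indicator_prob: "(\<integral>\<omega>. indicator {\<omega> \<in> space M. Z r \<omega> = n} \<omega> * c \<partial>M) = ?P n * c" for n and c :: real
      using state_event_sets[OF r(1), of n] by simp
    have "(\<lambda>n. \<integral>\<omega>. indicator {\<omega> \<in> space M. Z r \<omega> = n} \<omega> * (x r ^ Z r \<omega> - b * y r ^ Z r \<omega>) \<partial>M) sums \<psi> r"
      unfolding \<psi>_def by (rule expectation_sums_by_value[OF Z_measurable[OF r(1)] int[OF r]])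
    moreover have "(\<integral>\<omega>. indicator {\<omega> \<in> space M. Z r \<omega> = n} \<omega> * (x r ^ Z r \<omega> - b * y r ^ Z r \<omega>) \<partial>M)
        = ?P n * (x r ^ n - b * y r ^ n)" for n
      unfolding indicator_prob[symmetric]
      by (rule Bochner_Integration.integral_cong) (auto simp: indicator_def)
    ultimately have now: "(\<lambda>n. ?P n * (x r ^ n - b * y r ^ n)) sums \<psi> r" by simp
    have "(\<lambda>n. \<integral>\<omega>. indicator {\<omega> \<in> space M. Z r \<omega> = n} \<omega> * ?err \<partial>M) sums (\<integral>\<omega>. ?err \<partial>M)"
      by (rule expectation_sums_by_value[OF Z_measurable[OF r(1)]]) simp
    then have err: "(\<lambda>n. ?P n * ?err) sums ?err"
      unfolding indicator_prob by (simp add: prob_space)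
    have later: "(\<lambda>n. \<integral>\<omega>. indicator {\<omega> \<in> space M. Z r \<omega> = n} \<omega> * (x t ^ Z t \<omega> - b * y t ^ Z t \<omega>) \<partial>M) sums \<psi> t"
      unfolding \<psi>_def by (rule expectation_sums_by_value[OF Z_measurable[OF r(1)] int[OF t rt(3)]])
    have "?P n * (x r ^ n - b * y r ^ n) - ?P n * ?err
      \<le> (\<integral>\<omega>. indicator {\<omega> \<in> space M. Z r \<omega> = n} \<omega> * (x t ^ Z t \<omega> - b * y t ^ Z t \<omega>) \<partial>M)" for n
    proof -
      have "b * \<bar>one_step_power r t n (y t) - y r ^ n\<bar> \<le> 1 * (Ky * (?L t - ?L r)^2)"
        using Ky(2)[OF rt] b by (intro mult_mono) auto
      then have "\<bar>b * one_step_power r t n (y t) - b * y r ^ n\<bar> \<le> Ky * (?L t - ?L r)^2"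
        using b by (simp add: abs_mult flip: right_diff_distrib)
      then have "x r ^ n - b * y r ^ n - ?err
          \<le> one_step_power r t n (x t) - b * one_step_power r t n (y t) - K * (?L t - ?L r)^2"
        using Kx(2)[OF rt, of n] by (simp add: distrib_right)
      then have "?P n * (x r ^ n - b * y r ^ n - ?err)
          \<le> ?P n * (one_step_power r t n (x t) - b * one_step_power r t n (y t) - K * (?L t - ?L r)^2)"
        by (intro mult_left_mono) auto
      also have "\<dots> \<le> (\<integral>\<omega>. indicator {\<omega> \<in> space M. Z r \<omega> = n} \<omega> * (x t ^ Z t \<omega> - b * y t ^ Z t \<omega>) \<partial>M)"
        using range[of t] rt b by (intro K(2)) auto
      finally show ?thesis by (simp only: right_diff_distrib)
    qed
    from sums_le[OF this sums_diff[OF now err] later]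
    show "\<psi> r - ?err \<le> \<psi> t" .
  qed (use T in auto)
  moreover have "\<psi> 0 = (\<integral>\<omega>. x 0 - b * y 0 \<partial>M)"
    unfolding \<psi>_def by (rule Bochner_Integration.integral_cong) (auto simp: Z_start)
  ultimately show ?thesis by (simp add: \<psi>_def prob_space)
qed

definition log_mean :: "real \<Rightarrow> real" where
  "log_mean t = offspring_rate t - cumulative_rate lam t"

definition inverse_mean_power :: "real \<Rightarrow> real" where
  "inverse_mean_power t = exp (- \<theta> * log_mean t)"

text \<open>
This is \<open>V_fun\<close> with the mean replaced by \<open>exp (log_mean u)\<close>, which only later turns out to be the mean.
\<close>
definition V :: "real \<Rightarrow> real" where
  "V t = \<theta> / (1 + \<theta>) * (LBINT u:{0..t}. inverse_mean_power u * lam u)"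

lemma inverse_mean_power_pos: "0 < inverse_mean_power t"
  by (simp add: inverse_mean_power_def)

lemma initial_values: "offspring_rate 0 = 0" "cumulative_rate lam 0 = 0" "inverse_mean_power 0 = 1" "V 0 = 0"
proof -
  have zero: "(LBINT u:{0..0}. f u) = 0" for f :: "real \<Rightarrow> real"
    unfolding set_lebesgue_integral_def
  proof (rule integral_eq_zero_AE)
    show "AE u in lborel. indicator {0..0::real} u *\<^sub>R f u = 0"
      using AE_lborel_singleton[of "0::real"] by eventually_elim simp
  qed
  show "offspring_rate 0 = 0" "cumulative_rate lam 0 = 0" "inverse_mean_power 0 = 1" "V 0 = 0"
    using zero by (simp_all only: offspring_rate_def cumulative_rate_def inverse_mean_power_def log_mean_def V_def) simp_all
qed

lemma increments_log_mean:
  "clock.has_increments (cumulative_rate lam) T log_mean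
    (\<lambda>r t. (offspring_rate t - offspring_rate r) - (cumulative_rate lam t - cumulative_rate lam r))"
proof -
  interpret C: clock "cumulative_rate lam" T by (rule clock_cumulative_rate)
  show ?thesis
  proof (rule C.has_incrementsI[where K = "(1 + 1 / \<theta>) + 1" and C = 0])
    fix r t :: real assume rt: "0 \<le> r" "r \<le> t"
    show "\<bar>(offspring_rate t - offspring_rate r) - (cumulative_rate lam t - cumulative_rate lam r)\<bar>
      \<le> ((1 + 1 / \<theta>) + 1) * (cumulative_rate lam t - cumulative_rate lam r)"
    proof -
      have "\<bar>A - D\<bar> \<le> X + 1 * D" if "0 \<le> A" "A \<le> X" "0 \<le> D" for A D X :: real
        using that by linarith
      then show ?thesis
        using offspring_rate_diff_bounds[OF rt] cumulative_rate_mono[OF rt]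
        unfolding distrib_right[of "1 + 1 / \<theta>"] by simp
    qed
  qed (simp add: log_mean_def)
qed

lemma increments_inverse_mean_power:
  "clock.has_increments (cumulative_rate lam) T inverse_mean_power
    (\<lambda>r t. inverse_mean_power t
       * (- \<theta> * ((offspring_rate t - offspring_rate r) - (cumulative_rate lam t - cumulative_rate lam r))))"
proof -
  interpret C: clock "cumulative_rate lam" T by (rule clock_cumulative_rate)
  show ?thesis
    using C.has_increments_exp[OF C.has_increments_cmult[OF increments_log_mean, of "- \<theta>"]]
    by (simp only: inverse_mean_power_def[abs_def])
qed

lemma continuous_inverse_mean_power: "continuous_on {0..t} inverse_mean_power"
proof (cases "0 \<le> t")
  case True
  have "continuous_on {0..t} offspring_rate"
    unfolding offspring_rate_def
    by (rule continuous_on_indefinite_set_integral[OF offspring_rate_integrable[OF True]])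
  then show ?thesis
    unfolding inverse_mean_power_def log_mean_def
    by (intro continuous_intros clock.clock_continuous[OF clock_cumulative_rate])
qed simp

lemma V_integrable:
  assumes "0 \<le> t"
  shows "set_integrable lborel {0..t} (\<lambda>u. inverse_mean_power u * lam u)"
  by (rule set_integrable_mult_continuous[OF rate_integrable[OF assms] continuous_inverse_mean_power])

text \<open>
The integrand is Lipschitz with respect to the clock, so replacing it by its value at the right
end point costs only the square of the clock increment.
\<close>
lemma increments_V:
  "clock.has_increments (cumulative_rate lam) T V
    (\<lambda>r t. \<theta> / (1 + \<theta>) * (inverse_mean_power t * (cumulative_rate lam t - cumulative_rate lam r)))"
proof -
  interpret C: clock "cumulative_rate lam" T by (rule clock_cumulative_rate)
  let ?L = "cumulative_rate lam" and ?E = inverse_mean_power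
  obtain H where H: "0 \<le> H"
    "\<And>r t. 0 \<le> r \<Longrightarrow> r \<le> t \<Longrightarrow> t \<le> T \<Longrightarrow> \<bar>?E t - ?E r\<bar> \<le> H * (?L t - ?L r)"
    by (rule C.has_increments_lipschitz[OF increments_inverse_mean_power]) (rule that)
  obtain B where B: "\<And>r. 0 \<le> r \<Longrightarrow> r \<le> T \<Longrightarrow> \<bar>?E r\<bar> \<le> B"
    by (rule C.has_increments_bounded[OF increments_inverse_mean_power]) (rule that)
  have "C.has_increments (\<lambda>t. LBINT u:{0..t}. ?E u * lam u) (\<lambda>r t. ?E t * (?L t - ?L r))"
  proof (rule C.has_incrementsI[where K = B and C = H])
    fix r t assume rt: "0 \<le> r" "r \<le> t" "t \<le> T"
    have D: "0 \<le> ?L t - ?L r" using cumulative_rate_mono[OF rt(1,2)] by simp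
    show "\<bar>?E t * (?L t - ?L r)\<bar> \<le> B * (?L t - ?L r)"
      using B[of t] rt D by (simp add: abs_mult mult_right_mono)
    have int: "set_integrable lborel {r..t} (\<lambda>u. ?E u * lam u)" "set_integrable lborel {r..t} (\<lambda>u. c * lam u)" for c
      using V_integrable[of t] rate_integrable_Icc[OF rt(1), of t] rt by (auto intro: set_integrable_subset)
    define h where "h = H * (?L t - ?L r)"
    have close: "\<bar>?E t - ?E u\<bar> \<le> h" if "r \<le> u" "u \<le> t" for u
    proof -
      have "H * (?L t - ?L u) \<le> h"
        unfolding h_def using H(1) cumulative_rate_mono[OF rt(1) that(1)] by (intro mult_left_mono) auto
      then show ?thesis using H(2)[of u t] that rt by linarith
    qed
    have total: "(LBINT u:{r..t}. c * lam u) = c * (?L t - ?L r)" for c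
      by (simp only: set_integral_mult_right cumulative_rate_diff[OF rt(1,2)])
    have "(LBINT u:{r..t}. ?E u * lam u) \<le> (LBINT u:{r..t}. (?E t + h) * lam u)"
    proof (intro set_integral_mono int mult_right_mono)
      fix u assume "u \<in> {r..t}"
      then show "?E u \<le> ?E t + h" "0 \<le> lam u" using close[of u] rate_nonneg[of u] rt by auto
    qed
    moreover have "(LBINT u:{r..t}. (?E t - h) * lam u) \<le> (LBINT u:{r..t}. ?E u * lam u)"
    proof (intro set_integral_mono int mult_right_mono)
      fix u assume "u \<in> {r..t}"
      then show "?E t - h \<le> ?E u" "0 \<le> lam u" using close[of u] rate_nonneg[of u] rt by auto
    qed
    ultimately have "(LBINT u:{r..t}. ?E u * lam u) \<le> (?E t + h) * (?L t - ?L r)"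
      "(?E t - h) * (?L t - ?L r) \<le> (LBINT u:{r..t}. ?E u * lam u)" by (simp_all only: total)
    then have "\<bar>(LBINT u:{r..t}. ?E u * lam u) - ?E t * (?L t - ?L r)\<bar> \<le> h * (?L t - ?L r)"
      unfolding distrib_right left_diff_distrib[of "?E t" h] by linarith
    moreover have "(LBINT u:{0..t}. ?E u * lam u) - (LBINT u:{0..r}. ?E u * lam u) = (LBINT u:{r..t}. ?E u * lam u)"
      using rt by (intro set_integral_Icc_diff V_integrable) auto
    ultimately show "\<bar>(LBINT u:{0..t}. ?E u * lam u) - (LBINT u:{0..r}. ?E u * lam u) - ?E t * (?L t - ?L r)\<bar>
      \<le> H * (?L t - ?L r)^2"
      by (simp only: h_def power2_eq_square mult.assoc)
  qed
  from C.has_increments_cmult[OF this, of "\<theta> / (1 + \<theta>)"] show ?thesis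
    by (simp only: V_def[abs_def])
qed

text \<open>
The increment is \<open>\<theta> * E * ((1 / (1 + \<theta>) + c) * D - c * A)\<close>, where \<open>A\<close> is the increment of
\<open>offspring_rate\<close>, and \<open>A\<close> ranges between 0 and \<open>(1 + 1 / \<theta>) * D\<close>. The upper end point for \<open>c\<close> says that
the probability of extinction is nondecreasing; the lower one bounds \<open>E\<close> by \<open>V\<close>.
\<close>
lemma V_plus_inverse_mean_power_mono:
  assumes "0 \<le> r" "r \<le> t" and c: "- 1 / (1 + \<theta>) \<le> c" "c \<le> \<theta> / (1 + \<theta>)"
  shows "V r + c * inverse_mean_power r \<le> V t + c * inverse_mean_power t"
proof -
  interpret C: clock "cumulative_rate lam" t by (rule clock_cumulative_rate)
  let ?L = "cumulative_rate lam" and ?E = inverse_mean_power and ?A = offspring_rate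
  let ?f = "\<lambda>r. V r + c * ?E r"
  let ?d = "\<lambda>r t. \<theta> / (1 + \<theta>) * (?E t * (?L t - ?L r))
     + c * (?E t * (- \<theta> * ((?A t - ?A r) - (?L t - ?L r))))"
  have inc: "C.has_increments ?f ?d"
    by (intro C.has_increments_add C.has_increments_cmult increments_V increments_inverse_mean_power)
  obtain K where K: "0 \<le> K"
    "\<And>q u. 0 \<le> q \<Longrightarrow> q \<le> u \<Longrightarrow> u \<le> t \<Longrightarrow> \<bar>?d q u\<bar> \<le> K * (?L u - ?L q)"
    "\<And>q u. 0 \<le> q \<Longrightarrow> q \<le> u \<Longrightarrow> u \<le> t \<Longrightarrow> \<bar>?f u - ?f q - ?d q u\<bar> \<le> K * (?L u - ?L q)^2"
    by (rule C.has_incrementsE[OF inc]) (rule that)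
  show ?thesis
  proof (rule C.mono_if_second_order_decrease[where f = ?f])
    fix q u assume qu: "0 \<le> q" "q \<le> u" "u \<le> t"
    define A D where "A = ?A u - ?A q" and "D = ?L u - ?L q"
    have AD: "0 \<le> A" "A \<le> (1 + 1 / \<theta>) * D" "0 \<le> D"
      using offspring_rate_diff_bounds[OF qu(1,2)] cumulative_rate_mono[OF qu(1,2)]
      by (simp_all add: A_def D_def)
    have "0 \<le> (1 / (1 + \<theta>) + c) * D - c * A"
    proof (cases "0 \<le> c")
      case True
      then have "c * A \<le> c * ((1 + 1 / \<theta>) * D)" using AD by (intro mult_left_mono) auto
      also have "\<dots> = (c + c / \<theta>) * D" by (simp add: algebra_simps)
      also have "\<dots> \<le> (1 / (1 + \<theta>) + c) * D"
      proof (rule mult_right_mono)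
        have "c / \<theta> \<le> (\<theta> / (1 + \<theta>)) / \<theta>" using c(2) theta_range by (intro divide_right_mono) auto
        then show "c + c / \<theta> \<le> 1 / (1 + \<theta>) + c" using theta_range by simp
      qed (rule AD)
      finally show ?thesis by simp
    next
      case False
      then have "c * A \<le> 0" using AD by (intro mult_nonpos_nonneg) auto
      moreover have "0 \<le> (1 / (1 + \<theta>) + c) * D" using c(1) AD by (intro mult_nonneg_nonneg) auto
      ultimately show ?thesis by simp
    qed
    then have "0 \<le> \<theta> * ?E u * ((1 / (1 + \<theta>) + c) * D - c * A)"
      using theta_range inverse_mean_power_pos[of u] by (intro mult_nonneg_nonneg) auto
    also have "\<dots> = ?d q u" by (simp add: A_def D_def algebra_simps)
    finally have "0 \<le> ?d q u" .
    moreover have "y - e \<le> x" if "0 \<le> d" "\<bar>x - y - d\<bar> \<le> e" for x y d e :: real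
      using that by linarith
    ultimately show "?f q - K * (?L u - ?L q)^2 \<le> ?f u"
      using K(3)[OF qu] by blast
  qed (use assms in auto)
qed

lemma V_mono:
  assumes "0 \<le> r" "r \<le> t"
  shows "V r \<le> V t"
proof -
  have "(LBINT u:{r..t}. 0 * lam u) \<le> (LBINT u:{r..t}. inverse_mean_power u * lam u)"
  proof (intro set_integral_mono mult_right_mono)
    show "set_integrable lborel {r..t} (\<lambda>u. 0 * lam u)" by (simp add: set_integrable_def)
    show "set_integrable lborel {r..t} (\<lambda>u. inverse_mean_power u * lam u)"
      using V_integrable[of t] assms by (auto intro: set_integrable_subset)
  qed (use assms rate_nonneg inverse_mean_power_pos in \<open>auto intro: less_imp_le\<close>)
  then have "0 \<le> (LBINT u:{0..t}. inverse_mean_power u * lam u) - (LBINT u:{0..r}. inverse_mean_power u * lam u)"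
    using set_integral_Icc_diff[OF V_integrable assms] assms by simp
  then show ?thesis unfolding V_def using theta_range by (intro mult_left_mono) auto
qed

lemma V_nonneg: "0 \<le> t \<Longrightarrow> 0 \<le> V t"
  using V_mono[of 0 t] by (simp add: initial_values)

text \<open>
With \<open>Y = (1 - x) powr (- \<theta>)\<close> the backward equation becomes linear, and dividing \<open>Y\<close> by the solution
\<open>1 / inverse_mean_power\<close> of the homogeneous equation leaves a function that is found by integration.
It is expressed through \<open>V\<close> and \<open>inverse_mean_power\<close> instead of an integral involving \<open>a\<close>.
\<close>
definition backward_numerator :: "real \<Rightarrow> real \<Rightarrow> real \<Rightarrow> real" where
  "backward_numerator T s r = inverse_mean_power T * (1 - s) powr (- \<theta>) + (V T - V r)
     + (inverse_mean_power r - inverse_mean_power T) / (1 + \<theta>)"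

definition backward_pgf :: "real \<Rightarrow> real \<Rightarrow> real \<Rightarrow> real" where
  "backward_pgf T s r = 1 - (backward_numerator T s r / inverse_mean_power r) powr (- 1 / \<theta>)"

lemma powr_neg_theta_mono:
  assumes "0 \<le> s" "s \<le> s'" "s' < 1"
  shows "(1 - s) powr (- \<theta>) \<le> (1 - s') powr (- \<theta>)"
  using assms theta_range by (intro powr_mono2') auto

lemma backward_numerator_ge:
  assumes "0 \<le> s" "s < 1" "0 \<le> r" "r \<le> T"
  shows "inverse_mean_power r \<le> backward_numerator T s r"
proof -
  have "1 \<le> (1 - s) powr (- \<theta>)" using powr_neg_theta_mono[of 0 s] assms by simp
  then have "inverse_mean_power T * 1 \<le> inverse_mean_power T * (1 - s) powr (- \<theta>)"
    using inverse_mean_power_pos[of T] by (intro mult_left_mono) auto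
  moreover have "\<theta> / (1 + \<theta>) * z = z - z / (1 + \<theta>)" for z
    using theta_range by (simp add: field_simps)
  moreover have "- 1 / (1 + \<theta>) \<le> \<theta> / (1 + \<theta>)"
    using theta_range by (intro divide_right_mono) auto
  ultimately show ?thesis
    using V_plus_inverse_mean_power_mono[OF assms(3,4), of "\<theta> / (1 + \<theta>)"] theta_range
    by (simp add: backward_numerator_def diff_divide_distrib)
qed

lemma backward_numerator_pos:
  assumes "0 \<le> s" "s < 1" "0 \<le> r" "r \<le> T"
  shows "0 < backward_numerator T s r"
  using backward_numerator_ge[OF assms] inverse_mean_power_pos[of r] by linarith

lemma backward_pgf_nonneg:
  assumes "0 \<le> s" "s < 1" "0 \<le> r" "r \<le> T"
  shows "0 \<le> backward_pgf T s r"
proof -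
  have "1 \<le> backward_numerator T s r / inverse_mean_power r"
    using backward_numerator_ge[OF assms] inverse_mean_power_pos[of r] by simp
  then have "(backward_numerator T s r / inverse_mean_power r) powr (- 1 / \<theta>) \<le> 1 powr (- 1 / \<theta>)"
    using theta_range by (intro powr_mono2') auto
  then show ?thesis by (simp add: backward_pgf_def)
qed

lemma backward_pgf_mono:
  assumes "0 \<le> s" "s \<le> s'" "s' < 1" "0 \<le> r" "r \<le> T"
  shows "backward_pgf T s r \<le> backward_pgf T s' r"
proof -
  have "backward_numerator T s r \<le> backward_numerator T s' r"
    using powr_neg_theta_mono[OF assms(1-3)] inverse_mean_power_pos[of T]
    by (simp add: backward_numerator_def)
  then have "backward_numerator T s r / inverse_mean_power r \<le> backward_numerator T s' r / inverse_mean_power r"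
    using inverse_mean_power_pos[of r] by (intro divide_right_mono) auto
  moreover have "0 < backward_numerator T s r / inverse_mean_power r"
    using backward_numerator_pos[of s r T] inverse_mean_power_pos[of r] assms by simp
  ultimately show ?thesis
    unfolding backward_pgf_def using theta_range by (intro diff_left_mono powr_mono2') auto
qed

lemma backward_pgf_end:
  assumes "0 \<le> s" "s < 1"
  shows "backward_pgf T s T = s"
proof -
  have "backward_numerator T s T / inverse_mean_power T = (1 - s) powr (- \<theta>)"
    using inverse_mean_power_pos[of T] by (simp add: backward_numerator_def)
  then show ?thesis
    using assms theta_range by (simp add: backward_pgf_def powr_powr)
qed

text \<open>
The logarithm of \<open>1 - backward_pgf T s r\<close> is a combination of \<open>ln (backward_numerator T s r)\<close> and
\<open>log_mean r\<close>, so the chain rule for \<open>ln\<close> and \<open>exp\<close> suffices. Being an exponential of a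
bounded function, \<open>1 - backward_pgf T s r\<close> stays away from 0, as the uniform bounds require.
\<close>
lemma backward_pgf_solution:
  assumes s: "0 \<le> s" "s < 1"
  shows "backward_solution T (backward_pgf T s)"
    and "0 \<le> T \<Longrightarrow> \<exists>R<1. \<forall>r. 0 \<le> r \<and> r \<le> T \<longrightarrow> backward_pgf T s r \<le> R"
proof -
  interpret C: clock "cumulative_rate lam" T by (rule clock_cumulative_rate)
  let ?L = "cumulative_rate lam" and ?E = inverse_mean_power and ?A = offspring_rate
  let ?W = "backward_numerator T s"
  define U where "U r = - (1 / \<theta>) * ln (?W r) + (- 1) * log_mean r" for r
  obtain B where B: "\<And>r. 0 \<le> r \<Longrightarrow> r \<le> T \<Longrightarrow> \<bar>log_mean r\<bar> \<le> B"
    by (rule C.has_increments_bounded[OF increments_log_mean]) (rule that)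
  have E_ge: "exp (- \<theta> * B) \<le> ?E r" if "0 \<le> r" "r \<le> T" for r
    using B[OF that] theta_range by (simp add: inverse_mean_power_def abs_le_iff)
  have "C.has_increments (\<lambda>r. (?E T * (1 - s) powr (- \<theta>) + V T - ?E T / (1 + \<theta>)) + ((- 1) * V r + 1 / (1 + \<theta>) * ?E r))
     (\<lambda>r t. 0 + ((- 1) * (\<theta> / (1 + \<theta>) * (?E t * (?L t - ?L r)))
        + 1 / (1 + \<theta>) * (?E t * (- \<theta> * ((?A t - ?A r) - (?L t - ?L r))))))"
    by (intro C.has_increments_add C.has_increments_cmult C.has_increments_const
        increments_V increments_inverse_mean_power)
  then have incW: "C.has_increments ?W (\<lambda>r t. - \<theta> / (1 + \<theta>) * ?E t * (?A t - ?A r))"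
  proof (rule C.has_increments_cong)
    show "(?E T * (1 - s) powr (- \<theta>) + V T - ?E T / (1 + \<theta>)) + ((- 1) * V r + 1 / (1 + \<theta>) * ?E r) = ?W r" for r
      by (simp add: backward_numerator_def diff_divide_distrib)
    show "0 + ((- 1) * (\<theta> / (1 + \<theta>) * (?E t * (?L t - ?L r)))
        + 1 / (1 + \<theta>) * (?E t * (- \<theta> * ((?A t - ?A r) - (?L t - ?L r))))) = - \<theta> / (1 + \<theta>) * ?E t * (?A t - ?A r)" for r t
      using theta_range by (simp add: divide_simps) (simp add: algebra_simps)
  qed
  have "C.has_increments (\<lambda>r. ln (?W r)) (\<lambda>r t. (- \<theta> / (1 + \<theta>) * ?E t * (?A t - ?A r)) / ?W t)"
  proof (rule C.has_increments_ln[OF incW])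
    show "0 < exp (- \<theta> * B)" by simp
    show "exp (- \<theta> * B) \<le> ?W r" if "0 \<le> r" "r \<le> T" for r
      using E_ge[OF that] backward_numerator_ge[OF s that] by linarith
  qed
  then have incU: "C.has_increments U (\<lambda>r t. - (1 / \<theta>) * ((- \<theta> / (1 + \<theta>) * ?E t * (?A t - ?A r)) / ?W t)
      + (- 1) * ((?A t - ?A r) - (?L t - ?L r)))"
    unfolding U_def by (intro C.has_increments_add C.has_increments_cmult increments_log_mean)
  have Q: "(?W r / ?E r) powr (- 1 / \<theta>) = exp (U r)" if r: "0 \<le> r" "r \<le> T" for r
  proof -
    have "0 < ?W r / ?E r" using backward_numerator_pos[OF s r] inverse_mean_power_pos[of r] by simp
    moreover have "ln (?W r / ?E r) = ln (?W r) + \<theta> * log_mean r"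
      using backward_numerator_pos[OF s r] by (simp add: ln_div inverse_mean_power_def)
    ultimately have "(?W r / ?E r) powr (- 1 / \<theta>) = exp (- 1 / \<theta> * (ln (?W r) + \<theta> * log_mean r))"
      using backward_numerator_pos[OF s r] inverse_mean_power_pos[of r] by (simp add: powr_def)
    also have "- 1 / \<theta> * (ln (?W r) + \<theta> * log_mean r) = U r"
      using theta_range by (simp add: U_def field_simps)
    finally show ?thesis .
  qed
  have "C.has_increments (\<lambda>r. 1 + (- 1) * exp (U r)) (\<lambda>r t. 0 + (- 1) * (exp (U t) *
      (- (1 / \<theta>) * ((- \<theta> / (1 + \<theta>) * ?E t * (?A t - ?A r)) / ?W t)
      + (- 1) * ((?A t - ?A r) - (?L t - ?L r)))))"
    by (intro C.has_increments_add C.has_increments_cmult C.has_increments_const C.has_increments_exp incU)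
  then show "backward_solution T (backward_pgf T s)"
    unfolding backward_solution_def
  proof (rule C.has_increments_cong)
    show "1 + (- 1) * exp (U r) = backward_pgf T s r" if "0 \<le> r" "r \<le> T" for r
      using Q[OF that] by (simp add: backward_pgf_def)
    fix r t assume rt: "0 \<le> r" "r \<le> t" "t \<le> T"
    have t: "0 \<le> t" "t \<le> T" using rt by auto
    define q where "q = exp (U t)"
    have x: "backward_pgf T s t = 1 - q" using Q[OF t] by (simp add: backward_pgf_def q_def)
    have q: "0 < q" by (simp add: q_def)
    have "q powr \<theta> = (?W t / ?E t) powr (- 1)"
      unfolding q_def Q[OF t, symmetric] using theta_range by (simp add: powr_powr)
    also have "\<dots> = ?E t / ?W t"
      using backward_numerator_pos[OF s t] inverse_mean_power_pos[of t] by (simp add: powr_minus_divide)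
    finally have "q powr (1 + \<theta>) = q * (?E t / ?W t)" using q by (simp add: powr_add)
    then have "backward_pgf T s t * (?L t - ?L r) - replacement_pgf r t (backward_pgf T s t)
        = - q * (?L t - ?L r) + q * (?A t - ?A r) - (?A t - ?A r) * (q * (?E t / ?W t)) / (1 + \<theta>)"
      by (simp add: x replacement_pgf_def algebra_simps)
    also have "\<dots> = 0 + (- 1) * (q * (- (1 / \<theta>) * ((- \<theta> / (1 + \<theta>) * ?E t * (?A t - ?A r)) / ?W t)
      + (- 1) * ((?A t - ?A r) - (?L t - ?L r))))"
      using theta_range backward_numerator_pos[OF s t] by (simp add: divide_simps) (simp add: algebra_simps)
    finally show "0 + (- 1) * (exp (U t) * (- (1 / \<theta>) * ((- \<theta> / (1 + \<theta>) * ?E t * (?A t - ?A r)) / ?W t)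
      + (- 1) * ((?A t - ?A r) - (?L t - ?L r))))
      = backward_pgf T s t * (?L t - ?L r) - replacement_pgf r t (backward_pgf T s t)"
      by (simp only: q_def)
  qed
  obtain D where D: "\<And>r. 0 \<le> r \<Longrightarrow> r \<le> T \<Longrightarrow> \<bar>U r\<bar> \<le> D"
    by (rule C.has_increments_bounded[OF incU]) (rule that)
  show "\<exists>R<1. \<forall>r. 0 \<le> r \<and> r \<le> T \<longrightarrow> backward_pgf T s r \<le> R"
  proof (intro exI conjI allI impI)
    show "1 - exp (- D) < 1" by simp
    fix r assume r: "0 \<le> r \<and> r \<le> T"
    then have "- D \<le> U r" using D[of r] by auto
    then show "backward_pgf T s r \<le> 1 - exp (- D)"
      using Q r by (simp add: backward_pgf_def)
  qed
qed

text \<open>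
The power \<open>- \<theta>\<close> of 1 minus the generating function; survival, at \<open>s = 0\<close>, is the special case
\<open>survival_index\<close> below.
\<close>
definition pgf_index :: "real \<Rightarrow> real \<Rightarrow> real" where
  "pgf_index t s = V t + 1 / (1 + \<theta>) + inverse_mean_power t * ((1 - s) powr (- \<theta>) - 1 / (1 + \<theta>))"

lemma backward_pgf_start: "backward_pgf t s 0 = 1 - pgf_index t s powr (- 1 / \<theta>)"
proof -
  have "backward_numerator t s 0 = pgf_index t s"
    by (simp add: backward_numerator_def pgf_index_def initial_values diff_divide_distrib algebra_simps)
  then show ?thesis by (simp add: backward_pgf_def initial_values)
qed

lemma pgf_index_ge_1:
  assumes "0 \<le> t" "0 \<le> s" "s < 1"
  shows "1 \<le> pgf_index t s"
proof -
  have "backward_numerator t s 0 = pgf_index t s"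
    by (simp add: backward_numerator_def pgf_index_def initial_values diff_divide_distrib algebra_simps)
  then show ?thesis using backward_numerator_ge[of s 0 t] assms by (simp add: initial_values)
qed

lemma inverse_power_seq_at_top:
  "filterlim (\<lambda>k. (1 - (1 - 1 / real (Suc k))) powr (- \<theta>)) at_top sequentially"
proof -
  have "filterlim (\<lambda>k::nat. (real k + 1) powr \<theta>) at_top sequentially"
    using theta_range(1) by real_asymp
  moreover have "(1 - (1 - 1 / real (Suc k))) powr (- \<theta>) = (real k + 1) powr \<theta>" for k
    by (simp add: powr_minus powr_divide add.commute)
  ultimately show ?thesis by simp
qed

text \<open>
The upper bound compares the solutions ending at \<open>s\<close> and at \<open>u\<close> with \<open>b = 1\<close>, uses
that the expectation of \<open>u ^ Z t\<close> is at most 1, and lets \<open>u\<close> tend to 1.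
\<close>
lemma pgf_eq:
  assumes t: "0 \<le> t" and s: "0 \<le> s" "s < 1"
  shows "(\<integral>\<omega>. s ^ Z t \<omega> \<partial>M) = 1 - pgf_index t s powr (- 1 / \<theta>)"
proof (rule antisym)
  have compare: "backward_pgf t s' 0 - b * backward_pgf t s 0 \<le> (\<integral>\<omega>. s' ^ Z t \<omega> - b * s ^ Z t \<omega> \<partial>M)"
    if s': "s \<le> s'" "s' < 1" and b: "0 \<le> b" "b \<le> 1" for s' b
  proof -
    have "0 \<le> s'" using s s' by simp
    then obtain R where R: "R < 1" "\<And>r. 0 \<le> r \<Longrightarrow> r \<le> t \<Longrightarrow> backward_pgf t s' r \<le> R"
      using backward_pgf_solution(2)[OF _ s'(2) t] by blast
    have "backward_pgf t s' 0 - b * backward_pgf t s 0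
        \<le> (\<integral>\<omega>. backward_pgf t s' t ^ Z t \<omega> - b * backward_pgf t s t ^ Z t \<omega> \<partial>M)"
      by (rule backward_solution_submartingale[OF t backward_pgf_solution(1) backward_pgf_solution(1) _ R(1) b])
         (use s s' R(2) backward_pgf_nonneg backward_pgf_mono in auto)
    then show ?thesis
      using backward_pgf_end[of s t] backward_pgf_end[of s' t] s s' by simp
  qed
  show "1 - pgf_index t s powr (- 1 / \<theta>) \<le> (\<integral>\<omega>. s ^ Z t \<omega> \<partial>M)"
    using compare[of s 0] s by (simp add: backward_pgf_start)
  define u where "u k = 1 - 1 / real (Suc k)" for k
  have "filterlim (\<lambda>k. (V t + 1 / (1 + \<theta>) - inverse_mean_power t / (1 + \<theta>))
      + inverse_mean_power t * (1 - u k) powr (- \<theta>)) at_top sequentially"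
    unfolding u_def using inverse_mean_power_pos[of t]
    by (intro filterlim_tendsto_add_at_top[OF tendsto_const]
        filterlim_tendsto_pos_mult_at_top[OF tendsto_const _ inverse_power_seq_at_top])
  then have "filterlim (\<lambda>k. pgf_index t (u k)) at_top sequentially"
    by (simp add: pgf_index_def algebra_simps)
  then have "(\<lambda>k. pgf_index t (u k) powr (- 1 / \<theta>)) \<longlonglongrightarrow> 0"
    using theta_range by (intro tendsto_neg_powr) auto
  then have "(\<lambda>k. pgf_index t (u k) powr (- 1 / \<theta>) + (1 - pgf_index t s powr (- 1 / \<theta>)))
      \<longlonglongrightarrow> 0 + (1 - pgf_index t s powr (- 1 / \<theta>))"
    by (intro tendsto_intros)
  moreover have "eventually (\<lambda>k. (\<integral>\<omega>. s ^ Z t \<omega> \<partial>M)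
      \<le> pgf_index t (u k) powr (- 1 / \<theta>) + (1 - pgf_index t s powr (- 1 / \<theta>))) sequentially"
  proof -
    have "u \<longlonglongrightarrow> 1" unfolding u_def by real_asymp
    then have "eventually (\<lambda>k. s < u k) sequentially" using s(2) by (rule order_tendstoD)
    then show ?thesis
    proof eventually_elim
      case (elim k)
      have u1: "u k < 1" by (simp add: u_def)
      have int: "integrable M (\<lambda>\<omega>. s ^ Z t \<omega>)" "integrable M (\<lambda>\<omega>. u k ^ Z t \<omega>)"
        using s elim u1 t by (auto intro!: power_state_integrable)
      have "(\<integral>\<omega>. u k ^ Z t \<omega> \<partial>M) \<le> (\<integral>\<omega>. 1 \<partial>M)"
        using int(2) s elim u1 by (intro integral_mono power_le_one) auto
      then show ?case
        using compare[of "u k" 1] elim u1 int by (simp add: backward_pgf_start prob_space)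
    qed
  qed
  ultimately show "(\<integral>\<omega>. s ^ Z t \<omega> \<partial>M) \<le> 1 - pgf_index t s powr (- 1 / \<theta>)"
    using tendsto_lowerbound[of _ _ sequentially] by force
qed

text \<open>
The mean is the left derivative of the generating function at 1: the difference quotients
\<open>(1 - u ^ n) / (1 - u)\<close> are geometric sums that increase to \<open>n\<close> as \<open>u\<close> increases to 1.
\<close>
lemma mean_eq:
  assumes t: "0 \<le> t"
  shows "integrable M (\<lambda>\<omega>. real (Z t \<omega>))" and "mean_size M Z t = exp (log_mean t)"
proof -
  define u where "u k = 1 - 1 / real (Suc k)" for k
  have u: "0 \<le> u k" "u k < 1" for k by (auto simp: u_def)
  have u_mono: "u k \<le> u l" if "k \<le> l" for k l
    using that unfolding u_def by (intro diff_left_mono divide_left_mono) auto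
  have u_lim: "u \<longlonglongrightarrow> 1" unfolding u_def by real_asymp
  define f where "f k \<omega> = (\<Sum>j<Z t \<omega>. u k ^ j)" for k \<omega>
  have f_eq: "f k \<omega> = (1 - u k ^ Z t \<omega>) * real (Suc k)" for k \<omega>
  proof -
    have "f k \<omega> = (1 - u k ^ Z t \<omega>) / (1 - u k)"
      unfolding f_def using u(2)[of k] by (subst sum_gp_strict) auto
    then show ?thesis by (simp add: u_def)
  qed
  have int: "integrable M (f k)" for k
    unfolding f_eq[abs_def] using power_state_integrable[OF t, of "u k"] u[of k] by simp
  have f_int: "integral\<^sup>L M (f k)
      = ((V t + 1 / (1 + \<theta>) - inverse_mean_power t / (1 + \<theta>)) * (real k + 1) powr (- \<theta>)
          + inverse_mean_power t) powr (- 1 / \<theta>)" for k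
  proof -
    let ?c = "V t + 1 / (1 + \<theta>) - inverse_mean_power t / (1 + \<theta>)" and ?N = "real k + 1"
    have N: "(1 - u k) powr (- \<theta>) = ?N powr \<theta>"
      by (simp add: u_def powr_minus powr_divide add.commute)
    have "integral\<^sup>L M (f k) = (1 - (\<integral>\<omega>. u k ^ Z t \<omega> \<partial>M)) * real (Suc k)"
      unfolding f_eq[abs_def] using power_state_integrable[OF t, of "u k"] u[of k] by (simp add: prob_space)
    also have "\<dots> = pgf_index t (u k) powr (- 1 / \<theta>) * ?N"
      using pgf_eq[OF t u] by (simp add: add.commute)
    also have "?N = (?N powr (- \<theta>)) powr (- 1 / \<theta>)" using theta_range by (simp add: powr_powr)
    also have "pgf_index t (u k) powr (- 1 / \<theta>) * \<dots> = (pgf_index t (u k) * ?N powr (- \<theta>)) powr (- 1 / \<theta>)"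
      using pgf_index_ge_1[OF t u, of k] by (subst powr_mult) auto
    also have "pgf_index t (u k) * ?N powr (- \<theta>) = ?c * ?N powr (- \<theta>) + inverse_mean_power t"
    proof -
      have "pgf_index t (u k) = ?c + inverse_mean_power t * ?N powr \<theta>"
        by (simp add: pgf_index_def N algebra_simps)
      moreover have "?N powr \<theta> * ?N powr (- \<theta>) = 1" by (simp flip: powr_add)
      ultimately show ?thesis by (simp add: distrib_right mult.assoc)
    qed
    finally show ?thesis .
  qed
  have "(\<lambda>k::nat. (real k + 1) powr (- \<theta>)) \<longlonglongrightarrow> 0"
    using theta_range(1) by real_asymp
  then have "(\<lambda>k. ((V t + 1 / (1 + \<theta>) - inverse_mean_power t / (1 + \<theta>)) * (real k + 1) powr (- \<theta>)
          + inverse_mean_power t) powr (- 1 / \<theta>))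
      \<longlonglongrightarrow> ((V t + 1 / (1 + \<theta>) - inverse_mean_power t / (1 + \<theta>)) * 0 + inverse_mean_power t) powr (- 1 / \<theta>)"
    using inverse_mean_power_pos[of t] by (intro tendsto_intros) auto
  then have lim: "(\<lambda>k. integral\<^sup>L M (f k)) \<longlonglongrightarrow> inverse_mean_power t powr (- 1 / \<theta>)"
    by (simp add: f_int)
  have mono: "AE \<omega> in M. mono (\<lambda>k. f k \<omega>)"
    unfolding f_def by (intro AE_I2 monoI sum_mono power_mono u_mono u)
  have pointwise: "AE \<omega> in M. (\<lambda>k. f k \<omega>) \<longlonglongrightarrow> real (Z t \<omega>)"
  proof (rule AE_I2)
    fix \<omega>
    have "(\<lambda>k. f k \<omega>) \<longlonglongrightarrow> (\<Sum>j<Z t \<omega>. 1 ^ j)"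
      unfolding f_def by (intro tendsto_intros u_lim)
    then show "(\<lambda>k. f k \<omega>) \<longlonglongrightarrow> real (Z t \<omega>)" by simp
  qed
  have meas: "(\<lambda>\<omega>. real (Z t \<omega>)) \<in> borel_measurable M"
    by (rule measurable_compose[OF Z_measurable[OF t]]) simp
  show "integrable M (\<lambda>\<omega>. real (Z t \<omega>))"
    by (rule integrable_monotone_convergence[OF int mono pointwise lim meas])
  have "mean_size M Z t = inverse_mean_power t powr (- 1 / \<theta>)"
    unfolding mean_size_def by (rule integral_monotone_convergence[OF int mono pointwise lim meas])
  also have "\<dots> = exp (log_mean t)"
    using theta_range by (simp add: inverse_mean_power_def powr_def)
  finally show "mean_size M Z t = exp (log_mean t)" .
qed

end

section \<open>Limits in the extended reals\<close>

lemma monotone_limit_cases: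
  fixes f :: "real \<Rightarrow> real"
  assumes mono: "\<And>r t. 0 \<le> r \<Longrightarrow> r \<le> t \<Longrightarrow> f r \<le> f t"
  obtains "filterlim f at_top at_top" | l where "(f \<longlongrightarrow> l) at_top"
proof (cases "bdd_above (f ` {0..})")
  case True
  define l where "l = (SUP t\<in>{0..}. f t)"
  have "(f \<longlongrightarrow> l) at_top"
  proof (rule increasing_tendsto)
    show "eventually (\<lambda>t. f t \<le> l) at_top"
      using eventually_ge_at_top[of 0] unfolding l_def
      by eventually_elim (intro cSUP_upper True; simp)
    fix x assume "x < l"
    then obtain r where r: "0 \<le> r" "x < f r"
      using less_cSUP_iff[of "{0..}" f x] True by (auto simp: l_def)
    show "eventually (\<lambda>t. x < f t) at_top"
      using eventually_ge_at_top[of r] by eventually_elim (use r mono in force)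
  qed
  then show thesis by (rule that(2))
next
  case False
  have "filterlim f at_top at_top"
    unfolding filterlim_at_top
  proof
    fix B
    obtain r where r: "0 \<le> r" "B < f r"
      using False by (auto simp: bdd_above_def not_le)
    show "eventually (\<lambda>t. B \<le> f t) at_top"
      using eventually_ge_at_top[of r] by eventually_elim (use r mono in force)
  qed
  then show thesis by (rule that(1))
qed

lemma ereal_limit_cases:
  fixes f :: "'b \<Rightarrow> real"
  assumes "F \<noteq> bot" and nonneg: "eventually (\<lambda>t. 0 \<le> f t) F"
  shows "(\<exists>L::ereal. ((\<lambda>t. ereal (f t)) \<longlongrightarrow> L) F) \<longleftrightarrow> (\<exists>l. (f \<longlongrightarrow> l) F) \<or> filterlim f at_top F"
proof
  assume "\<exists>L::ereal. ((\<lambda>t. ereal (f t)) \<longlongrightarrow> L) F"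
  then obtain L :: ereal where L: "((\<lambda>t. ereal (f t)) \<longlongrightarrow> L) F" by blast
  have "0 \<le> L"
    by (rule tendsto_lowerbound[OF L _ assms(1)]) (use nonneg in \<open>auto elim: eventually_mono\<close>)
  then show "(\<exists>l. (f \<longlongrightarrow> l) F) \<or> filterlim f at_top F"
    using L by (cases L) (auto simp: tendsto_PInfty_eq_at_top)
next
  assume "(\<exists>l. (f \<longlongrightarrow> l) F) \<or> filterlim f at_top F"
  then show "\<exists>L::ereal. ((\<lambda>t. ereal (f t)) \<longlongrightarrow> L) F"
  proof
    assume "\<exists>l. (f \<longlongrightarrow> l) F"
    then obtain l where "(f \<longlongrightarrow> l) F" by blast
    then have "((\<lambda>t. ereal (f t)) \<longlongrightarrow> ereal l) F" by simp
    then show ?thesis by blast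
  next
    assume "filterlim f at_top F"
    then show ?thesis unfolding tendsto_PInfty_eq_at_top[symmetric] by blast
  qed
qed

text \<open>
The first sequence is any one along which \<open>f\<close> converges. Its limit is not the limit of \<open>f\<close>, so \<open>f\<close>
leaves some neighbourhood of it at arbitrarily late times; a convergent subsequence of these gives
the second limit, outside that neighbourhood.
\<close>
lemma two_partial_limits:
  fixes f :: "real \<Rightarrow> ereal"
  assumes nonneg: "\<And>t. 0 \<le> t \<Longrightarrow> 0 \<le> f t"
    and no_limit: "\<not> (\<exists>L. 0 \<le> L \<and> (f \<longlongrightarrow> L) at_top)"
  obtains \<sigma> \<tau> L L' where "time_sequence \<sigma>" "time_sequence \<tau>" "0 \<le> L" "0 \<le> L'" "L \<noteq> L'"
    "(\<lambda>n. f (\<sigma> n)) \<longlonglongrightarrow> L" "(\<lambda>n. f (\<tau> n)) \<longlonglongrightarrow> L'"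
proof -
  have subsequence: "\<exists>r L. time_sequence (\<lambda>n. s (r n)) \<and> 0 \<le> L \<and> (\<lambda>n. f (s (r n))) \<longlonglongrightarrow> L"
    if s: "\<And>n. real n \<le> s n" for s :: "nat \<Rightarrow> real"
  proof -
    obtain L r where r: "strict_mono r" and L: "((\<lambda>n. f (s n)) \<circ> r) \<longlonglongrightarrow> L"
      using compact_complete_linorder by blast
    have "filterlim (\<lambda>n. s (r n)) at_top sequentially"
    proof (rule filterlim_at_top_mono[OF filterlim_real_sequentially], intro always_eventually allI)
      fix n
      have "real n \<le> real (r n)" using seq_suble[OF r, of n] by simp
      then show "real n \<le> s (r n)" using s[of "r n"] by linarith
    qed
    moreover have pos: "0 \<le> s (r n)" for n using s[of "r n"] by (rule order.trans[rotated]) simp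
    ultimately have "time_sequence (\<lambda>n. s (r n))" by (simp add: time_sequence_def)
    moreover have "0 \<le> L"
      by (rule LIMSEQ_le_const[OF L]) (use nonneg pos in auto)
    ultimately show ?thesis using L by (auto simp: o_def)
  qed
  obtain r L where r: "time_sequence (\<lambda>n. real (r n))" "0 \<le> L" "(\<lambda>n. f (real (r n))) \<longlonglongrightarrow> L"
    using subsequence[of real] by auto
  have "\<not> (f \<longlongrightarrow> L) at_top" using no_limit r(2) by blast
  then obtain S where S: "open S" "L \<in> S" "\<not> eventually (\<lambda>t. f t \<in> S) at_top"
    by (auto simp: tendsto_def)
  then have "\<exists>t\<ge>real n. f t \<notin> S" for n
    by (auto simp: eventually_at_top_linorder)
  then obtain s where s: "\<And>n. real n \<le> s n" "\<And>n. f (s n) \<notin> S" by metis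
  obtain q L' where q: "time_sequence (\<lambda>n. s (q n))" "0 \<le> L'" "(\<lambda>n. f (s (q n))) \<longlonglongrightarrow> L'"
    using subsequence[OF s(1)] by auto
  have "L' \<in> - S"
    by (rule closed_sequentially[OF _ _ q(3)]) (use S(1) s(2) in auto)
  then have "L \<noteq> L'" using S(2) by auto
  then show thesis using that r q by blast
qed

context theta_positive_branching_process
begin

section \<open>Survival, extinction and the conditional law\<close>

lemma mean_size_pos: "0 \<le> t \<Longrightarrow> 0 < mean_size M Z t"
  by (simp add: mean_eq)

lemma mean_size_powr:
  assumes "0 \<le> t"
  shows "mean_size M Z t powr (- \<theta>) = inverse_mean_power t"
    and "mean_size M Z t powr \<theta> = 1 / inverse_mean_power t"
    and "mean_size M Z t = inverse_mean_power t powr (- 1 / \<theta>)"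
proof -
  show "mean_size M Z t powr (- \<theta>) = inverse_mean_power t"
    using assms by (simp add: mean_eq inverse_mean_power_def powr_def)
  show "mean_size M Z t powr \<theta> = 1 / inverse_mean_power t"
    using assms by (simp add: mean_eq inverse_mean_power_def powr_def exp_minus field_simps)
  show "mean_size M Z t = inverse_mean_power t powr (- 1 / \<theta>)"
    using assms theta_range by (simp add: mean_eq inverse_mean_power_def powr_def)
qed

lemma V_fun_eq:
  assumes "0 \<le> t"
  shows "V_fun M Z lam \<theta> t = V t"
proof -
  have "(LBINT u:{0..t}. mean_size M Z u powr (- \<theta>) * lam u) = (LBINT u:{0..t}. inverse_mean_power u * lam u)"
    by (intro set_lebesgue_integral_cong) (simp_all add: mean_size_powr(1))
  then show ?thesis by (simp add: V_fun_def V_def)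
qed

definition survival_index :: "real \<Rightarrow> real" where
  "survival_index t = pgf_index t 0"

lemma survival_index_eq: "survival_index t = V t + 1 / (1 + \<theta>) + \<theta> / (1 + \<theta>) * inverse_mean_power t"
  using theta_range by (simp add: survival_index_def pgf_index_def field_simps)

lemma survival_index_ge_1: "0 \<le> t \<Longrightarrow> 1 \<le> survival_index t"
  unfolding survival_index_def by (rule pgf_index_ge_1) auto

lemma pgf_index_eq: "pgf_index t s = survival_index t + inverse_mean_power t * ((1 - s) powr (- \<theta>) - 1)"
  by (simp add: survival_index_def pgf_index_def algebra_simps)

lemma prob_extinct:
  assumes "0 \<le> t"
  shows "\<P>(\<omega> in M. Z t \<omega> = 0) = 1 - survival_index t powr (- 1 / \<theta>)"
proof -
  have "(\<integral>\<omega>. (0::real) ^ Z t \<omega> \<partial>M) = (\<integral>\<omega>. indicator {\<omega> \<in> space M. Z t \<omega> = 0} \<omega> \<partial>M)"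
    by (rule Bochner_Integration.integral_cong) (auto simp: indicator_def power_0_left)
  then show ?thesis
    using pgf_eq[OF assms, of 0] state_event_sets[OF assms, of 0] by (simp add: survival_index_def)
qed

lemma survival_event_sets:
  assumes "0 \<le> t"
  shows "{\<omega> \<in> space M. 0 < Z t \<omega>} \<in> sets M"
proof -
  have "{\<omega> \<in> space M. 0 < Z t \<omega>} = space M - {\<omega> \<in> space M. Z t \<omega> = 0}" by auto
  then show ?thesis using state_event_sets[OF assms] by auto
qed

lemma survival_prob_eq:
  assumes "0 \<le> t"
  shows "survival_prob M Z t = survival_index t powr (- 1 / \<theta>)"
proof -
  have "{\<omega> \<in> space M. 0 < Z t \<omega>} = space M - {\<omega> \<in> space M. Z t \<omega> = 0}" by auto
  then have "survival_prob M Z t = 1 - \<P>(\<omega> in M. Z t \<omega> = 0)"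
    unfolding survival_prob_def using prob_compl[OF state_event_sets[OF assms, of 0]] by simp
  then show ?thesis using prob_extinct[OF assms] by simp
qed

lemma survival_prob_pos: "0 \<le> t \<Longrightarrow> 0 < survival_prob M Z t"
  using survival_index_ge_1[of t] by (simp add: survival_prob_eq)

lemma conditional_mean_eq_ratio:
  assumes "0 \<le> t"
  shows "conditional_mean_size M Z t = mean_size M Z t / survival_prob M Z t"
proof -
  have "(LINT \<omega>:{\<omega> \<in> space M. Z t \<omega> > 0}|M. real (Z t \<omega>)) = (\<integral>\<omega>. real (Z t \<omega>) \<partial>M)"
    unfolding set_lebesgue_integral_def
    by (rule Bochner_Integration.integral_cong) (auto simp: indicator_def)
  then show ?thesis
    by (simp add: conditional_mean_size_def expectation_given_survival_def mean_size_def)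
qed

lemma conditional_mean_pos: "0 \<le> t \<Longrightarrow> 0 < conditional_mean_size M Z t"
  using mean_size_pos survival_prob_pos by (simp add: conditional_mean_eq_ratio)

lemma conditional_mean_eq:
  assumes "0 \<le> t"
  shows "conditional_mean_size M Z t = (survival_index t / inverse_mean_power t) powr (1 / \<theta>)"
proof -
  have "conditional_mean_size M Z t = (inverse_mean_power t / survival_index t) powr (- 1 / \<theta>)"
    using survival_index_ge_1[OF assms] inverse_mean_power_pos[of t]
    by (simp add: conditional_mean_eq_ratio[OF assms] survival_prob_eq[OF assms] mean_size_powr(3)[OF assms] powr_divide)
  also have "\<dots> = (survival_index t / inverse_mean_power t) powr (1 / \<theta>)"
    using survival_index_ge_1[OF assms] inverse_mean_power_pos[of t] by (simp add: powr_minus powr_divide)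
  finally show ?thesis .
qed

lemma conditional_mean_powr:
  assumes "0 \<le> t"
  shows "conditional_mean_size M Z t powr \<theta> = survival_index t / inverse_mean_power t"
    and "conditional_mean_size M Z t powr (- \<theta>) = inverse_mean_power t / survival_index t"
proof -
  have "0 < survival_index t" "0 < inverse_mean_power t"
    using survival_index_ge_1[OF assms] inverse_mean_power_pos[of t] by simp_all
  then show "conditional_mean_size M Z t powr \<theta> = survival_index t / inverse_mean_power t"
    "conditional_mean_size M Z t powr (- \<theta>) = inverse_mean_power t / survival_index t"
    using theta_range by (simp_all add: conditional_mean_eq[OF assms] powr_powr powr_minus)
qed

text \<open>
The generating function and the survival probability are the same power of \<open>pgf_index\<close> and of
\<open>survival_index\<close>. The two indices differ by a multiple of \<open>inverse_mean_power\<close>, and the quotient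
\<open>inverse_mean_power / survival_index\<close> is a power of the conditional mean, so the conditional law
depends on time only through that mean.
\<close>
lemma conditional_pgf:
  assumes t: "0 \<le> t" and s: "0 \<le> s" "s < 1"
  shows "expectation_given_survival M Z t (\<lambda>z. s ^ z)
    = 1 - (1 + conditional_mean_size M Z t powr (- \<theta>) * ((1 - s) powr (- \<theta>) - 1)) powr (- 1 / \<theta>)"
proof -
  have I0: "1 \<le> survival_index t" and I: "1 \<le> pgf_index t s"
    using survival_index_ge_1[OF t] pgf_index_ge_1[OF t s] .
  have "(LINT \<omega>:{\<omega> \<in> space M. Z t \<omega> > 0}|M. s ^ Z t \<omega>)
      = (\<integral>\<omega>. s ^ Z t \<omega> - indicator {\<omega> \<in> space M. Z t \<omega> = 0} \<omega> \<partial>M)"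
    unfolding set_lebesgue_integral_def
    by (rule Bochner_Integration.integral_cong) (auto simp: indicator_def)
  also have "\<dots> = (\<integral>\<omega>. s ^ Z t \<omega> \<partial>M) - \<P>(\<omega> in M. Z t \<omega> = 0)"
    using integrable_real_indicator[OF state_event_sets[OF t, of 0]] power_state_integrable[OF t, of s] s state_event_sets[OF t, of 0]
    by (subst Bochner_Integration.integral_diff) (simp_all add: emeasure_eq_measure)
  also have "\<dots> = survival_index t powr (- 1 / \<theta>) - pgf_index t s powr (- 1 / \<theta>)"
    using pgf_eq[OF t s] prob_extinct[OF t] by simp
  finally have "expectation_given_survival M Z t (\<lambda>z. s ^ z)
      = 1 - pgf_index t s powr (- 1 / \<theta>) / survival_index t powr (- 1 / \<theta>)"
    using I0 by (simp add: expectation_given_survival_def survival_prob_eq[OF t] diff_divide_distrib)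
  also have "pgf_index t s powr (- 1 / \<theta>) / survival_index t powr (- 1 / \<theta>)
      = (pgf_index t s / survival_index t) powr (- 1 / \<theta>)"
    using I I0 by (simp add: powr_divide)
  also have "pgf_index t s / survival_index t
      = 1 + conditional_mean_size M Z t powr (- \<theta>) * ((1 - s) powr (- \<theta>) - 1)"
    using I0 by (simp add: pgf_index_eq conditional_mean_powr[OF t] add_divide_distrib)
  finally show ?thesis .
qed

lemma expectation_given_survival_one:
  assumes "0 \<le> t"
  shows "expectation_given_survival M Z t (\<lambda>z. 1) = 1"
proof -
  have "(LINT \<omega>:{\<omega> \<in> space M. Z t \<omega> > 0}|M. 1) = survival_prob M Z t"
    using survival_event_sets[OF assms] by (simp add: set_lebesgue_integral_def survival_prob_def)
  then show ?thesis
    using survival_prob_pos[OF assms] by (simp add: expectation_given_survival_def)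
qed

lemma inverse_mean_power_le:
  assumes "0 \<le> t"
  shows "inverse_mean_power t \<le> 1 + (1 + \<theta>) * V t"
proof -
  have "- 1 / (1 + \<theta>) \<le> \<theta> / (1 + \<theta>)"
    using theta_range by (intro divide_right_mono) auto
  then have "V 0 + (- 1 / (1 + \<theta>)) * inverse_mean_power 0 \<le> V t + (- 1 / (1 + \<theta>)) * inverse_mean_power t"
    using assms by (intro V_plus_inverse_mean_power_mono) auto
  then show ?thesis using theta_range by (simp add: initial_values field_simps)
qed

lemma V_limit_eq_infinity_iff: "V_limit M Z lam \<theta> = \<infinity> \<longleftrightarrow> filterlim V at_top at_top"
proof -
  have eq: "eventually (\<lambda>t. ereal (V_fun M Z lam \<theta> t) = ereal (V t)) at_top"
    using eventually_ge_at_top[of 0] by eventually_elim (simp add: V_fun_eq)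
  have Lim: "V_limit M Z lam \<theta> = L" if "((\<lambda>t. ereal (V t)) \<longlongrightarrow> L) at_top" for L
    unfolding V_limit_def using that tendsto_cong[OF eq] by (intro tendsto_Lim) auto
  show ?thesis
  proof (rule monotone_limit_cases[of V])
    assume "filterlim V at_top at_top"
    then show ?thesis using Lim[of \<infinity>] by (simp add: tendsto_PInfty_eq_at_top)
  next
    fix l assume l: "(V \<longlongrightarrow> l) at_top"
    then have "V_limit M Z lam \<theta> = ereal l" by (intro Lim) simp
    moreover have "\<not> filterlim V at_top at_top"
      using l not_tendsto_and_filterlim_at_infinity[OF _ l] filterlim_at_top_imp_at_infinity by auto
    ultimately show ?thesis by simp
  qed (rule V_mono)
qed

text \<open>
The extinction probability is defined through \<open>Lim\<close>, which is meaningful only if the limit exists;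
hence the monotonicity of the survival index. The index lies between \<open>V\<close> and \<open>1 + (1 + \<theta>) * V\<close>,
so both are unbounded together.
\<close>
lemma extinction_prob_eq_1_iff: "extinction_prob M Z = 1 \<longleftrightarrow> filterlim V at_top at_top"
proof -
  have eq: "eventually (\<lambda>t. \<P>(\<omega> in M. Z t \<omega> = 0) = 1 - survival_index t powr (- 1 / \<theta>)) at_top"
    using eventually_ge_at_top[of 0] by eventually_elim (rule prob_extinct)
  have Lim: "extinction_prob M Z = L" if "((\<lambda>t. 1 - survival_index t powr (- 1 / \<theta>)) \<longlongrightarrow> L) at_top" for L
    unfolding extinction_prob_def using that tendsto_cong[OF eq] by (intro tendsto_Lim) auto
  have mono: "survival_index r \<le> survival_index t" if "0 \<le> r" "r \<le> t" for r t
  proof -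
    have "- 1 / (1 + \<theta>) \<le> \<theta> / (1 + \<theta>)"
      using theta_range by (intro divide_right_mono) auto
    then show ?thesis
      using V_plus_inverse_mean_power_mono[OF that, of "\<theta> / (1 + \<theta>)"] by (simp add: survival_index_eq)
  qed
  have V_le: "V t \<le> survival_index t" and index_le: "survival_index t \<le> 1 + (1 + \<theta>) * V t" if "0 \<le> t" for t
  proof -
    show "V t \<le> survival_index t"
      using theta_range inverse_mean_power_pos[of t] by (simp add: survival_index_eq)
    have "\<theta> / (1 + \<theta>) * inverse_mean_power t \<le> \<theta> / (1 + \<theta>) * (1 + (1 + \<theta>) * V t)"
      using inverse_mean_power_le[OF that] theta_range by (intro mult_left_mono) auto
    also have "\<dots> = \<theta> / (1 + \<theta>) + \<theta> * V t" using theta_range by (simp add: field_simps)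
    finally have "survival_index t \<le> V t + (1 / (1 + \<theta>) + \<theta> / (1 + \<theta>)) + \<theta> * V t"
      by (simp add: survival_index_eq)
    also have "1 / (1 + \<theta>) + \<theta> / (1 + \<theta>) = 1" using theta_range by (simp flip: add_divide_distrib)
    finally show "survival_index t \<le> 1 + (1 + \<theta>) * V t" by (simp add: distrib_right)
  qed
  show ?thesis
  proof (rule monotone_limit_cases[of survival_index])
    assume top: "filterlim survival_index at_top at_top"
    then have "((\<lambda>t. survival_index t powr (- 1 / \<theta>)) \<longlongrightarrow> 0) at_top"
      using theta_range by (intro tendsto_neg_powr) auto
    then have "((\<lambda>t. 1 - survival_index t powr (- 1 / \<theta>)) \<longlongrightarrow> 1 - 0) at_top" by (intro tendsto_intros)
    then have "extinction_prob M Z = 1" using Lim by simp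
    moreover have "filterlim V at_top at_top"
    proof (rule monotone_limit_cases[of V])
      fix l assume "(V \<longlongrightarrow> l) at_top"
      then have "((\<lambda>t. 1 + (1 + \<theta>) * V t) \<longlongrightarrow> 1 + (1 + \<theta>) * l) at_top" by (intro tendsto_intros)
      moreover have "filterlim (\<lambda>t. 1 + (1 + \<theta>) * V t) at_top at_top"
        using top by (rule filterlim_at_top_mono)
          (use index_le in \<open>auto intro: eventually_mono[OF eventually_ge_at_top[of 0]]\<close>)
      ultimately show ?thesis
        using not_tendsto_and_filterlim_at_infinity[of at_top] filterlim_at_top_imp_at_infinity
          trivial_limit_at_top_linorder by blast
    qed (auto intro: V_mono)
    ultimately show ?thesis by simp
  next
    fix l assume l: "(survival_index \<longlongrightarrow> l) at_top"
    have "1 \<le> l"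
      by (rule tendsto_lowerbound[OF l])
         (auto intro: eventually_mono[OF eventually_ge_at_top[of 0]] survival_index_ge_1)
    then have "((\<lambda>t. 1 - survival_index t powr (- 1 / \<theta>)) \<longlongrightarrow> 1 - l powr (- 1 / \<theta>)) at_top"
      using l by (intro tendsto_intros) auto
    then have "extinction_prob M Z = 1 - l powr (- 1 / \<theta>)" by (rule Lim)
    then have "extinction_prob M Z \<noteq> 1" using \<open>1 \<le> l\<close> by simp
    moreover have "\<not> filterlim V at_top at_top"
    proof
      assume "filterlim V at_top at_top"
      then have "filterlim survival_index at_top at_top"
        by (rule filterlim_at_top_mono)
           (use V_le in \<open>auto intro: eventually_mono[OF eventually_ge_at_top[of 0]]\<close>)
      then show False
        using not_tendsto_and_filterlim_at_infinity[OF _ l] filterlim_at_top_imp_at_infinity by auto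
    qed
    ultimately show ?thesis by simp
  qed (rule mono)
qed

section \<open>Partial limits\<close>

definition scaled_V :: "real \<Rightarrow> real" where
  "scaled_V t = V t / inverse_mean_power t"

lemma scaled_V_eq:
  assumes "0 \<le> t"
  shows "mean_size M Z t powr \<theta> * V_fun M Z lam \<theta> t = scaled_V t"
  using assms by (simp add: scaled_V_def mean_size_powr(2) V_fun_eq)

lemma scaled_V_nonneg: "0 \<le> t \<Longrightarrow> 0 \<le> scaled_V t"
  using V_nonneg inverse_mean_power_pos[of t] by (simp add: scaled_V_def)

lemma conditional_mean_powr_eq_scaled_V:
  assumes "0 \<le> t" "0 < V t"
  shows "conditional_mean_size M Z t powr \<theta>
    = scaled_V t * (1 + 1 / ((1 + \<theta>) * V t)) + \<theta> / (1 + \<theta>)"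
proof -
  have "survival_index t / inverse_mean_power t
      = V t / inverse_mean_power t + 1 / (1 + \<theta>) / inverse_mean_power t + \<theta> / (1 + \<theta>)"
    using inverse_mean_power_pos[of t] by (simp add: survival_index_eq add_divide_distrib)
  moreover have "1 / (1 + \<theta>) / inverse_mean_power t = scaled_V t * (1 / ((1 + \<theta>) * V t))"
    using assms(2) by (simp add: scaled_V_def)
  ultimately show ?thesis
    by (simp add: conditional_mean_powr[OF assms(1)] scaled_V_def distrib_left)
qed

lemma correction_tendsto:
  assumes "filterlim v at_top F"
  shows "((\<lambda>t. 1 + 1 / ((1 + \<theta>) * v t)) \<longlongrightarrow> 1) F"
proof -
  have "filterlim (\<lambda>t. (1 + \<theta>) * v t) at_top F"
    using theta_range by (intro filterlim_tendsto_pos_mult_at_top[OF tendsto_const _ assms]) auto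
  then have "((\<lambda>t. inverse ((1 + \<theta>) * v t)) \<longlongrightarrow> 0) F"
    by (intro tendsto_inverse_0_at_top)
  then have "((\<lambda>t. 1 + inverse ((1 + \<theta>) * v t)) \<longlongrightarrow> 1 + 0) F" by (intro tendsto_intros)
  then show ?thesis by (simp add: inverse_eq_divide)
qed

text \<open>
The power \<open>\<theta>\<close> of the conditional mean is \<open>scaled_V\<close> up to a factor that tends to 1 and a constant
shift. The filter is arbitrary because the limit is taken both over all times and along sequences.
\<close>
lemma conditional_mean_limit:
  assumes g: "eventually (\<lambda>n. 0 \<le> g n) F" and V: "filterlim (\<lambda>n. V (g n)) at_top F"
  shows "((\<lambda>n. scaled_V (g n)) \<longlongrightarrow> K) F \<Longrightarrow> F \<noteq> bot \<Longrightarrow>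
      ((\<lambda>n. conditional_mean_size M Z (g n)) \<longlongrightarrow> (K + \<theta> / (1 + \<theta>)) powr (1 / \<theta>)) F"
    and "filterlim (\<lambda>n. scaled_V (g n)) at_top F \<Longrightarrow>
      filterlim (\<lambda>n. conditional_mean_size M Z (g n)) at_top F"
    and "((\<lambda>n. conditional_mean_size M Z (g n)) \<longlongrightarrow> m) F \<Longrightarrow>
      ((\<lambda>n. scaled_V (g n)) \<longlongrightarrow> m powr \<theta> - \<theta> / (1 + \<theta>)) F"
    and "filterlim (\<lambda>n. conditional_mean_size M Z (g n)) at_top F \<Longrightarrow>
      filterlim (\<lambda>n. scaled_V (g n)) at_top F"
proof -
  let ?cm = "\<lambda>n. conditional_mean_size M Z (g n)" and ?c = "\<lambda>n. 1 + 1 / ((1 + \<theta>) * V (g n))"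
  have c: "(?c \<longlongrightarrow> 1) F" by (rule correction_tendsto[OF V])
  have pos: "eventually (\<lambda>n. 0 \<le> g n \<and> 0 < V (g n)) F"
    using g filterlim_at_top_dense[THEN iffD1, OF V, rule_format, of 0] by eventually_elim auto
  have cm_powr: "eventually (\<lambda>n. ?cm n powr \<theta> = scaled_V (g n) * ?c n + \<theta> / (1 + \<theta>)) F"
    using pos by eventually_elim (rule conditional_mean_powr_eq_scaled_V; simp)
  have cm: "eventually (\<lambda>n. (scaled_V (g n) * ?c n + \<theta> / (1 + \<theta>)) powr (1 / \<theta>) = ?cm n) F"
    using cm_powr g
  proof eventually_elim
    case (elim n)
    have "0 < ?cm n" by (rule conditional_mean_pos[OF elim(2)])
    then show ?case unfolding elim(1)[symmetric] using theta_range by (simp add: powr_powr)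
  qed
  have scaled: "eventually (\<lambda>n. (?cm n powr \<theta> - \<theta> / (1 + \<theta>)) / ?c n = scaled_V (g n)) F"
    using cm_powr pos
  proof eventually_elim
    case (elim n)
    have "0 < ?c n" using elim theta_range by (intro add_pos_nonneg) auto
    then show ?case unfolding elim(1) by simp
  qed
  have theta: "0 < \<theta> / (1 + \<theta>)" using theta_range by simp
  show "(?cm \<longlongrightarrow> (K + \<theta> / (1 + \<theta>)) powr (1 / \<theta>)) F"
    if K: "((\<lambda>n. scaled_V (g n)) \<longlongrightarrow> K) F" and F: "F \<noteq> bot"
  proof -
    have "0 \<le> K"
      by (rule tendsto_lowerbound[OF K _ F]) (use g in \<open>auto elim: eventually_mono intro: scaled_V_nonneg\<close>)
    then have "((\<lambda>n. (scaled_V (g n) * ?c n + \<theta> / (1 + \<theta>)) powr (1 / \<theta>))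
        \<longlongrightarrow> (K * 1 + \<theta> / (1 + \<theta>)) powr (1 / \<theta>)) F"
      using theta by (intro tendsto_powr tendsto_add tendsto_mult K c tendsto_const) auto
    then show ?thesis using tendsto_cong[OF cm] by simp
  qed
  show "filterlim ?cm at_top F" if "filterlim (\<lambda>n. scaled_V (g n)) at_top F"
  proof -
    have "filterlim (\<lambda>n. scaled_V (g n) * ?c n) at_top F"
      by (rule filterlim_at_top_mult_tendsto_pos[OF c _ that]) simp
    then have "filterlim (\<lambda>n. \<theta> / (1 + \<theta>) + scaled_V (g n) * ?c n) at_top F"
      by (rule filterlim_tendsto_add_at_top[OF tendsto_const])
    moreover have "filterlim (\<lambda>x::real. x powr (1 / \<theta>)) at_top at_top"
      using theta_range(1) by real_asymp
    ultimately have "filterlim (\<lambda>n. (\<theta> / (1 + \<theta>) + scaled_V (g n) * ?c n) powr (1 / \<theta>)) at_top F"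
      by (rule filterlim_compose[rotated])
    then show ?thesis
      using filterlim_cong[OF refl refl cm] by (simp add: add.commute)
  qed
  show "((\<lambda>n. scaled_V (g n)) \<longlongrightarrow> m powr \<theta> - \<theta> / (1 + \<theta>)) F" if m: "(?cm \<longlongrightarrow> m) F"
  proof -
    have "eventually (\<lambda>n. 0 \<le> ?cm n) F"
      using g by eventually_elim (simp add: conditional_mean_pos less_imp_le)
    then have "((\<lambda>n. (?cm n powr \<theta> - \<theta> / (1 + \<theta>)) / ?c n) \<longlongrightarrow> (m powr \<theta> - \<theta> / (1 + \<theta>)) / 1) F"
      using theta_range
      by (intro tendsto_divide tendsto_diff tendsto_powr' m c tendsto_const) auto
    then show ?thesis using tendsto_cong[OF scaled] by simp
  qed
  show "filterlim (\<lambda>n. scaled_V (g n)) at_top F" if "filterlim ?cm at_top F"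
  proof -
    have "filterlim (\<lambda>x::real. x powr \<theta>) at_top at_top"
      using theta_range(1) by real_asymp
    then have "filterlim (\<lambda>n. ?cm n powr \<theta>) at_top F" using that by (rule filterlim_compose)
    then have "filterlim (\<lambda>n. - (\<theta> / (1 + \<theta>)) + ?cm n powr \<theta>) at_top F"
      by (rule filterlim_tendsto_add_at_top[OF tendsto_const])
    moreover have "((\<lambda>n. inverse (?c n)) \<longlongrightarrow> inverse 1) F" by (intro tendsto_inverse c) simp
    ultimately have "filterlim (\<lambda>n. (- (\<theta> / (1 + \<theta>)) + ?cm n powr \<theta>) * inverse (?c n)) at_top F"
      by (intro filterlim_at_top_mult_tendsto_pos[where c = "inverse 1"]) auto
    then show ?thesis
      using filterlim_cong[OF refl refl scaled] by (simp add: divide_inverse add.commute)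
  qed
qed

lemma loosely_subcritical_iff:
  "loosely_subcritical M Z \<longleftrightarrow> V_limit M Z lam \<theta> = \<infinity> \<and>
     \<not> (\<exists>L::ereal. 0 \<le> L \<and>
          ((\<lambda>t. ereal (mean_size M Z t powr \<theta> * V_fun M Z lam \<theta> t)) \<longlongrightarrow> L) at_top)"
proof (cases "filterlim V at_top at_top")
  case False
  then show ?thesis
    by (simp add: loosely_subcritical_def V_limit_eq_infinity_iff extinction_prob_eq_1_iff)
next
  case True
  have ge0: "eventually (\<lambda>t::real. 0 \<le> t) at_top" by (rule eventually_ge_at_top)
  have eq: "eventually (\<lambda>t. ereal (mean_size M Z t powr \<theta> * V_fun M Z lam \<theta> t) = ereal (scaled_V t)) at_top"
    using ge0 by eventually_elim (simp add: scaled_V_eq)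
  have nonneg: "eventually (\<lambda>t. 0 \<le> scaled_V t) at_top" "eventually (\<lambda>t. 0 \<le> conditional_mean_size M Z t) at_top"
    by (rule eventually_mono[OF ge0], simp add: scaled_V_nonneg conditional_mean_pos less_imp_le)+
  have "(\<exists>L::ereal. 0 \<le> L \<and> ((\<lambda>t. ereal (mean_size M Z t powr \<theta> * V_fun M Z lam \<theta> t)) \<longlongrightarrow> L) at_top)
      \<longleftrightarrow> (\<exists>L::ereal. 0 \<le> L \<and> ((\<lambda>t. ereal (scaled_V t)) \<longlongrightarrow> L) at_top)"
    using tendsto_cong[OF eq] by simp
  also have "\<dots> \<longleftrightarrow> (\<exists>L::ereal. ((\<lambda>t. ereal (scaled_V t)) \<longlongrightarrow> L) at_top)"
  proof -
    have "0 \<le> L" if "((\<lambda>t. ereal (scaled_V t)) \<longlongrightarrow> L) at_top" for L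
      by (rule tendsto_lowerbound[OF that]) (use nonneg(1) in \<open>auto elim: eventually_mono\<close>)
    then show ?thesis by blast
  qed
  also have "\<dots> \<longleftrightarrow> (\<exists>L::ereal. ((\<lambda>t. ereal (conditional_mean_size M Z t)) \<longlongrightarrow> L) at_top)"
    using conditional_mean_limit[where g = "\<lambda>t. t", OF ge0 True] trivial_limit_at_top_linorder
    unfolding ereal_limit_cases[OF trivial_limit_at_top_linorder nonneg(1)]
      ereal_limit_cases[OF trivial_limit_at_top_linorder nonneg(2)] by blast
  finally show ?thesis
    using True by (simp add: loosely_subcritical_def V_limit_eq_infinity_iff extinction_prob_eq_1_iff)
qed

text \<open>
Both equivalences are powers of \<open>survival_index / V\<close>, which tends to 1 because \<open>1 / V\<close> and
\<open>inverse_mean_power / V\<close> vanish in the limit.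
\<close>
lemma infinite_partial_limit_survival:
  assumes g: "\<And>n. 0 \<le> g n" and V: "filterlim (\<lambda>n. V (g n)) at_top F"
    and top: "filterlim (\<lambda>n. scaled_V (g n)) at_top F"
  shows "(\<lambda>n. survival_prob M Z (g n)) \<sim>[F] (\<lambda>n. V_fun M Z lam \<theta> (g n) powr (- 1 / \<theta>))"
    and "(\<lambda>n. conditional_mean_size M Z (g n))
      \<sim>[F] (\<lambda>n. mean_size M Z (g n) * V_fun M Z lam \<theta> (g n) powr (1 / \<theta>))"
proof -
  have pos: "eventually (\<lambda>n. 0 < V (g n)) F"
    using filterlim_at_top_dense[THEN iffD1, OF V] by blast
  have "((\<lambda>n. inverse (scaled_V (g n))) \<longlongrightarrow> 0) F"
    by (rule tendsto_inverse_0_at_top[OF top])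
  then have "((\<lambda>n. (1 + 1 / ((1 + \<theta>) * V (g n))) + \<theta> / (1 + \<theta>) * inverse (scaled_V (g n)))
      \<longlongrightarrow> 1 + \<theta> / (1 + \<theta>) * 0) F"
    by (intro tendsto_intros correction_tendsto V)
  moreover have "eventually (\<lambda>n. (1 + 1 / ((1 + \<theta>) * V (g n))) + \<theta> / (1 + \<theta>) * inverse (scaled_V (g n))
      = survival_index (g n) / V (g n)) F"
    using pos
    by eventually_elim (simp add: survival_index_eq scaled_V_def add_divide_distrib)
  ultimately have ratio: "((\<lambda>n. survival_index (g n) / V (g n)) \<longlongrightarrow> 1) F"
    using tendsto_cong by force
  have "((\<lambda>n. (survival_index (g n) / V (g n)) powr c) \<longlongrightarrow> 1 powr c) F" for c
    by (intro tendsto_powr ratio tendsto_const) simp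
  then have powr: "((\<lambda>n. (survival_index (g n) / V (g n)) powr c) \<longlongrightarrow> 1) F" for c by simp
  show "(\<lambda>n. survival_prob M Z (g n)) \<sim>[F] (\<lambda>n. V_fun M Z lam \<theta> (g n) powr (- 1 / \<theta>))"
  proof (rule asymp_equivI')
    have "eventually (\<lambda>n. (survival_index (g n) / V (g n)) powr (- 1 / \<theta>)
        = survival_prob M Z (g n) / V_fun M Z lam \<theta> (g n) powr (- 1 / \<theta>)) F"
      using pos
    proof eventually_elim
      case (elim n)
      then show ?case using survival_index_ge_1[OF g, of n]
        by (simp add: survival_prob_eq[OF g] V_fun_eq[OF g] powr_divide)
    qed
    from tendsto_cong[OF this] powr
    show "((\<lambda>n. survival_prob M Z (g n) / V_fun M Z lam \<theta> (g n) powr (- 1 / \<theta>)) \<longlongrightarrow> 1) F" by blast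
  qed
  show "(\<lambda>n. conditional_mean_size M Z (g n))
      \<sim>[F] (\<lambda>n. mean_size M Z (g n) * V_fun M Z lam \<theta> (g n) powr (1 / \<theta>))"
  proof (rule asymp_equivI')
    have "eventually (\<lambda>n. (survival_index (g n) / V (g n)) powr (1 / \<theta>)
        = conditional_mean_size M Z (g n) / (mean_size M Z (g n) * V_fun M Z lam \<theta> (g n) powr (1 / \<theta>))) F"
      using pos
    proof eventually_elim
      case (elim n)
      have "survival_prob M Z (g n) = 1 / survival_index (g n) powr (1 / \<theta>)"
        by (simp add: survival_prob_eq[OF g] powr_minus_divide)
      then show ?case using elim survival_index_ge_1[OF g, of n] mean_size_pos[OF g, of n]
        by (simp add: conditional_mean_eq_ratio[OF g] V_fun_eq[OF g] powr_divide)
    qed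
    from tendsto_cong[OF this] powr
    show "((\<lambda>n. conditional_mean_size M Z (g n)
        / (mean_size M Z (g n) * V_fun M Z lam \<theta> (g n) powr (1 / \<theta>))) \<longlongrightarrow> 1) F" by blast
  qed
qed

text \<open>
With \<open>s = exp (- w / m)\<close> the conditional generating function involves
\<open>(m * (1 - s)) powr (- \<theta>)\<close>, and \<open>m * (1 - s)\<close> tends to \<open>w\<close> as the conditional mean \<open>m\<close> tends to infinity.
\<close>
lemma infinite_partial_limit_laplace:
  assumes g: "\<And>n. 0 \<le> g n" and V: "filterlim (\<lambda>n. V (g n)) at_top F"
    and top: "filterlim (\<lambda>n. scaled_V (g n)) at_top F" and w: "0 \<le> w"
  shows "((\<lambda>n. expectation_given_survival M Z (g n) (\<lambda>z. exp (- w * real z / conditional_mean_size M Z (g n))))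
    \<longlongrightarrow> (if w = 0 then 1 else 1 - (1 + w powr (- \<theta>)) powr (- 1 / \<theta>))) F"
proof (cases "w = 0")
  case True
  then show ?thesis using expectation_given_survival_one[OF g] by simp
next
  case False
  with w have w: "0 < w" by simp
  let ?cm = "\<lambda>n. conditional_mean_size M Z (g n)"
  have cm: "filterlim ?cm at_top F"
    using g by (intro conditional_mean_limit(2)[OF _ V top]) simp
  have small: "((\<lambda>n. ?cm n powr (- \<theta>)) \<longlongrightarrow> 0) F"
    using theta_range by (intro tendsto_neg_powr cm) auto
  have "((\<lambda>m::real. m * (1 - exp (- w / m))) \<longlongrightarrow> w) at_top" by real_asymp
  from filterlim_compose[OF this cm]
  have "((\<lambda>n. ?cm n * (1 - exp (- w / ?cm n))) \<longlongrightarrow> w) F" .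
  then have main: "((\<lambda>n. (?cm n * (1 - exp (- w / ?cm n))) powr (- \<theta>)) \<longlongrightarrow> w powr (- \<theta>)) F"
    by (rule tendsto_powr[OF _ tendsto_const]) (use w in simp)
  have "((\<lambda>n. 1 - (1 + ((?cm n * (1 - exp (- w / ?cm n))) powr (- \<theta>) - ?cm n powr (- \<theta>))) powr (- 1 / \<theta>))
      \<longlongrightarrow> 1 - (1 + (w powr (- \<theta>) - 0)) powr (- 1 / \<theta>)) F"
    using w by (intro tendsto_diff tendsto_powr tendsto_add tendsto_const small main) (auto simp: add_nonneg_eq_0_iff)
  moreover have "1 - (1 + ((?cm n * (1 - exp (- w / ?cm n))) powr (- \<theta>) - ?cm n powr (- \<theta>))) powr (- 1 / \<theta>)
      = expectation_given_survival M Z (g n) (\<lambda>z. exp (- w * real z / ?cm n))" for n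
  proof -
    have cm0: "0 < ?cm n" by (rule conditional_mean_pos[OF g])
    have s: "0 \<le> exp (- w / ?cm n)" "exp (- w / ?cm n) < 1" using w cm0 by auto
    have "exp (- w * real z / ?cm n) = exp (- w / ?cm n) ^ z" for z
      by (simp add: mult.commute flip: exp_of_nat_mult)
    then have "expectation_given_survival M Z (g n) (\<lambda>z. exp (- w * real z / ?cm n))
        = 1 - (1 + ?cm n powr (- \<theta>) * ((1 - exp (- w / ?cm n)) powr (- \<theta>) - 1)) powr (- 1 / \<theta>)"
      using conditional_pgf[OF g s] by simp
    also have "?cm n powr (- \<theta>) * ((1 - exp (- w / ?cm n)) powr (- \<theta>) - 1)
        = (?cm n * (1 - exp (- w / ?cm n))) powr (- \<theta>) - ?cm n powr (- \<theta>)"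
    proof -
      have "(?cm n * (1 - exp (- w / ?cm n))) powr (- \<theta>)
          = ?cm n powr (- \<theta>) * (1 - exp (- w / ?cm n)) powr (- \<theta>)"
        by (rule powr_mult)
      then show ?thesis by (simp only: right_diff_distrib[of "?cm n powr (- \<theta>)"] mult_1_right)
    qed
    finally show ?thesis by simp
  qed
  ultimately show ?thesis using False by simp
qed

text \<open>
The mean vanishes because its power \<open>\<theta>\<close> is \<open>scaled_V / V\<close>, with bounded numerator; the other limits are
continuous functions of the conditional mean, which converges to a positive number.
\<close>
lemma finite_partial_limit:
  assumes g: "\<And>n. 0 \<le> g n" and V: "filterlim (\<lambda>n. V (g n)) at_top F" and F: "F \<noteq> bot"
    and K: "((\<lambda>n. scaled_V (g n)) \<longlongrightarrow> K) F" and K0: "0 \<le> K"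
  defines "m \<equiv> (K + \<theta> / (1 + \<theta>)) powr (1 / \<theta>)"
  shows "((\<lambda>n. mean_size M Z (g n)) \<longlongrightarrow> 0) F"
    and "(\<lambda>n. survival_prob M Z (g n)) \<sim>[F] (\<lambda>n. mean_size M Z (g n) / m)"
    and "((\<lambda>n. conditional_mean_size M Z (g n)) \<longlongrightarrow> m) F"
    and "0 \<le> s \<Longrightarrow> s \<le> 1 \<Longrightarrow> ((\<lambda>n. expectation_given_survival M Z (g n) (\<lambda>z. s ^ z))
      \<longlongrightarrow> (if s = 1 then 1 else 1 - m * (K - 1 / (1 + \<theta>) + (1 - s) powr (- \<theta>)) powr (- 1 / \<theta>))) F"
proof -
  let ?cm = "\<lambda>n. conditional_mean_size M Z (g n)"
  have base: "0 < K + \<theta> / (1 + \<theta>)" using K0 theta_range by (intro add_nonneg_pos) auto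
  then have m: "0 < m" by (simp add: m_def)
  show cm: "(?cm \<longlongrightarrow> m) F"
    unfolding m_def using g by (intro conditional_mean_limit(1)[OF _ V K F]) simp
  have pos: "eventually (\<lambda>n. 0 < V (g n)) F"
    using filterlim_at_top_dense[THEN iffD1, OF V] by blast
  have "((\<lambda>n. scaled_V (g n) * inverse (V (g n))) \<longlongrightarrow> K * 0) F"
    by (intro tendsto_mult K tendsto_inverse_0_at_top V)
  then have "((\<lambda>n. (scaled_V (g n) * inverse (V (g n))) powr (1 / \<theta>)) \<longlongrightarrow> 0) F"
    using theta_range pos
    by (intro tendsto_zero_powrI[where b = "1 / \<theta>"])
       (auto elim!: eventually_mono intro!: mult_nonneg_nonneg scaled_V_nonneg g simp: less_imp_le)
  moreover have "eventually (\<lambda>n. (scaled_V (g n) * inverse (V (g n))) powr (1 / \<theta>) = mean_size M Z (g n)) F"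
    using pos
  proof eventually_elim
    case (elim n)
    have "scaled_V (g n) * inverse (V (g n)) = mean_size M Z (g n) powr \<theta>"
      using elim by (simp add: scaled_V_def mean_size_powr(2)[OF g] field_simps)
    then show ?case using mean_size_pos[OF g, of n] theta_range by (simp add: powr_powr)
  qed
  ultimately show "((\<lambda>n. mean_size M Z (g n)) \<longlongrightarrow> 0) F" using tendsto_cong by force
  show "(\<lambda>n. survival_prob M Z (g n)) \<sim>[F] (\<lambda>n. mean_size M Z (g n) / m)"
  proof (rule asymp_equivI')
    have "((\<lambda>n. m / ?cm n) \<longlongrightarrow> m / m) F" using m by (intro tendsto_intros cm) auto
    moreover have "m / ?cm n = survival_prob M Z (g n) / (mean_size M Z (g n) / m)" for n
      by (simp add: conditional_mean_eq_ratio[OF g])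
    ultimately show "((\<lambda>n. survival_prob M Z (g n) / (mean_size M Z (g n) / m)) \<longlongrightarrow> 1) F"
      using m by simp
  qed
  show "((\<lambda>n. expectation_given_survival M Z (g n) (\<lambda>z. s ^ z))
      \<longlongrightarrow> (if s = 1 then 1 else 1 - m * (K - 1 / (1 + \<theta>) + (1 - s) powr (- \<theta>)) powr (- 1 / \<theta>))) F"
    if s: "0 \<le> s" "s \<le> 1"
  proof (cases "s = 1")
    case True
    then show ?thesis using expectation_given_survival_one[OF g] by simp
  next
    case False
    with s have s: "0 \<le> s" "s < 1" by auto
    have ge1: "1 \<le> (1 - s) powr (- \<theta>)" using powr_neg_theta_mono[of 0 s] s by simp
    have m_powr: "m powr (- \<theta>) = 1 / (K + \<theta> / (1 + \<theta>))"
      using base theta_range by (simp add: m_def powr_powr powr_minus_divide)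
    have pos: "0 < K - 1 / (1 + \<theta>) + (1 - s) powr (- \<theta>)"
    proof -
      have "1 / (1 + \<theta>) < 1" using theta_range by simp
      then show ?thesis using ge1 K0 by linarith
    qed
    have eq: "1 + m powr (- \<theta>) * ((1 - s) powr (- \<theta>) - 1)
        = (K - 1 / (1 + \<theta>) + (1 - s) powr (- \<theta>)) / (K + \<theta> / (1 + \<theta>))"
    proof -
      have "\<theta> / (1 + \<theta>) = 1 - 1 / (1 + \<theta>)" using theta_range by (simp add: field_simps)
      then show ?thesis unfolding m_powr using base by (simp add: field_simps)
    qed
    have "((\<lambda>n. 1 - (1 + ?cm n powr (- \<theta>) * ((1 - s) powr (- \<theta>) - 1)) powr (- 1 / \<theta>))
        \<longlongrightarrow> 1 - (1 + m powr (- \<theta>) * ((1 - s) powr (- \<theta>) - 1)) powr (- 1 / \<theta>)) F"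
      using m ge1 by (intro tendsto_intros cm) (auto simp: add_nonneg_eq_0_iff)
    moreover have "(1 + m powr (- \<theta>) * ((1 - s) powr (- \<theta>) - 1)) powr (- 1 / \<theta>)
        = m * (K - 1 / (1 + \<theta>) + (1 - s) powr (- \<theta>)) powr (- 1 / \<theta>)"
    proof -
      have "(I / J) powr (- 1 / \<theta>) = J powr (1 / \<theta>) * I powr (- 1 / \<theta>)" if "0 < I" "0 < J" for I J :: real
        using that by (simp add: powr_divide powr_minus_divide)
      then show ?thesis unfolding eq unfolding m_def using base pos by blast
    qed
    ultimately show ?thesis using False conditional_pgf[OF g s] by simp
  qed
qed

lemma partial_limit_iff:
  assumes "time_sequence \<tau>"
  shows "has_partial_limit M Z lam \<theta> \<tau> L \<longleftrightarrow> (\<lambda>n. ereal (scaled_V (\<tau> n))) \<longlonglongrightarrow> L"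
  using assms by (simp add: has_partial_limit_def time_sequence_def scaled_V_eq)

end

theorem theorem2p9:
  fixes M :: "'a measure"
    and \<theta> :: real
    and lam a :: "real \<Rightarrow> real"
    and p :: "real \<Rightarrow> nat pmf"
    and Z :: "real \<Rightarrow> 'a \<Rightarrow> nat"
  assumes "theta_positive_branching_process M \<theta> lam a p Z"
  shows
    "(loosely_subcritical M Z \<longleftrightarrow>
        V_limit M Z lam \<theta> = \<infinity> \<and>
        \<not> (\<exists>L::ereal. 0 \<le> L \<and>
             ((\<lambda>t. ereal (mean_size M Z t powr \<theta> * V_fun M Z lam \<theta> t)) \<longlongrightarrow> L) at_top)) \<and>
     (loosely_subcritical M Z \<longrightarrow>
        (\<exists>\<tau>1 \<tau>2 L1 L2. time_sequence \<tau>1 \<and> time_sequence \<tau>2 \<and> 0 \<le> L1 \<and> 0 \<le> L2 \<and> L1 \<noteq> L2 \<and>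
           has_partial_limit M Z lam \<theta> \<tau>1 L1 \<and> has_partial_limit M Z lam \<theta> \<tau>2 L2) \<and>
        (\<forall>\<tau>. time_sequence \<tau> \<longrightarrow>
           (has_partial_limit M Z lam \<theta> \<tau> \<infinity> \<longrightarrow>
              (\<lambda>n. survival_prob M Z (\<tau> n))
                \<sim>[sequentially] (\<lambda>n. V_fun M Z lam \<theta> (\<tau> n) powr (- 1 / \<theta>)) \<and>
              (\<lambda>n. conditional_mean_size M Z (\<tau> n))
                \<sim>[sequentially]
                (\<lambda>n. mean_size M Z (\<tau> n) * V_fun M Z lam \<theta> (\<tau> n) powr (1 / \<theta>)) \<and>
              (\<forall>w\<ge>0.
                 (\<lambda>n. expectation_given_survival M Z (\<tau> n)
                        (\<lambda>z. exp (- w * real z / conditional_mean_size M Z (\<tau> n))))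
                 \<longlonglongrightarrow> (if w = 0 then 1 else 1 - (1 + w powr (- \<theta>)) powr (- 1 / \<theta>)))) \<and>
           (\<forall>K::real. 0 \<le> K \<and> has_partial_limit M Z lam \<theta> \<tau> (ereal K) \<longrightarrow>
              (let m = (K + \<theta> / (1 + \<theta>)) powr (1 / \<theta>) in
                 (\<lambda>n. mean_size M Z (\<tau> n)) \<longlonglongrightarrow> 0 \<and>
                 (\<lambda>n. survival_prob M Z (\<tau> n))
                   \<sim>[sequentially] (\<lambda>n. mean_size M Z (\<tau> n) / m) \<and>
                 (\<lambda>n. conditional_mean_size M Z (\<tau> n)) \<longlonglongrightarrow> m \<and>
                 (\<forall>s. 0 \<le> s \<and> s \<le> 1 \<longrightarrow>
                    (\<lambda>n. expectation_given_survival M Z (\<tau> n) (\<lambda>z. s ^ z))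
                    \<longlonglongrightarrow> (if s = 1 then 1
                       else 1 - m * (K - 1 / (1 + \<theta>) + (1 - s) powr (- \<theta>)) powr (- 1 / \<theta>)))))))"
proof -
  interpret theta_positive_branching_process M \<theta> lam a p Z by (rule assms)
  show ?thesis
  proof (intro conjI impI allI)
    show "loosely_subcritical M Z \<longleftrightarrow> V_limit M Z lam \<theta> = \<infinity> \<and>
        \<not> (\<exists>L::ereal. 0 \<le> L \<and>
             ((\<lambda>t. ereal (mean_size M Z t powr \<theta> * V_fun M Z lam \<theta> t)) \<longlongrightarrow> L) at_top)"
      by (rule loosely_subcritical_iff)
  next
    assume "loosely_subcritical M Z"
    then have no_limit: "\<not> (\<exists>L::ereal. 0 \<le> L \<and>
        ((\<lambda>t. ereal (mean_size M Z t powr \<theta> * V_fun M Z lam \<theta> t)) \<longlongrightarrow> L) at_top)"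
      by (simp add: loosely_subcritical_iff)
    obtain \<sigma> \<tau> L L' where "time_sequence \<sigma>" "time_sequence \<tau>" "0 \<le> L" "0 \<le> L'" "L \<noteq> L'"
      "(\<lambda>n. ereal (mean_size M Z (\<sigma> n) powr \<theta> * V_fun M Z lam \<theta> (\<sigma> n))) \<longlonglongrightarrow> L"
      "(\<lambda>n. ereal (mean_size M Z (\<tau> n) powr \<theta> * V_fun M Z lam \<theta> (\<tau> n))) \<longlonglongrightarrow> L'"
      by (rule two_partial_limits[OF _ no_limit]) (simp_all add: scaled_V_eq scaled_V_nonneg)
    then show "\<exists>\<tau>1 \<tau>2 L1 L2. time_sequence \<tau>1 \<and> time_sequence \<tau>2 \<and> 0 \<le> L1 \<and> 0 \<le> L2 \<and> L1 \<noteq> L2 \<and>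
        has_partial_limit M Z lam \<theta> \<tau>1 L1 \<and> has_partial_limit M Z lam \<theta> \<tau>2 L2"
      unfolding has_partial_limit_def by blast
  next
    fix \<tau> assume "loosely_subcritical M Z" and \<tau>: "time_sequence \<tau>"
    then have "filterlim V at_top at_top"
      by (simp add: loosely_subcritical_def extinction_prob_eq_1_iff)
    then have V: "filterlim (\<lambda>n. V (\<tau> n)) at_top sequentially"
      by (rule filterlim_compose) (use \<tau> in \<open>simp add: time_sequence_def\<close>)
    have nonneg: "0 \<le> \<tau> n" for n using \<tau> by (simp add: time_sequence_def)
    {
      assume "has_partial_limit M Z lam \<theta> \<tau> \<infinity>"
      then have top: "filterlim (\<lambda>n. scaled_V (\<tau> n)) at_top sequentially"
        by (simp add: partial_limit_iff[OF \<tau>] tendsto_PInfty_eq_at_top)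
      show "(\<lambda>n. survival_prob M Z (\<tau> n)) \<sim>[sequentially] (\<lambda>n. V_fun M Z lam \<theta> (\<tau> n) powr (- 1 / \<theta>))"
        "(\<lambda>n. conditional_mean_size M Z (\<tau> n))
           \<sim>[sequentially] (\<lambda>n. mean_size M Z (\<tau> n) * V_fun M Z lam \<theta> (\<tau> n) powr (1 / \<theta>))"
        by (rule infinite_partial_limit_survival[OF nonneg V top])+
      show "(\<lambda>n. expectation_given_survival M Z (\<tau> n)
              (\<lambda>z. exp (- w * real z / conditional_mean_size M Z (\<tau> n))))
            \<longlonglongrightarrow> (if w = 0 then 1 else 1 - (1 + w powr (- \<theta>)) powr (- 1 / \<theta>))" if "0 \<le> w" for w
        by (rule infinite_partial_limit_laplace[OF nonneg V top that])
    next
      fix K :: real assume "0 \<le> K \<and> has_partial_limit M Z lam \<theta> \<tau> (ereal K)"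
      then have K: "0 \<le> K" "(\<lambda>n. scaled_V (\<tau> n)) \<longlonglongrightarrow> K"
        by (simp_all add: partial_limit_iff[OF \<tau>])
      show "let m = (K + \<theta> / (1 + \<theta>)) powr (1 / \<theta>) in
          (\<lambda>n. mean_size M Z (\<tau> n)) \<longlonglongrightarrow> 0 \<and>
          (\<lambda>n. survival_prob M Z (\<tau> n)) \<sim>[sequentially] (\<lambda>n. mean_size M Z (\<tau> n) / m) \<and>
          (\<lambda>n. conditional_mean_size M Z (\<tau> n)) \<longlonglongrightarrow> m \<and>
          (\<forall>s. 0 \<le> s \<and> s \<le> 1 \<longrightarrow>
             (\<lambda>n. expectation_given_survival M Z (\<tau> n) (\<lambda>z. s ^ z))
             \<longlonglongrightarrow> (if s = 1 then 1
                else 1 - m * (K - 1 / (1 + \<theta>) + (1 - s) powr (- \<theta>)) powr (- 1 / \<theta>)))"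
        unfolding Let_def
        using finite_partial_limit[OF nonneg V sequentially_bot K(2,1)] by blast
    }
  qed
qed

end
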